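(* Define the following two translation-invariant Clifford QCAs (modulo phases) for qubits on the three-dimensional lattice. (i) $\alpha^{\mathrm{3F}}_{\mathrm{TQFT}}$: place two qubits $A,B$ on each face of $\mathbb{Z}^3$. For each edge $e$ put $G^\alpha_e=X^\alpha_{\delta\boldsymbol e}\prod_{f'}(Z^\alpha_{f'})^{\int\delta\boldsymbol e\cup_1\boldsymbol f'}$, $\alpha\in\{A,B\}$, and map $Z^A_f\mapsto Z^A_f\prod_e(G^B_e)^{\int\boldsymbol f\cup\boldsymbol e}=:\overline Z^A_f$, $Z^B_f\mapsto Z^B_f\prod_e(G^A_e)^{\int\boldsymbol e\cup\boldsymbol f}=:\overline Z^B_f$, $X^\alpha_f\mapsto X^\alpha_f\prod_{f'}\big(Z^\alpha_{f'}\overline Z^\alpha_{f'}\big)^{\int\boldsymbol f'\cup_1\boldsymbol f}$. (ii) $\alpha^{\mathrm{3F}}_{\mathrm{ISA}}$: on the square lattice $\mathbb{Z}^2$ place two qubits $A,B$ on each edge, let $\tilde U^\alpha_e=X^\alpha_e\prod_{e'}(Z^\alpha_{e'})^{\int\boldsymbol e\cup\boldsymbol e'}$, $W^\alpha_f=Z^\alpha_{\partial f}$, and $$A^A_e=\tilde U^A_e\prod_f(W^A_f)^{\int\boldsymbol f\cup_1\boldsymbol e},\quad A^B_e=\tilde U^B_e\prod_f(W^B_f)^{\int\boldsymbol e\cup_1\boldsymbol f}\prod_{e'}(Z^A_{e'})^{\int\boldsymbol e\cup\boldsymbol e'},$$ $$\overline A^A_e=\tilde U^A_e\prod_f(W^A_f)^{\int\boldsymbol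 e\cup_1\boldsymbol f}\prod_{e'}(Z^B_{e'})^{\int\boldsymbol e'\cup\boldsymbol e},\quad \overline A^B_e=\tilde U^B_e\prod_f(W^B_f)^{\int\boldsymbol f\cup_1\boldsymbol e}.$$ Stack copies of this two-dimensional system along a third direction, layers labelled by $j\in\mathbb{Z}$, and let $\alpha^{\mathrm{3F}}_{\mathrm{ISA}}$ send $A^\alpha_e$ in layer $j$ to $A^\alpha_e$ in layer $j+1$ and fix every $\overline A^\alpha_e$ in every layer (this determines it, since these operators generate all Pauli operators modulo phases). Then $\alpha^{\mathrm{3F}}_{\mathrm{TQFT}}$ and $\alpha^{\mathrm{3F}}_{\mathrm{ISA}}$ are equivalent Clifford QCAs, i.e. after stabilization they differ by a composition of finite-depth Clifford circuits and shifts.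
   Context: All Pauli operators are taken modulo phases. In $\mathbb{Z}^d$ an $n$-cell is a pair $(v,I)$, $v\in\mathbb{Z}^d$, $I\subset[d]=\{1,\dots,d\}$, $|I|=n$, representing $v+\{\sum_{i\in I}t_ie_i:t_i\in[0,1]\}$ (edges $n=1$, faces $n=2$); bold denotes indicator cochains. The mod-2 boundary is $\partial(v,I)=\sum_{i\in I}\big[(v,I\setminus\{i\})+(v+e_i,I\setminus\{i\})\big]$, $\delta a(c)=a(\partial c)$, $X_{\delta\boldsymbol e}=\prod_fX_f^{(\delta\boldsymbol e)(f)}$, $Z_{\partial f}=\prod_eZ_e^{(\delta\boldsymbol e)(f)}$. With $e_I=\sum_{i\in I}e_i$ and $a,b$ of degrees $p,q$: if $p+q=d$, $(a\cup b)(v,[d])=\sum_{I\sqcup J=[d],|I|=p}a(v,I)b(v+e_I,J)$; if $p+q=d+1$, $(a\cup_1b)(v,[d])=\sum_{c\in[d]}\sum_{I'\sqcup J'=[d]\setminus\{c\},|I'|=p-1}a(v+\sum_{j\in J',j>c}e_j,I'\cup\{c\})\,b(v+\sum_{i\in I',i<c}e_i,J'\cup\{c\})$. $\int$ is the sum over all $d$-cells mod 2 ($d=3$ in (i), $d=2$ in (ii)). A Clifford QCA modulo phases is a locality-preserving automorphism of the group of Pauli operators modulo phases preserving commutation relations. Finite-depth Clifford circuits are finite products of automorphisms that are block-diagonal with respect to a partition of the lattice into blocks of uniformly bounded diameter. Shifts are bounded-range permutations of qubits. Stabilization means extending a QCA by the identity on additional qubits at each site. *)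

theory Defs
  imports
    "HOL-Analysis.Cartesian_Space"
    "HOL-Library.Poly_Mapping"
    "HOL-Library.Product_Plus"
    "HOL-Library.Z2"
    "HOL-Library.FuncSet"
    "HOL-Library.Disjoint_Sets"
begin

section \<open>Cells, cochains and cup products on the cubic lattice\<close>

text \<open>
  The coordinate directions are the elements of a finite linearly ordered type. For the numeral
  types these are $0 < 1$ for type \<open>2\<close> and $0 < 1 < 2$ for type \<open>3\<close>, so direction $i$ of
  $[d] = \{1,\dots,d\}$ is the element $i - 1$. (As elements of type \<open>3\<close> one has $3 = 0$, so the
  literals $1, 2, 3$ would be in the wrong order.)
\<close>

lemma directions_2: "(UNIV :: 2 set) = {0, 1}" "(0::2) < 1"
proof -
  have zero2: "(2::2) = 0"
    by (simp add: bit0.Rep_inject_sym bit0.Rep_numeral bit0.Rep_0)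
  show "(UNIV :: 2 set) = {0, 1}"
    using UNIV_2 zero2 by auto
  show "(0::2) < 1" by (simp add: less_bit0_def bit0.Rep_0 bit0.Rep_1)
qed

lemma directions_3: "(UNIV :: 3 set) = {0, 1, 2}" "(0::3) < 1" "(1::3) < 2"
proof -
  have zero3: "(3::3) = 0"
    by (simp add: bit1.Rep_inject_sym bit1.Rep_numeral bit1.Rep_0)
  show "(UNIV :: 3 set) = {0, 1, 2}"
    using UNIV_3 zero3 by auto
  show "(0::3) < 1" by (simp add: less_bit1_def bit1.Rep_0 bit1.Rep_1)
  show "(1::3) < 2" by (simp add: less_bit1_def bit1.Rep_1 bit1.Rep_numeral)
qed

text \<open>The cell \<open>(v, I)\<close> is $v + \{\sum_{i\in I} t_i e_i : t_i \in [0,1]\}$; its dimension is \<open>card I\<close>.\<close>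

type_synonym 'd cell = "(int, 'd) vec \<times> 'd set"

definition e_sum :: "'d::finite set \<Rightarrow> (int, 'd) vec" where
  "e_sum I = (\<chi> i. of_bool (i \<in> I))"

definition cell_boundary :: "'d::finite cell \<Rightarrow> ('d cell \<Rightarrow>\<^sub>0 bit)" where
  "cell_boundary c = (case c of (v, I) \<Rightarrow>
     (\<Sum>i\<in>I. Poly_Mapping.single (v, I - {i}) 1
           + Poly_Mapping.single (v + e_sum {i}, I - {i}) 1))"

definition coboundary :: "('d::finite cell \<Rightarrow> bit) \<Rightarrow> ('d cell \<Rightarrow> bit)" where
  "coboundary a c =
     (\<Sum>c'\<in>Poly_Mapping.keys (cell_boundary c). Poly_Mapping.lookup (cell_boundary c) c' * a c')"

definition ind :: "'d cell \<Rightarrow> ('d cell \<Rightarrow> bit)" where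
  "ind c = (\<lambda>c'. of_bool (c' = c))"

text \<open>
  A cochain of top degree is written as a function of \<open>v\<close>, standing for its value on \<open>(v, UNIV)\<close>.
  The argument \<open>p\<close> is the degree of the first factor \<open>a\<close>; the second factor has degree
  $d - p$ for \<open>cup\<close> and $d + 1 - p$ for \<open>cup1\<close>.
\<close>

definition cup ::
  "nat \<Rightarrow> ('d::finite cell \<Rightarrow> bit) \<Rightarrow> ('d cell \<Rightarrow> bit) \<Rightarrow> (int, 'd) vec \<Rightarrow> bit" where
  "cup p a b v = (\<Sum>I | card I = p. a (v, I) * b (v + e_sum I, - I))"

definition cup1 ::
  "nat \<Rightarrow> ('d::{finite,linorder} cell \<Rightarrow> bit) \<Rightarrow> ('d cell \<Rightarrow> bit) \<Rightarrow> (int, 'd) vec \<Rightarrow> bit" where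
  "cup1 p a b v =
     (\<Sum>c\<in>UNIV. \<Sum>(I, J) | I \<union> J = UNIV - {c} \<and> I \<inter> J = {} \<and> card I = p - 1.
        a (v + e_sum {j \<in> J. j > c}, I \<union> {c}) * b (v + e_sum {i \<in> I. i < c}, J \<union> {c}))"

text \<open>\<^const>\<open>Sum_any\<close> sums over the points of the (finite) support.\<close>

definition lattice_integral :: "((int, 'd::finite) vec \<Rightarrow> bit) \<Rightarrow> bit" where
  "lattice_integral f = Sum_any f"


section \<open>Pauli operators modulo phases\<close>

text \<open>
  A finitely supported Pauli operator modulo phases assigns to each qubit a pair \<open>(x, z)\<close>, standing
  for $X^x Z^z$. The group of Pauli operators modulo phases is abelian and written additively.
\<close>

type_synonym 'q pauli = "'q \<Rightarrow>\<^sub>0 bit \<times> bit"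

definition paulis :: "'q set \<Rightarrow> 'q pauli set" where
  "paulis Q = {P. Poly_Mapping.keys P \<subseteq> Q}"

definition PX :: "'q \<Rightarrow> 'q pauli" where
  "PX q = Poly_Mapping.single q (1, 0)"

definition PZ :: "'q \<Rightarrow> 'q pauli" where
  "PZ q = Poly_Mapping.single q (0, 1)"

definition paulis_commute :: "'q pauli \<Rightarrow> 'q pauli \<Rightarrow> bool" where
  "paulis_commute P R \<longleftrightarrow>
     (\<Sum>q\<in>Poly_Mapping.keys P \<union> Poly_Mapping.keys R.
        fst (Poly_Mapping.lookup P q) * snd (Poly_Mapping.lookup R q)
      + snd (Poly_Mapping.lookup P q) * fst (Poly_Mapping.lookup R q)) = 0"

definition relabel :: "('q \<Rightarrow> 'r) \<Rightarrow> 'q pauli \<Rightarrow> 'r pauli" where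
  "relabel g P =
     (\<Sum>q\<in>Poly_Mapping.keys P. Poly_Mapping.single (g q) (Poly_Mapping.lookup P q))"

text \<open>
  \<open>cell_prod n F k\<close> is $\prod_c F(c)^{k(c)}$ over all \<open>n\<close>-cells \<open>c\<close>; it is used only where \<open>k\<close> has
  finitely many nonzero values on \<open>n\<close>-cells.
\<close>

definition cell_prod :: "nat \<Rightarrow> ('d cell \<Rightarrow> 'q pauli) \<Rightarrow> ('d cell \<Rightarrow> bit) \<Rightarrow> 'q pauli" where
  "cell_prod n F k = (\<Sum>c | card (snd c) = n \<and> k c = 1. F c)"

text \<open>The homomorphism with \<open>PX q \<mapsto> x q\<close> and \<open>PZ q \<mapsto> z q\<close>.\<close>

definition hom_ext :: "('q \<Rightarrow> 'r pauli) \<Rightarrow> ('q \<Rightarrow> 'r pauli) \<Rightarrow> 'q pauli \<Rightarrow> 'r pauli" where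
  "hom_ext x z P =
     (\<Sum>q\<in>Poly_Mapping.keys P.
        (if fst (Poly_Mapping.lookup P q) = 1 then x q else 0)
      + (if snd (Poly_Mapping.lookup P q) = 1 then z q else 0))"


section \<open>Clifford QCAs, circuits, shifts and equivalence\<close>

text \<open>
  A system of qubits is given by a set \<open>Q\<close> of qubits and a map \<open>pos\<close> assigning to each qubit a site of
  $\mathbb{Z}^d$.
\<close>

definition site_dist :: "(int, 'd::finite) vec \<Rightarrow> (int, 'd) vec \<Rightarrow> int" where
  "site_dist u v = (\<Sum>i\<in>UNIV. \<bar>u $ i - v $ i\<bar>)"

definition pauli_automorphism :: "'q set \<Rightarrow> ('q pauli \<Rightarrow> 'q pauli) \<Rightarrow> bool" where
  "pauli_automorphism Q \<alpha> \<longleftrightarrow>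
     bij_betw \<alpha> (paulis Q) (paulis Q) \<and>
     (\<forall>P\<in>paulis Q. \<forall>R\<in>paulis Q. \<alpha> (P + R) = \<alpha> P + \<alpha> R) \<and>
     (\<forall>P\<in>paulis Q. \<forall>R\<in>paulis Q. paulis_commute (\<alpha> P) (\<alpha> R) \<longleftrightarrow> paulis_commute P R)"

definition clifford_qca ::
  "'q set \<Rightarrow> ('q \<Rightarrow> (int, 'd::finite) vec) \<Rightarrow> ('q pauli \<Rightarrow> 'q pauli) \<Rightarrow> bool" where
  "clifford_qca Q pos \<alpha> \<longleftrightarrow>
     pauli_automorphism Q \<alpha> \<and>
     (\<exists>r. \<forall>P\<in>paulis Q. \<forall>q\<in>Poly_Mapping.keys (\<alpha> P).
        \<exists>q'\<in>Poly_Mapping.keys P. site_dist (pos q) (pos q') \<le> r)"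

text \<open>\<open>\<tau> t\<close> is the translation of the qubits by \<open>t\<close>.\<close>

definition translation_invariant ::
  "'q set \<Rightarrow> ((int, 'd::finite) vec \<Rightarrow> 'q \<Rightarrow> 'q) \<Rightarrow> ('q pauli \<Rightarrow> 'q pauli) \<Rightarrow> bool" where
  "translation_invariant Q \<tau> \<alpha> \<longleftrightarrow>
     (\<forall>t. \<forall>P\<in>paulis Q. \<alpha> (relabel (\<tau> t) P) = relabel (\<tau> t) (\<alpha> P))"

definition block_diagonal ::
  "'q set \<Rightarrow> ('q \<Rightarrow> (int, 'd::finite) vec) \<Rightarrow> ('q pauli \<Rightarrow> 'q pauli) \<Rightarrow> bool" where
  "block_diagonal Q pos \<alpha> \<longleftrightarrow>
     pauli_automorphism Q \<alpha> \<and>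
     (\<exists>\<B> r. partition_on UNIV \<B> \<and>
        (\<forall>B\<in>\<B>. \<forall>u\<in>B. \<forall>v\<in>B. site_dist u v \<le> r) \<and>
        (\<forall>B\<in>\<B>. \<alpha> ` paulis {q \<in> Q. pos q \<in> B} = paulis {q \<in> Q. pos q \<in> B}))"

inductive finite_depth_circuit ::
  "'q set \<Rightarrow> ('q \<Rightarrow> (int, 'd::finite) vec) \<Rightarrow> ('q pauli \<Rightarrow> 'q pauli) \<Rightarrow> bool"
  for Q pos where
  "finite_depth_circuit Q pos id"
| "block_diagonal Q pos \<gamma> \<Longrightarrow> finite_depth_circuit Q pos \<alpha> \<Longrightarrow>
     finite_depth_circuit Q pos (\<gamma> \<circ> \<alpha>)"

definition qubit_shift ::
  "'q set \<Rightarrow> ('q \<Rightarrow> (int, 'd::finite) vec) \<Rightarrow> ('q pauli \<Rightarrow> 'q pauli) \<Rightarrow> bool" where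
  "qubit_shift Q pos \<alpha> \<longleftrightarrow>
     (\<exists>\<pi>. bij_betw \<pi> Q Q \<and> (\<exists>r. \<forall>q\<in>Q. site_dist (pos (\<pi> q)) (pos q) \<le> r) \<and>
        (\<forall>P\<in>paulis Q. \<alpha> P = relabel \<pi> P))"

inductive circuit_shift_composition ::
  "'q set \<Rightarrow> ('q \<Rightarrow> (int, 'd::finite) vec) \<Rightarrow> ('q pauli \<Rightarrow> 'q pauli) \<Rightarrow> bool"
  for Q pos where
  "circuit_shift_composition Q pos id"
| "finite_depth_circuit Q pos \<gamma> \<Longrightarrow> circuit_shift_composition Q pos \<alpha> \<Longrightarrow>
     circuit_shift_composition Q pos (\<gamma> \<circ> \<alpha>)"
| "qubit_shift Q pos \<gamma> \<Longrightarrow> circuit_shift_composition Q pos \<alpha> \<Longrightarrow>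
     circuit_shift_composition Q pos (\<gamma> \<circ> \<alpha>)"

text \<open>Stabilization by \<open>m\<close> additional qubits at each site.\<close>

definition stab_qubits :: "'q set \<Rightarrow> nat \<Rightarrow> ('q + (int, 'd::finite) vec \<times> nat) set" where
  "stab_qubits Q m = Q <+> (UNIV \<times> {..<m})"

definition stab_pos ::
  "('q \<Rightarrow> (int, 'd::finite) vec) \<Rightarrow> 'q + (int, 'd) vec \<times> nat \<Rightarrow> (int, 'd) vec" where
  "stab_pos pos = case_sum pos fst"

definition stabilize ::
  "('q pauli \<Rightarrow> 'q pauli) \<Rightarrow>
   ('q + (int, 'd::finite) vec \<times> nat) pauli \<Rightarrow> ('q + (int, 'd) vec \<times> nat) pauli" where
  "stabilize \<alpha> P =
     relabel Inl (\<alpha> (Poly_Mapping.map_key Inl P)) + relabel Inr (Poly_Mapping.map_key Inr P)"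

text \<open>
  The two QCAs may be given on different systems of qubits over the same lattice, so after
  stabilization the qubits at each site of the first system are identified with those at the same
  site of the second by a bijection \<open>\<sigma>\<close>.
\<close>

definition qca_equivalent ::
  "'q set \<Rightarrow> ('q \<Rightarrow> (int, 'd::finite) vec) \<Rightarrow> ('q pauli \<Rightarrow> 'q pauli) \<Rightarrow>
   'r set \<Rightarrow> ('r \<Rightarrow> (int, 'd) vec) \<Rightarrow> ('r pauli \<Rightarrow> 'r pauli) \<Rightarrow> bool" where
  "qca_equivalent Q pos \<alpha> R pos' \<beta> \<longleftrightarrow>
     (\<exists>m n \<sigma> \<gamma>.
        bij_betw \<sigma> (stab_qubits Q m) (stab_qubits R n) \<and>
        (\<forall>q\<in>stab_qubits Q m. stab_pos pos' (\<sigma> q) = stab_pos pos q) \<and>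
        circuit_shift_composition (stab_qubits R n) (stab_pos pos') \<gamma> \<and>
        (\<forall>P\<in>paulis (stab_qubits Q m).
           relabel \<sigma> (stabilize \<alpha> P) = \<gamma> (stabilize \<beta> (relabel \<sigma> P))))"


section \<open>The QCA $\alpha^{3F}_{TQFT}$\<close>

datatype species = Sp_A | Sp_B

type_synonym 'd cell_qubit = "'d cell \<times> species"

definition tqft_qubits :: "3 cell_qubit set" where
  "tqft_qubits = {(f, s). card (snd f) = 2}"

definition tqft_pos :: "3 cell_qubit \<Rightarrow> (int, 3) vec" where
  "tqft_pos q = fst (fst q)"

definition tqft_translate :: "(int, 3) vec \<Rightarrow> 3 cell_qubit \<Rightarrow> 3 cell_qubit" where
  "tqft_translate t = (\<lambda>((v, I), s). ((v + t, I), s))"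

definition tqft_G :: "species \<Rightarrow> 3 cell \<Rightarrow> 3 cell_qubit pauli" where
  "tqft_G s e =
     cell_prod 2 (\<lambda>f. PX (f, s)) (coboundary (ind e))
   + cell_prod 2 (\<lambda>f'. PZ (f', s)) (\<lambda>f'. lattice_integral (cup1 2 (coboundary (ind e)) (ind f')))"

definition tqft_Zbar :: "3 cell_qubit \<Rightarrow> 3 cell_qubit pauli" where
  "tqft_Zbar q = (case q of (f, s) \<Rightarrow> PZ (f, s) + (case s of
     Sp_A \<Rightarrow> cell_prod 1 (tqft_G Sp_B) (\<lambda>e. lattice_integral (cup 2 (ind f) (ind e)))
   | Sp_B \<Rightarrow> cell_prod 1 (tqft_G Sp_A) (\<lambda>e. lattice_integral (cup 1 (ind e) (ind f)))))"

definition tqft_Xbar :: "3 cell_qubit \<Rightarrow> 3 cell_qubit pauli" where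
  "tqft_Xbar q = (case q of (f, s) \<Rightarrow> PX (f, s)
   + cell_prod 2 (\<lambda>f'. PZ (f', s) + tqft_Zbar (f', s)) (\<lambda>f'. lattice_integral (cup1 2 (ind f') (ind f))))"

definition alpha_TQFT :: "3 cell_qubit pauli \<Rightarrow> 3 cell_qubit pauli" where
  "alpha_TQFT = hom_ext tqft_Xbar tqft_Zbar"


section \<open>The QCA $\alpha^{3F}_{ISA}$\<close>

text \<open>One layer, on the square lattice.\<close>

definition isa_U :: "species \<Rightarrow> 2 cell \<Rightarrow> 2 cell_qubit pauli" where
  "isa_U s e = PX (e, s)
   + cell_prod 1 (\<lambda>e'. PZ (e', s)) (\<lambda>e'. lattice_integral (cup 1 (ind e) (ind e')))"

definition isa_W :: "species \<Rightarrow> 2 cell \<Rightarrow> 2 cell_qubit pauli" where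
  "isa_W s f = cell_prod 1 (\<lambda>e. PZ (e, s)) (\<lambda>e. coboundary (ind e) f)"

definition isa_A :: "species \<Rightarrow> 2 cell \<Rightarrow> 2 cell_qubit pauli" where
  "isa_A s e = (case s of
     Sp_A \<Rightarrow> isa_U Sp_A e
       + cell_prod 2 (isa_W Sp_A) (\<lambda>f. lattice_integral (cup1 2 (ind f) (ind e)))
   | Sp_B \<Rightarrow> isa_U Sp_B e
       + cell_prod 2 (isa_W Sp_B) (\<lambda>f. lattice_integral (cup1 1 (ind e) (ind f)))
       + cell_prod 1 (\<lambda>e'. PZ (e', Sp_A)) (\<lambda>e'. lattice_integral (cup 1 (ind e) (ind e'))))"

definition isa_Abar :: "species \<Rightarrow> 2 cell \<Rightarrow> 2 cell_qubit pauli" where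
  "isa_Abar s e = (case s of
     Sp_A \<Rightarrow> isa_U Sp_A e
       + cell_prod 2 (isa_W Sp_A) (\<lambda>f. lattice_integral (cup1 1 (ind e) (ind f)))
       + cell_prod 1 (\<lambda>e'. PZ (e', Sp_B)) (\<lambda>e'. lattice_integral (cup 1 (ind e') (ind e)))
   | Sp_B \<Rightarrow> isa_U Sp_B e
       + cell_prod 2 (isa_W Sp_B) (\<lambda>f. lattice_integral (cup1 2 (ind f) (ind e))))"

text \<open>The stack: the qubit \<open>(j, q)\<close> is the copy of \<open>q\<close> in layer \<open>j\<close>.\<close>

type_synonym stack_qubit = "int \<times> 2 cell_qubit"

definition isa_qubits :: "stack_qubit set" where
  "isa_qubits = {(j, (e, s)). card (snd e) = 1}"

definition isa_pos :: "stack_qubit \<Rightarrow> (int, 3) vec" where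
  "isa_pos = (\<lambda>(j, ((v, I), s)). \<chi> i. if i = 0 then v $ 0 else if i = 1 then v $ 1 else j)"

definition isa_translate :: "(int, 3) vec \<Rightarrow> stack_qubit \<Rightarrow> stack_qubit" where
  "isa_translate t =
     (\<lambda>(j, ((v, I), s)). (j + t $ 2, ((v + (\<chi> i. if i = 0 then t $ 0 else t $ 1), I), s)))"

definition in_layer :: "int \<Rightarrow> 2 cell_qubit pauli \<Rightarrow> stack_qubit pauli" where
  "in_layer j = relabel (Pair j)"

text \<open>
  The defining property of $\alpha^{3F}_{ISA}$ among group endomorphisms; values outside
  \<open>paulis isa_qubits\<close> are fixed by the use of \<open>\<rightarrow>\<^sub>E\<close>.
\<close>

definition is_alpha_ISA :: "(stack_qubit pauli \<Rightarrow> stack_qubit pauli) \<Rightarrow> bool" where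
  "is_alpha_ISA \<alpha> \<longleftrightarrow>
     \<alpha> \<in> paulis isa_qubits \<rightarrow>\<^sub>E paulis isa_qubits \<and>
     (\<forall>P\<in>paulis isa_qubits. \<forall>R\<in>paulis isa_qubits. \<alpha> (P + R) = \<alpha> P + \<alpha> R) \<and>
     (\<forall>j s e. card (snd e) = 1 \<longrightarrow>
        \<alpha> (in_layer j (isa_A s e)) = in_layer (j + 1) (isa_A s e) \<and>
        \<alpha> (in_layer j (isa_Abar s e)) = in_layer j (isa_Abar s e))"

definition alpha_ISA :: "stack_qubit pauli \<Rightarrow> stack_qubit pauli" where
  "alpha_ISA = (THE \<alpha>. is_alpha_ISA \<alpha>)"

end

theory Submission
  imports Defs
begin

text \<open>
  Finitely supported Pauli operators modulo phases on a translation-invariant system over \<open>\<int>\<^sup>3\<close> form a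
  module over the Laurent polynomials over the field with two elements in the translations \<open>x\<close>, \<open>y\<close>, \<open>z\<close>. Recording
  which translates of one operator anticommute with another gives a hermitian form \<open>lam\<close>. Translation-invariant
  Clifford QCAs are isometries of this form, and every isometry needed here has the shape
  \<open>p + (\<Sum> lam w p \<odot> v)\<close> for finitely many pairs \<open>(v, w)\<close>.

  The layered QCA is a pump: it multiplies by \<open>z\<close> the submodule generated by the operators \<open>A\<close>, which is an
  orthogonal summand because their Gram matrix is invertible, and it fixes the complement, generated by the
  operators \<open>Abar\<close>. The TQFT QCA is a pump too, up to circuits and shifts. It is \<open>T = 1 + C + C\<^sup>*\<close>, where
  \<open>C\<close> maps species A to species B and equals \<open>C0 + z C1\<close>, with \<open>C0\<close> and \<open>C1\<close> (\<open>AB0\<close> and \<open>AB1\<close> below)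
  free of \<open>z\<close>. Shifting species A by one layer turns \<open>T\<close> into \<open>T\<close> at \<open>z = 1\<close> followed by the pump of the graph of
  \<open>C1\<close>, see \<open>T_decomp\<close>. By \<open>lam_AB1_AB1\<close> the form on that graph is the standard form on the species A operators
  plus a form of rank one. In a suitable basis (\<open>gram_q\<close>) its matrix is that of the operators \<open>A\<close> of
  one layer together with that of a single qubit.

  It remains to compare two pumps on orthogonal submodules with the same Gram matrix. This is
  \<open>swap_pump\<close>: two exchanges of the submodules, one of them twisted by \<open>z\<close>, turn one pump into the other, and
  each exchange is a product of Clifford rotations about mutually commuting operators. Such products
  are finite-depth circuits, since the translates of a local operator can be distributed over finitely
  many classes with disjoint supports within each class (\<open>rotation_circuit\<close>). Also \<open>T\<close> at \<open>z = 1\<close> is a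
  product of such rotations (\<open>T_at_1_sym_map\<close>), and the pump of the single qubit is a shift. The resulting
  identity, \<open>T_pump\<close>, takes place on the six face qubits, the four edge qubits and one spare qubit at each site.

  The remaining work identifies \<open>T\<close> and the pump with the two QCAs as given by cup products.
\<close>

section \<open>Hermitian modules in characteristic two\<close>

text \<open>
  The Pauli group of a translation-invariant system is a module over a Laurent polynomial ring, with a
  hermitian form recording which translates commute; all maps below are built from that form. The
  signs disappear because the ring has characteristic 2.
\<close>

locale hermitian_module = module scale
  for scale :: "'r::comm_ring_1 \<Rightarrow> 'p::ab_group_add \<Rightarrow> 'p" (infixr \<open>\<odot>\<close> 75) +
  fixes cnj :: "'r \<Rightarrow> 'r" and lam :: "'p \<Rightarrow> 'p \<Rightarrow> 'r"
  assumes char2: "(1::'r) + 1 = 0"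
    and cnj_add: "cnj (a + b) = cnj a + cnj b"
    and cnj_mult: "cnj (a * b) = cnj a * cnj b"
    and cnj_cnj: "cnj (cnj a) = a"
    and lam_add_right: "lam p (q + r) = lam p q + lam p r"
    and lam_scale_right: "lam p (a \<odot> q) = a * lam p q"
    and cnj_lam: "cnj (lam p q) = lam q p"
begin

lemma r_double: "(a::'r) + a = 0"
proof -
  have "a + a = a * (1 + 1)" by (simp only: distrib_left mult_1_right)
  then show ?thesis by (simp only: char2 mult_zero_right)
qed

lemma r_double': "(a::'r) + (a + b) = b"
  by (simp add: add.assoc[symmetric] r_double)

lemma p_double: "(p::'p) + p = 0"
proof -
  have "p + p = (1 + 1) \<odot> p" by (simp only: scale_left_distrib scale_one)
  then show ?thesis by (simp only: char2 scale_zero_left)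
qed

lemma p_double': "(p::'p) + (p + q) = q"
  by (simp add: add.assoc[symmetric] p_double)

lemma r_minus: "- (a::'r) = a"
  by (rule minus_unique) (rule r_double)

lemma cnj_0: "cnj 0 = 0"
  using cnj_add[of 0 0] by simp

lemma cnj_1: "cnj 1 = 1"
  using cnj_mult[of "cnj 1" 1] by (simp add: cnj_cnj)

lemma lam_add_left: "lam (p + q) r = lam p r + lam q r"
  using arg_cong[OF lam_add_right[of r p q], of cnj] by (simp only: cnj_add cnj_lam)

lemma lam_scale_left: "lam (a \<odot> p) q = cnj a * lam p q"
  using arg_cong[OF lam_scale_right[of q a p], of cnj] by (simp only: cnj_mult cnj_lam)

lemma lam_zero_right: "lam p 0 = 0"
  using lam_scale_right[of p 0 0] by simp

lemma lam_zero_left: "lam 0 p = 0"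
  using lam_scale_left[of 0 0 p] by (simp add: cnj_0)

lemma lam_sum_right: "lam p (sum f I) = (\<Sum>i\<in>I. lam p (f i))"
  by (induction I rule: infinite_finite_induct) (auto simp: lam_zero_right lam_add_right)

lemma lam_sum_left: "lam (sum f I) p = (\<Sum>i\<in>I. lam (f i) p)"
  by (induction I rule: infinite_finite_induct) (auto simp: lam_zero_left lam_add_left)

lemma lam_zero_sym: "lam p q = 0 \<Longrightarrow> lam q p = 0"
  using cnj_lam[of p q] by (simp only: cnj_0)

text \<open>
  If \<open>N\<close> inverts the Gram matrix of \<open>v\<close>, then \<open>cross N I v v\<close> is the orthogonal projection onto the
  span of the \<open>v i\<close>.
\<close>

definition cross where
  "cross N I v w p = (\<Sum>i\<in>I. \<Sum>j\<in>I. (N i j * lam (w j) p) \<odot> v i)"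

lemma cross_add: "cross N I v w (p + q) = cross N I v w p + cross N I v w q"
  by (simp add: cross_def lam_add_right distrib_left scale_left_distrib sum.distrib)

lemma cross_scale: "cross N I v w (a \<odot> p) = a \<odot> cross N I v w p"
  by (simp add: cross_def lam_scale_right scale_sum_right mult.left_commute)

lemma cross_orth: "(\<And>j. j \<in> I \<Longrightarrow> lam (w j) p = 0) \<Longrightarrow> cross N I v w p = 0"
  by (simp add: cross_def)

lemma cross_sum: "cross N I v w (sum f J) = (\<Sum>k\<in>J. cross N I v w (f k))"
proof -
  have "cross N I v w 0 = 0" by (rule cross_orth) (rule lam_zero_right)
  then show ?thesis
    by (induction J rule: infinite_finite_induct) (auto simp: cross_add)
qed

lemma cross_gen:
  assumes "finite I" "k \<in> I" "\<And>i. i \<in> I \<Longrightarrow> (\<Sum>j\<in>I. N i j * lam (w j) p) = of_bool (i = k)"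
  shows "cross N I v w p = v k"
proof -
  have "cross N I v w p = (\<Sum>i\<in>I. of_bool (i = k) \<odot> v i)"
    unfolding cross_def by (rule sum.cong[OF refl]) (simp add: assms(3)[symmetric] scale_sum_left)
  also have "\<dots> = (\<Sum>i\<in>I. if i = k then v i else 0)"
    by (rule sum.cong) auto
  finally show ?thesis using assms(1,2) by simp
qed

lemma cross_cross:
  assumes "finite I" "\<And>i k. i \<in> I \<Longrightarrow> k \<in> I \<Longrightarrow> (\<Sum>j\<in>I. N i j * lam (w j) (v' k)) = of_bool (i = k)"
  shows "cross N I v w (cross N I v' w' p) = cross N I v w' p"
  unfolding cross_def[of N I v' w' p] cross_def[of N I v w' p]
  by (simp add: cross_sum cross_scale cross_gen assms)

lemma cross_cross_orth:
  assumes "\<And>j k. j \<in> I \<Longrightarrow> k \<in> I \<Longrightarrow> lam (w j) (v' k) = 0"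
  shows "cross N I v w (cross N I v' w' p) = 0"
  by (rule cross_orth) (simp add: cross_def[of N I v' w' p] lam_sum_right lam_scale_right assms)

lemma cross_adjoint:
  assumes "\<And>i j. i \<in> I \<Longrightarrow> j \<in> I \<Longrightarrow> cnj (N i j) = N j i"
  shows "lam (cross N I v v p) r = lam p (cross N I v v r)"
proof -
  have "lam (cross N I v v p) r = (\<Sum>i\<in>I. \<Sum>j\<in>I. N j i * lam p (v j) * lam (v i) r)"
    by (simp add: cross_def lam_sum_left lam_scale_left cnj_mult cnj_lam assms cong: sum.cong)
  also have "\<dots> = (\<Sum>j\<in>I. \<Sum>i\<in>I. N j i * lam p (v j) * lam (v i) r)"
    by (rule sum.swap)
  also have "\<dots> = lam p (cross N I v v r)"
    by (simp add: cross_def lam_sum_right lam_scale_right mult_ac)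
  finally show ?thesis .
qed

text \<open>
  Multiplying an orthogonal summand by a unitary scalar and fixing its complement preserves the form.
  With \<open>u\<close> a monomial this pumps the operators of the summand along a lattice direction.
\<close>

lemma pump_isometry:
  assumes "finite I" and u: "u * cnj u = 1"
    and v: "\<And>i k. i \<in> I \<Longrightarrow> k \<in> I \<Longrightarrow> (\<Sum>j\<in>I. N i j * lam (v j) (v k)) = of_bool (i = k)"
    and N: "\<And>i j. i \<in> I \<Longrightarrow> j \<in> I \<Longrightarrow> cnj (N i j) = N j i"
  defines "pump \<equiv> \<lambda>u p. p + (1 + u) \<odot> cross N I v v p"
  shows "lam (pump u p) (pump u r) = lam p r"
    and "pump (cnj u) (pump u p) = p" and "pump u (pump (cnj u) p) = p"
proof -
  let ?P = "cross N I v v"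
  have PP: "?P (?P p) = ?P p" for p by (rule cross_cross[OF assms(1) v])
  have adj: "lam (?P p) r = lam p (?P r)" for p r by (rule cross_adjoint[OF N])
  have u': "cnj u * u = 1" "u * (cnj u * w) = w" for w
    using u by (simp_all add: mult.assoc[symmetric] mult.commute)
  show "lam (pump u p) (pump u r) = lam p r"
    by (simp add: pump_def lam_add_left lam_add_right lam_scale_left lam_scale_right adj PP cnj_add cnj_1
        distrib_left distrib_right mult.assoc u u' r_double r_double' add_ac)
  show "pump (cnj u) (pump u p) = p" "pump u (pump (cnj u) p) = p"
    by (simp_all add: pump_def cross_add cross_scale PP scale_left_distrib scale_right_distrib
        u u' p_double p_double' add_ac)
qed

text \<open>
  Because \<open>q\<close> and \<open>a\<close> are orthogonal and have the same Gram matrix with inverse \<open>N\<close>, the map \<open>swp u\<close> exchanges them: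
  it sends \<open>q k\<close> to \<open>u \<odot> a k\<close> and \<open>a k\<close> to \<open>cnj u \<odot> q k\<close>. Hence \<open>swp 1 \<circ> swp u\<close> multiplies \<open>q\<close> by \<open>u\<close> and
  \<open>a\<close> by \<open>cnj u\<close>, which moves a pump from one summand to the other. The point of writing it in this
  way is that each \<open>swp u\<close> is a product of commuting rotations: the vectors \<open>q i + u \<odot> a i\<close> span an
  isotropic submodule, the two equal Gram matrices cancelling in characteristic 2.
\<close>

lemma swap_pump:
  assumes "finite I" and u: "u * cnj u = 1"
    and q: "\<And>i k. i \<in> I \<Longrightarrow> k \<in> I \<Longrightarrow> (\<Sum>j\<in>I. N i j * lam (q j) (q k)) = of_bool (i = k)"
    and a: "\<And>i k. i \<in> I \<Longrightarrow> k \<in> I \<Longrightarrow> (\<Sum>j\<in>I. N i j * lam (a j) (a k)) = of_bool (i = k)"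
    and qa: "\<And>i k. i \<in> I \<Longrightarrow> k \<in> I \<Longrightarrow> lam (q i) (a k) = 0"
  defines "swap_rot \<equiv> \<lambda>u p. p + cross N I (\<lambda>i. q i + u \<odot> a i) (\<lambda>i. q i + u \<odot> a i) p"
  shows "swap_rot 1 (swap_rot u (p + (1 + u) \<odot> cross N I a a p)) = p + (1 + u) \<odot> cross N I q q p"
proof -
  have aq: "lam (a i) (q k) = 0" if "i \<in> I" "k \<in> I" for i k
    by (rule lam_zero_sym) (rule qa[OF that(2,1)])
  have swap_rot: "swap_rot t p = p + cross N I q q p + cnj t \<odot> cross N I q a p + t \<odot> cross N I a q p
      + (t * cnj t) \<odot> cross N I a a p" for t p
    by (simp add: swap_rot_def cross_def lam_add_left lam_scale_left scale_right_distrib scale_left_distrib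
        distrib_left sum.distrib scale_sum_right add_ac mult_ac)
  note c = cross_cross[OF assms(1) q] cross_cross[OF assms(1) a]
    cross_cross_orth[OF qa] cross_cross_orth[OF aq]
  have u': "u * (cnj u * w) = w" "cnj u * u = 1" "cnj u * (u * w) = w" for w
    using u by (simp_all add: mult.assoc[symmetric] mult.commute)
  show ?thesis
    by (simp add: swap_rot cross_add cross_scale c u u' cnj_1 scale_right_distrib scale_left_distrib
        scale_scale p_double p_double' add_ac)
qed

text \<open>
  A finite list of pairs presents a module map by local data; locality, translation invariance and
  the effect of relabelling the qubits can all be read off from such a list.
\<close>

definition lin :: "('p \<times> 'p) list \<Rightarrow> 'p \<Rightarrow> 'p" where
  "lin L p = (\<Sum>(v, w)\<leftarrow>L. lam w p \<odot> v)"

text \<open>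
  When the entries of the list are mutually orthogonal, \<open>p + sym_map L p\<close> is a product of rotations,
  see \<open>sym_map_circuit\<close>.
\<close>

definition sym_map :: "('p \<times> 'p) list \<Rightarrow> 'p \<Rightarrow> 'p" where
  "sym_map L p = (\<Sum>(v, w)\<leftarrow>L. lam w p \<odot> v + lam v p \<odot> w)"

lemma lin_add: "lin L (p + r) = lin L p + lin L r"
proof (induction L)
  case (Cons vw L)
  then show ?case
    by (cases vw) (simp add: lin_def lam_add_right scale_left_distrib add_ac)
qed (simp add: lin_def)

lemma lin_scale: "lin L (a \<odot> p) = a \<odot> lin L p"
proof (induction L)
  case (Cons vw L)
  then show ?case
    by (cases vw) (simp add: lin_def lam_scale_right scale_right_distrib)
qed (simp add: lin_def)

lemmas cnj_simps = cnj_add cnj_mult cnj_cnj cnj_0 cnj_1 cnj_lam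
lemmas lam_simps = lam_add_left lam_add_right lam_scale_left lam_scale_right
  lam_zero_left lam_zero_right

end

lemma dirs3: "(0::3) \<noteq> 1" "(1::3) \<noteq> 0" "(0::3) \<noteq> 2" "(2::3) \<noteq> 0" "(1::3) \<noteq> 2" "(2::3) \<noteq> 1"
  using directions_3(2,3) by auto

text \<open>
  The units \<open>x0\<close>, \<open>y0\<close>, \<open>z0\<close> stand for the translations in the three directions and \<open>x1\<close>, \<open>y1\<close>, \<open>z1\<close> for their
  inverses.
\<close>

locale laurent_module = hermitian_module +
  fixes x0 x1 y0 y1 z0 z1 :: 'a
  assumes units: "x0 * x1 = 1" "y0 * y1 = 1" "z0 * z1 = 1"
    and cnj_units: "cnj x0 = x1" "cnj y0 = y1" "cnj z0 = z1"
begin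

lemma units': "x0 * (x1 * w) = w" "y0 * (y1 * w) = w" "z0 * (z1 * w) = w"
  by (simp_all add: mult.assoc[symmetric] units)

lemma cnj_units': "cnj x1 = x0" "cnj y1 = y0" "cnj z1 = z0"
  using cnj_units cnj_cnj by auto

lemmas ring_nf = distrib_left distrib_right mult.assoc mult.commute mult.left_commute
  add.assoc add.commute add.left_commute units units' r_double r_double' r_minus
lemmas vec_nf = ring_nf scale_left_distrib scale_right_distrib scale_scale scale_one
  scale_zero_left scale_zero_right p_double p_double'
lemmas unit_simps = lam_simps cnj_simps cnj_units cnj_units'

text \<open>
  The upper left block is the Gram matrix of the operators \<open>A\<close> of the layered system (species A and
  B, two edge directions each); the lower right block is a single qubit. The six
  generators of the species A face operators will have this Gram matrix after a deformation and a
  change of basis. The inverse differs from it only in the diagonal.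
\<close>

definition theta where "theta i j = [
  [y0 + y1, (1 + y0) * (1 + x1), 0, y0, 0, 0],
  [(1 + y1) * (1 + x0), x0 + x1, x0, 0, 0, 0],
  [0, x1, y0 + y1, (1 + y0) * (1 + x1), 0, 0],
  [y1, 0, (1 + y1) * (1 + x0), x0 + x1, 0, 0],
  [0, 0, 0, 0, 0, 1],
  [0, 0, 0, 0, 1, 0]] ! i ! j"

definition theta_inv where "theta_inv i j = [
  [x0 + x1, (1 + y0) * (1 + x1), 0, y0, 0, 0],
  [(1 + y1) * (1 + x0), y0 + y1, x0, 0, 0, 0],
  [0, x1, x0 + x1, (1 + y0) * (1 + x1), 0, 0],
  [y1, 0, (1 + y1) * (1 + x0), y0 + y1, 0, 0],
  [0, 0, 0, 0, 0, 1],
  [0, 0, 0, 0, 1, 0]] ! i ! j"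

lemma less6: "{..<6::nat} = {0,1,2,3,4,5}" by auto

lemma theta_inv_theta: "i \<in> {..<6} \<Longrightarrow> k \<in> {..<6} \<Longrightarrow>
  (\<Sum>j\<in>{..<6}. theta_inv i j * theta j k) = of_bool (i = k)"
  unfolding less6 theta_def theta_inv_def
  by (elim insertE emptyE; simp add: ring_nf)

lemma theta_gram_inverse:
  assumes "\<And>i k. i \<in> {..<6} \<Longrightarrow> k \<in> {..<6} \<Longrightarrow> lam (v i) (v k) = theta i k" "i \<in> {..<6}" "k \<in> {..<6}"
  shows "(\<Sum>j\<in>{..<6}. theta_inv i j * lam (v j) (v k)) = of_bool (i = k)"
proof -
  have "(\<Sum>j\<in>{..<6}. theta_inv i j * lam (v j) (v k)) = (\<Sum>j\<in>{..<6}. theta_inv i j * theta j k)"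
    by (rule sum.cong) (simp_all only: assms)
  then show ?thesis by (simp only: theta_inv_theta[OF assms(2,3)])
qed

lemma cnj_theta_inv: "i \<in> {..<6} \<Longrightarrow> j \<in> {..<6} \<Longrightarrow> cnj (theta_inv i j) = theta_inv j i"
  unfolding less6 theta_inv_def
  by (elim insertE emptyE; simp add: unit_simps ring_nf)

text \<open>
  The form \<open>theta_inv\<close> is of the shape \<open>M + M\<^sup>*\<close>, since its diagonal entries are \<open>r + cnj r\<close>. Therefore the
  projection is a symmetrized list, as required for decomposing it into rotations.
\<close>

lemma cross_theta_inv: "cross theta_inv {..<6} w w = sym_map
  [(x0 \<odot> w 0, w 0), (((1 + y0) * (1 + x1)) \<odot> w 0, w 1), (y0 \<odot> w 0, w 3), (y0 \<odot> w 1, w 1),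
   (x0 \<odot> w 1, w 2), (x0 \<odot> w 2, w 2), (((1 + y0) * (1 + x1)) \<odot> w 2, w 3), (y0 \<odot> w 3, w 3),
   (w 4, w 5)]"
  unfolding less6
  by (rule ext) (simp add: cross_def sym_map_def theta_inv_def unit_simps vec_nf)

end

section \<open>The factorization of the TQFT automorphism\<close>

text \<open>
  One face of each orientation at the origin: \<open>X s i\<close> and \<open>Z s i\<close> act on the face orthogonal to
  direction \<open>i\<close>.
\<close>

locale face_frame = laurent_module +
  fixes X Z :: "species \<Rightarrow> 3 \<Rightarrow> 'b"
  assumes lam_XX: "lam (X s i) (X t k) = 0"
    and lam_ZZ: "lam (Z s i) (Z t k) = 0"
    and lam_XZ: "lam (X s i) (Z t k) = of_bool (s = t \<and> i = k)"
begin

lemma lam_ZX: "lam (Z s i) (X t k) = of_bool (s = t \<and> i = k)"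
  using arg_cong[OF lam_XZ[of t k s i], of cnj] by (auto simp: cnj_lam cnj_0 cnj_1)

lemmas frame_simps = unit_simps lam_XX lam_ZZ lam_XZ lam_ZX

text \<open>
  The operators \<open>j1\<close>, \<open>j2\<close> and \<open>j3 = k0 + z1 \<odot> k1\<close> are the flux operators of the three faces at the
  origin, whose combinations are the edge operators \<open>G\<close>: \<open>nA\<close> is \<open>G\<close> of species A at the vertical edge, and
  \<open>nB\<close> is a translate of \<open>G\<close> of species B at such an edge. Splitting \<open>j3\<close> isolates all dependence on the
  vertical translation.
\<close>

definition j1 where "j1 s = X s 0 + y0 \<odot> Z s 1 + Z s 2"
definition j2 where "j2 s = X s 1 + x0 \<odot> Z s 0 + y1 \<odot> Z s 2"
definition k0 where "k0 s = X s 2"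
definition k1 where "k1 s = x0 \<odot> Z s 0 + Z s 1"
definition nA where "nA = (1 + y1) \<odot> j1 Sp_A + (1 + x1) \<odot> j2 Sp_A"
definition nB where "nB = (x0 * (1 + y0)) \<odot> j1 Sp_B + (y0 * (1 + x0)) \<odot> j2 Sp_B"

lemma gram_jk:
  "lam (j1 s) (j1 t) = 0" "lam (j2 s) (j2 t) = 0"
  "lam (j1 s) (j2 t) = (if s = t then x0 + y1 else 0)"
  "lam (j2 s) (j1 t) = (if s = t then x1 + y0 else 0)"
  "lam (j1 s) (k0 t) = (if s = t then 1 else 0)" "lam (j1 s) (k1 t) = (if s = t then x0 else 0)"
  "lam (j2 s) (k0 t) = (if s = t then y0 else 0)" "lam (j2 s) (k1 t) = (if s = t then 1 else 0)"
  "lam (k0 s) (j1 t) = (if s = t then 1 else 0)" "lam (k1 s) (j1 t) = (if s = t then x1 else 0)"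
  "lam (k0 s) (j2 t) = (if s = t then y1 else 0)" "lam (k1 s) (j2 t) = (if s = t then 1 else 0)"
  "lam (k0 s) (k0 t) = 0" "lam (k0 s) (k1 t) = 0" "lam (k1 s) (k0 t) = 0" "lam (k1 s) (k1 t) = 0"
  by (auto simp: j1_def j2_def k0_def k1_def frame_simps ring_nf dirs3)

text \<open>
  The QCA is \<open>T = 1 + C + C\<^sup>*\<close>, where \<open>C\<close> maps species A to species B. It has degree one in the
  vertical translation, \<open>C = AB0 + z0 \<odot> AB1\<close>; \<open>BA0\<close> and \<open>BA1\<close> are the adjoints of \<open>AB0\<close> and \<open>AB1\<close>.
\<close>

definition AB0 where "AB0 p = (x0 * lam (j2 Sp_A) p) \<odot> j1 Sp_B + (y0 * lam (j1 Sp_A) p) \<odot> j2 Sp_B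
  + lam nA p \<odot> k1 Sp_B + lam (k0 Sp_A) p \<odot> nB"
definition AB1 where "AB1 p = (x0 * lam (j2 Sp_A) p) \<odot> j1 Sp_B + (y0 * lam (j1 Sp_A) p) \<odot> j2 Sp_B
  + lam nA p \<odot> k0 Sp_B + lam (k1 Sp_A) p \<odot> nB"
definition BA0 where "BA0 p = (x1 * lam (j1 Sp_B) p) \<odot> j2 Sp_A + (y1 * lam (j2 Sp_B) p) \<odot> j1 Sp_A
  + lam (k1 Sp_B) p \<odot> nA + lam nB p \<odot> k0 Sp_A"
definition BA1 where "BA1 p = (x1 * lam (j1 Sp_B) p) \<odot> j2 Sp_A + (y1 * lam (j2 Sp_B) p) \<odot> j1 Sp_A
  + lam (k0 Sp_B) p \<odot> nA + lam nB p \<odot> k1 Sp_A"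

text \<open>
  The three relations of this kind carry the factorization: the images of \<open>AB1\<close> and \<open>AB0\<close> are
  orthogonal, the form pulled back along \<open>AB1\<close> has rank one, and \<open>AB1\<close> kills the image of \<open>BA0\<close>.
\<close>

lemma lam_AB1_AB0: "lam (AB1 p) (AB0 q) = 0"
  by (simp add: AB1_def AB0_def nB_def nA_def gram_jk frame_simps ring_nf)

lemma lam_AB1_AB1: "lam (AB1 p) (AB1 q) = lam p nA * lam nA q"
  by (simp add: AB1_def AB0_def nB_def nA_def gram_jk frame_simps ring_nf)

lemma AB1_BA0: "AB1 (BA0 p) = 0"
  by (simp add: AB1_def BA0_def nB_def nA_def gram_jk frame_simps vec_nf)

lemma coupling_add: "AB0 (p + q) = AB0 p + AB0 q" "AB1 (p + q) = AB1 p + AB1 q"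
  "BA0 (p + q) = BA0 p + BA0 q" "BA1 (p + q) = BA1 p + BA1 q"
  by (simp_all add: AB0_def AB1_def BA0_def BA1_def frame_simps vec_nf)

lemma coupling_scale: "AB0 (a \<odot> p) = a \<odot> AB0 p" "AB1 (a \<odot> p) = a \<odot> AB1 p"
  "BA0 (a \<odot> p) = a \<odot> BA0 p" "BA1 (a \<odot> p) = a \<odot> BA1 p"
  by (simp_all add: AB0_def AB1_def BA0_def BA1_def frame_simps vec_nf)

text \<open>
  Corrections of \<open>j1\<close> and \<open>j2\<close> by a \<open>Z\<close>, which make all their translates commute.
\<close>

definition h1 where "h1 = X Sp_A 0 + (y0 + x1) \<odot> Z Sp_A 1 + Z Sp_A 2"
definition h2 where "h2 = X Sp_A 1 + (x0 + y1) \<odot> Z Sp_A 0 + y1 \<odot> Z Sp_A 2"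
definition nu where "nu = (1 + y1) \<odot> h1 + (1 + x1) \<odot> h2"
text \<open>
  A basis of the species A operators, chosen such that the deformed form
  \<open>lam (u i) (u k) + lam (u i) nA * lam nA (u k)\<close> has the matrix \<open>theta\<close>. By \<open>lam_AB1_AB1\<close> this is the Gram
  matrix of the graph of \<open>AB1\<close>, spanned by the \<open>q k\<close>.
\<close>

definition u where "u = (!) [(x1 * y1) \<odot> h2 + (1 + y1) \<odot> nu, (x1 * y1) \<odot> h1 + (1 + x1) \<odot> nu,
  y1 \<odot> Z Sp_A 0, x1 \<odot> Z Sp_A 1, X Sp_A 2 + Z Sp_A 0 + y0 \<odot> Z Sp_A 1, Z Sp_A 2]"
definition q where "q k = u k + AB1 (u k)"

lemma gram_h: "lam h1 h1 = 0" "lam h1 h2 = 0" "lam h2 h1 = 0" "lam h2 h2 = 0"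
  by (simp_all add: h1_def h2_def frame_simps dirs3 ring_nf)
lemma h_Z: "lam h1 (Z Sp_A 0) = 1" "lam h1 (Z Sp_A 1) = 0" "lam h1 (Z Sp_A 2) = 0"
  "lam h2 (Z Sp_A 0) = 0" "lam h2 (Z Sp_A 1) = 1" "lam h2 (Z Sp_A 2) = 0"
  "lam (Z Sp_A 0) h1 = 1" "lam (Z Sp_A 1) h1 = 0" "lam (Z Sp_A 2) h1 = 0"
  "lam (Z Sp_A 0) h2 = 0" "lam (Z Sp_A 1) h2 = 1" "lam (Z Sp_A 2) h2 = 0"
  by (simp_all add: h1_def h2_def frame_simps dirs3 ring_nf)

lemma nA_alt: "nA = nu + (y1 * (1 + x1)) \<odot> Z Sp_A 0 + (x1 * (1 + y1)) \<odot> Z Sp_A 1"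
  by (simp add: nA_def nu_def h1_def h2_def j1_def j2_def vec_nf)

lemma lam_X2: "lam (X Sp_A 2) h1 = 1" "lam (X Sp_A 2) h2 = y1" "lam h1 (X Sp_A 2) = 1" "lam h2 (X Sp_A 2) = y0"
  by (simp_all add: h1_def h2_def frame_simps dirs3 ring_nf)

lemma lam_A_B:
  "lam (X Sp_A i) (j1 Sp_B) = 0" "lam (X Sp_A i) (j2 Sp_B) = 0" "lam (X Sp_A i) (k0 Sp_B) = 0"
  "lam (X Sp_A i) (k1 Sp_B) = 0" "lam (X Sp_A i) nB = 0"
  "lam (Z Sp_A i) (j1 Sp_B) = 0" "lam (Z Sp_A i) (j2 Sp_B) = 0" "lam (Z Sp_A i) (k0 Sp_B) = 0"
  "lam (Z Sp_A i) (k1 Sp_B) = 0" "lam (Z Sp_A i) nB = 0"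
  by (simp_all add: j1_def j2_def k0_def k1_def nB_def frame_simps)

text \<open>
  Holds for the species A operators; it removes the cross terms from the Gram matrix of a graph.
\<close>

definition orth_AB where "orth_AB p \<longleftrightarrow> (\<forall>c. lam p (AB0 c) = 0 \<and> lam p (AB1 c) = 0)"

lemma orth_AB_lin: "orth_AB p \<Longrightarrow> orth_AB r \<Longrightarrow> orth_AB (p + r)" "orth_AB p \<Longrightarrow> orth_AB (a \<odot> p)"
  by (auto simp: orth_AB_def lam_simps)

lemma orth_AB_A: "orth_AB (X Sp_A i)" "orth_AB (Z Sp_A i)"
  by (simp_all add: orth_AB_def AB0_def AB1_def lam_A_B lam_simps)

lemma orth_AB_u: "i \<in> {..<6} \<Longrightarrow> orth_AB (u i)"
  unfolding less6
  by (elim insertE emptyE; simp add: u_def nu_def h1_def h2_def orth_AB_lin orth_AB_A)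

lemma lam_q: "i \<in> {..<6} \<Longrightarrow> k \<in> {..<6} \<Longrightarrow>
    lam (q i) (q k) = lam (u i) (u k) + lam (u i) nA * lam nA (u k)"
  using orth_AB_u[of i] orth_AB_u[of k]
  by (simp add: q_def lam_simps lam_AB1_AB1 orth_AB_def lam_zero_sym)

lemma gram_q: "i \<in> {..<6} \<Longrightarrow> k \<in> {..<6} \<Longrightarrow> lam (q i) (q k) = theta i k"
  unfolding lam_q unfolding less6 theta_def
  by (elim insertE emptyE; simp add: u_def nA_alt nu_def gram_h h_Z lam_X2 frame_simps dirs3 ring_nf)

text \<open>
  \<open>projQ\<close> is the projection onto the graph of \<open>AB1\<close> over species A, \<open>piA\<close> the projection onto species A, and
  \<open>T_at_1\<close> is \<open>T\<close> with the vertical translation replaced by 1.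
\<close>

definition projQ where "projQ = cross theta_inv {..<6} q q"
definition piA where "piA p = (\<Sum>i\<in>UNIV. lam (Z Sp_A i) p \<odot> X Sp_A i + lam (X Sp_A i) p \<odot> Z Sp_A i)"
definition T where "T p = p + AB0 p + z0 \<odot> AB1 p + BA0 p + z1 \<odot> BA1 p"
definition T_at_1 where "T_at_1 p = p + AB0 p + AB1 p + BA0 p + BA1 p"

lemma projQ_add: "projQ (p + r) = projQ p + projQ r"
  by (simp add: projQ_def cross_add)
lemma projQ_scale: "projQ (a \<odot> p) = a \<odot> projQ p"
  by (simp add: projQ_def cross_scale)

lemma projQ_q: "k \<in> {..<6} \<Longrightarrow> projQ (q k) = q k"
  unfolding projQ_def
  by (rule cross_gen) (simp_all add: gram_q theta_inv_theta[simplified])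

text \<open>
  That \<open>p + AB1 p\<close> lies in the graph is stated by means of the projection onto it.
\<close>

definition graph_fix where "graph_fix p \<longleftrightarrow> projQ (p + AB1 p) = p + AB1 p"

lemma graph_fix_lin: "graph_fix p \<Longrightarrow> graph_fix r \<Longrightarrow> graph_fix (p + r)"
  "graph_fix p \<Longrightarrow> graph_fix (a \<odot> p)"
proof -
  assume "graph_fix p"
  then have p: "projQ p + projQ (AB1 p) = p + AB1 p" by (simp add: graph_fix_def projQ_add)
  then show "graph_fix (a \<odot> p)"
    by (simp add: graph_fix_def coupling_scale projQ_add projQ_scale scale_right_distrib[symmetric])
  assume "graph_fix r"
  then have r: "projQ r + projQ (AB1 r) = r + AB1 r" by (simp add: graph_fix_def projQ_add)
  have "projQ (p + r + AB1 (p + r)) = (projQ p + projQ (AB1 p)) + (projQ r + projQ (AB1 r))"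
    by (simp add: coupling_add projQ_add add_ac)
  then show "graph_fix (p + r)" unfolding p r by (simp add: graph_fix_def coupling_add add_ac)
qed

lemma graph_fix_u: "k \<in> {..<6} \<Longrightarrow> graph_fix (u k)"
  using projQ_q by (simp add: graph_fix_def q_def)

lemma A_from_u:
  "nu = (y0 * (1 + x0)) \<odot> u 0 + (x0 * (1 + y0)) \<odot> u 1"
  "h2 = (x0 * y0) \<odot> (u 0 + (1 + y1) \<odot> nu)"
  "h1 = (x0 * y0) \<odot> (u 1 + (1 + x1) \<odot> nu)"
  "Z Sp_A 0 = y0 \<odot> u 2" "Z Sp_A 1 = x0 \<odot> u 3" "Z Sp_A 2 = u 5"
  "X Sp_A 2 = u 4 + Z Sp_A 0 + y0 \<odot> Z Sp_A 1"
  "X Sp_A 0 = h1 + (y0 + x1) \<odot> Z Sp_A 1 + Z Sp_A 2"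
  "X Sp_A 1 = h2 + (x0 + y1) \<odot> Z Sp_A 0 + y1 \<odot> Z Sp_A 2"
  by (simp_all add: u_def nu_def h1_def h2_def vec_nf)

lemma graph_fix_A: "graph_fix (X Sp_A i)" "graph_fix (Z Sp_A i)"
proof -
  have u: "graph_fix (u 0)" "graph_fix (u 1)" "graph_fix (u 2)" "graph_fix (u 3)" "graph_fix (u 4)"
    "graph_fix (u 5)" by (simp_all add: graph_fix_u)
  have Z: "graph_fix (Z Sp_A 0)" "graph_fix (Z Sp_A 1)" "graph_fix (Z Sp_A 2)"
    unfolding A_from_u(4,5,6) by (intro graph_fix_lin u)+
  have nu: "graph_fix nu" unfolding A_from_u(1) by (intro graph_fix_lin u)
  have h: "graph_fix h2" "graph_fix h1"
    by (subst A_from_u, intro graph_fix_lin u nu)+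
  have X: "graph_fix (X Sp_A 0)" "graph_fix (X Sp_A 1)" "graph_fix (X Sp_A 2)"
    by (subst A_from_u, intro graph_fix_lin u nu h Z)+
  have i: "i = 0 \<or> i = 1 \<or> i = 2" using directions_3(1) by auto
  then show "graph_fix (X Sp_A i)" "graph_fix (Z Sp_A i)" using X Z by auto
qed

lemma graph_fix_piA: "graph_fix (piA p)"
  unfolding piA_def directions_3(1)
  by (simp add: dirs3) (intro graph_fix_lin graph_fix_A)

lemma of_bool_scale: "of_bool b \<odot> p = (if b then p else 0)"
  by simp

lemma mult_of_bool: "(a::'a) * of_bool b = (if b then a else 0)"
  by simp

lemma piA_A: "piA (X Sp_A i) = X Sp_A i" "piA (Z Sp_A i) = Z Sp_A i"
  by (simp_all add: piA_def frame_simps of_bool_scale del: of_bool_eq)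

lemma piA_B: "piA (X Sp_B i) = 0" "piA (Z Sp_B i) = 0"
  by (simp_all add: piA_def frame_simps)

lemma piA_add: "piA (p + r) = piA p + piA r"
  by (simp add: piA_def lam_simps scale_left_distrib sum.distrib add_ac)

lemma piA_scale: "piA (a \<odot> p) = a \<odot> piA p"
  by (simp add: piA_def lam_simps scale_sum_right scale_right_distrib)

lemma piA_AB: "piA (AB0 p) = 0" "piA (AB1 p) = 0"
  by (simp_all add: AB0_def AB1_def nB_def j1_def j2_def k0_def k1_def piA_add piA_scale piA_B)

lemma piA_BA: "piA (BA0 p) = BA0 p" "piA (BA1 p) = BA1 p"
  by (simp_all add: BA0_def BA1_def nA_def j1_def j2_def k0_def k1_def piA_add piA_scale piA_A)

lemma lam_piA: "lam (X Sp_A i) (piA p) = lam (X Sp_A i) p" "lam (Z Sp_A i) (piA p) = lam (Z Sp_A i) p"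
  by (simp_all add: piA_def lam_sum_right frame_simps mult_of_bool sum.distrib)

lemma AB_orth:
  assumes "\<And>i. lam (X Sp_A i) p = 0" "\<And>i. lam (Z Sp_A i) p = 0"
  shows "AB0 p = 0" "AB1 p = 0"
  by (simp_all add: AB0_def AB1_def nA_def j1_def j2_def k0_def k1_def lam_simps assms)

lemma u_orth:
  assumes "\<And>i. lam (X Sp_A i) p = 0" "\<And>i. lam (Z Sp_A i) p = 0" "k \<in> {..<6}"
  shows "lam (u k) p = 0"
  using assms(3) unfolding less6
  by (elim insertE emptyE; simp add: u_def nu_def h1_def h2_def lam_simps assms)

lemma lam_B_piA: "lam (X Sp_B i) (piA p) = 0" "lam (Z Sp_B i) (piA p) = 0"
  by (simp_all add: piA_def lam_sum_right frame_simps)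

lemma BA_orth: "BA0 (piA p) = 0" "BA1 (piA p) = 0"
  by (simp_all add: BA0_def BA1_def nB_def j1_def j2_def k0_def k1_def lam_simps lam_B_piA)

lemma lam_AB1_BA1: "lam (AB1 r) p = lam r (BA1 p)"
  by (simp add: AB1_def BA1_def frame_simps ring_nf)

lemma lam_q_AB0: "k \<in> {..<6} \<Longrightarrow> lam (q k) (AB0 p) = 0"
  using orth_AB_u[of k] by (simp add: q_def lam_simps lam_AB1_AB0 orth_AB_def)

lemma projQ_AB0: "projQ (AB0 p) = 0"
  unfolding projQ_def by (rule cross_orth) (rule lam_q_AB0)

text \<open>
  Moving species A up by one layer turns \<open>T\<close> into a pump of the graph of \<open>AB1\<close>. For \<open>p\<close> of species A,
  \<open>T p = p + AB0 p + z0 \<odot> AB1 p\<close> becomes \<open>AB0 p + z0 \<odot> (p + AB1 p)\<close>, where \<open>p + AB1 p\<close> lies in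
  the graph and \<open>AB0 p\<close> is orthogonal to it. For \<open>p\<close> of species B, \<open>T p = p + BA0 p + z1 \<odot> BA1 p\<close> becomes
  \<open>(p + BA1 p) + z0 \<odot> BA0 p\<close>; here \<open>p + BA1 p\<close> is orthogonal to the graph, because \<open>BA1\<close> is the adjoint
  of \<open>AB1\<close>, and \<open>BA0 p\<close> lies in the graph because \<open>AB1\<close> annihilates it.
\<close>

lemma T_decomp: "T p + (1 + z0) \<odot> piA (T p) = T_at_1 p + (1 + z0) \<odot> projQ (T_at_1 p)" (is "?F p = ?G p")
proof -
  define p1 p2 where "p1 = piA p" and "p2 = p + piA p"
  have "p1 + p2 = p + (piA p + piA p)" by (simp only: p1_def p2_def add_ac)
  then have p: "p = p1 + p2" by (simp only: p_double add_0_right)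
  have add: "?F p = ?F p1 + ?F p2" "?G p = ?G p1 + ?G p2"
    unfolding p by (simp_all add: T_def T_at_1_def coupling_add piA_add projQ_add scale_right_distrib add_ac)
  have 1: "?F p1 = ?G p1"
  proof -
    have a: "piA p1 = p1"
      by (simp add: p1_def piA_def[of "piA p"] lam_piA) (simp add: piA_def)
    have b: "BA0 p1 = 0" "BA1 p1 = 0" by (simp_all add: p1_def BA_orth)
    have c: "projQ (p1 + AB1 p1) = p1 + AB1 p1"
      using graph_fix_piA[of p] by (simp add: graph_fix_def p1_def)
    have "projQ (T_at_1 p1) = p1 + AB1 p1"
      using c by (simp add: T_at_1_def b projQ_add projQ_AB0)
    moreover have "?F p1 = p1 + AB0 p1 + z0 \<odot> AB1 p1 + (1 + z0) \<odot> p1"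
      by (simp add: T_def b piA_add piA_scale piA_AB a)
    ultimately show ?thesis
      by (simp add: T_at_1_def b vec_nf)
  qed
  have 2: "?F p2 = ?G p2"
  proof -
    have o: "lam (X Sp_A i) p2 = 0" "lam (Z Sp_A i) p2 = 0" for i
      by (simp_all add: p2_def lam_simps lam_piA r_double)
    have a: "piA p2 = 0" by (simp add: piA_def o)
    note c = AB_orth[OF o]
    have "lam (q k) (p2 + BA1 p2) = 0" if "k \<in> {..<6}" for k
    proof -
      have "BA1 (BA1 p2) = 0" using BA_orth(2)[of "BA1 p2"] by (simp only: piA_BA)
      then have "lam (q k) (p2 + BA1 p2) = lam (u k) (BA1 p2) + lam (u k) (BA1 p2)"
        by (simp add: q_def lam_simps lam_AB1_BA1 u_orth[OF o that])
      then show ?thesis by (simp only: r_double)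
    qed
    then have "projQ (p2 + BA1 p2) = 0"
      unfolding projQ_def by (rule cross_orth)
    moreover have "projQ (BA0 p2) = BA0 p2"
      using graph_fix_piA[of "BA0 p2"] by (simp add: graph_fix_def piA_BA AB1_BA0)
    ultimately have "projQ (T_at_1 p2) = BA0 p2"
      by (simp add: T_at_1_def c projQ_add add_ac)
    then show ?thesis
      by (simp add: T_def T_at_1_def c piA_add piA_scale a piA_BA vec_nf)
  qed
  show ?thesis unfolding add 1 2 ..
qed

text \<open>
  Species A moved down by one layer; the inverse of the shift that appears in \<open>T_decomp\<close>.
\<close>

definition lower_A where "lower_A p = p + (1 + z1) \<odot> piA p"

lemma piA_piA: "piA (piA p) = piA p"
  by (simp add: piA_def[of "piA p"] lam_piA) (simp add: piA_def)

lemma T_factor: "T p = lower_A (T_at_1 p + (1 + z0) \<odot> projQ (T_at_1 p))"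
  unfolding T_decomp[symmetric]
  by (simp add: lower_A_def piA_add piA_scale piA_piA vec_nf)

definition shift1 where
  "shift1 i p = p + (1 + z1) \<odot> (lam (Z Sp_A i) p \<odot> X Sp_A i + lam (X Sp_A i) p \<odot> Z Sp_A i)"

lemma lower_A_shift1: "lower_A = shift1 0 \<circ> shift1 1 \<circ> shift1 2"
proof (rule ext)
  fix p
  have l: "lam (Z Sp_A i) (shift1 k p) = lam (Z Sp_A i) p" "lam (X Sp_A i) (shift1 k p) = lam (X Sp_A i) p"
    if "i \<noteq> k" for i k p
    using that by (simp_all add: shift1_def frame_simps)
  let ?b = "\<lambda>i. lam (Z Sp_A i) p \<odot> X Sp_A i + lam (X Sp_A i) p \<odot> Z Sp_A i"
  have s: "shift1 i r = r + (1 + z1) \<odot> ?b i" if "lam (Z Sp_A i) r = lam (Z Sp_A i) p" "lam (X Sp_A i) r = lam (X Sp_A i) p" for i r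
    using that by (simp add: shift1_def)
  have "(shift1 0 \<circ> shift1 1 \<circ> shift1 2) p = shift1 2 p + (1 + z1) \<odot> ?b 1 + (1 + z1) \<odot> ?b 0"
  proof -
    have "shift1 1 (shift1 2 p) = shift1 2 p + (1 + z1) \<odot> ?b 1"
      by (rule s) (simp_all only: l dirs3 not_False_eq_True)
    moreover have "shift1 0 (shift1 1 (shift1 2 p)) = shift1 1 (shift1 2 p) + (1 + z1) \<odot> ?b 0"
      by (rule s) (simp_all only: l dirs3 not_False_eq_True)
    ultimately show ?thesis by (simp only: comp_def)
  qed
  also have "\<dots> = p + (1 + z1) \<odot> (?b 0 + ?b 1 + ?b 2)"
    by (simp only: s[OF refl refl, of 2] scale_right_distrib[of "1 + z1"] add_ac)
  also have "?b 0 + ?b 1 + ?b 2 = piA p"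
    by (simp only: piA_def directions_3(1)) (simp add: dirs3)
  finally show "lower_A p = (shift1 0 \<circ> shift1 1 \<circ> shift1 2) p" by (simp only: lower_A_def)
qed

text \<open>
  The exchange map of \<open>swap_pump\<close> between the graph of \<open>AB1\<close> and a second frame \<open>v\<close> with the same Gram
  matrix.
\<close>

definition swap_rot where
  "swap_rot v t p = p + cross theta_inv {..<6} (\<lambda>i. q i + t \<odot> v i) (\<lambda>i. q i + t \<odot> v i) p"

lemma q_orth:
  assumes "\<And>s i. lam (X s i) p = 0" "\<And>s i. lam (Z s i) p = 0" "k \<in> {..<6}"
  shows "lam (q k) p = 0"
proof -
  have "BA1 p = 0"
    by (simp add: BA1_def nB_def j1_def j2_def k0_def k1_def lam_simps assms(1,2))
  then show ?thesis
    using u_orth[OF assms(1,2,3)] by (simp add: q_def lam_simps lam_AB1_BA1)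
qed

lemma T_at_1_orth:
  assumes "\<And>s i. lam (X s i) p = 0" "\<And>s i. lam (Z s i) p = 0"
  shows "T_at_1 p = p"
  by (simp add: T_at_1_def AB0_def AB1_def BA0_def BA1_def nA_def nB_def j1_def j2_def k0_def k1_def
      lam_simps assms)

lemma T_at_1_add: "T_at_1 (p + r) = T_at_1 p + T_at_1 r"
  by (simp add: T_at_1_def coupling_add add_ac)

text \<open>
  The pump of the graph of \<open>AB1\<close> is traded for the pump of any orthogonal frame with Gram matrix \<open>theta\<close>;
  everything in front of the latter is a shift or an isotropic symmetrized map.
\<close>

lemma T_pump:
  assumes a: "\<And>i k. i \<in> {..<6} \<Longrightarrow> k \<in> {..<6} \<Longrightarrow> lam (a i) (a k) = theta i k"
    and Xa: "\<And>s i k. k \<in> {..<6} \<Longrightarrow> lam (X s i) (a k) = 0"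
    and Za: "\<And>s i k. k \<in> {..<6} \<Longrightarrow> lam (Z s i) (a k) = 0"
  shows "T p = lower_A (swap_rot a 1 (swap_rot a z0 (T_at_1 (p + (1 + z0) \<odot> cross theta_inv {..<6} a a p))))"
proof -
  let ?A = "cross theta_inv {..<6} a a"
  have o: "lam (X s i) ((1 + z0) \<odot> ?A p) = 0" "lam (Z s i) ((1 + z0) \<odot> ?A p) = 0" for s i p
    by (simp_all add: cross_def lam_sum_right lam_simps Xa Za)
  have aX: "lam (a k) (X s i) = 0" "lam (a k) (Z s i) = 0" if "k \<in> {..<6}" for s i k
    by (rule lam_zero_sym, rule Xa[OF that] Za[OF that])+
  have "lam (a k) (AB0 p + AB1 p + BA0 p + BA1 p) = 0" if "k \<in> {..<6}" for k
    by (simp add: AB0_def AB1_def BA0_def BA1_def nA_def nB_def j1_def j2_def k0_def k1_def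
      lam_simps aX[OF that])
  then have "?A (AB0 p + AB1 p + BA0 p + BA1 p) = 0" by (rule cross_orth)
  then have A: "?A (T_at_1 p) = ?A p"
    unfolding T_at_1_def by (simp add: cross_add add.assoc)
  have "T_at_1 (p + (1 + z0) \<odot> ?A p) = T_at_1 p + (1 + z0) \<odot> ?A (T_at_1 p)"
    by (simp only: T_at_1_add T_at_1_orth[OF o] A)
  moreover have "swap_rot a 1 (swap_rot a z0 (T_at_1 p + (1 + z0) \<odot> ?A (T_at_1 p))) = T_at_1 p + (1 + z0) \<odot> projQ (T_at_1 p)"
    unfolding swap_rot_def projQ_def
  proof (rule swap_pump)
    show "lam (q i) (a k) = 0" if "i \<in> {..<6}" "k \<in> {..<6}" for i k
      by (rule q_orth) (simp_all add: Xa Za that del: lessThan_iff)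
  qed (simp_all add: units cnj_units gram_q a theta_inv_theta[simplified])
  ultimately show ?thesis by (simp only: T_factor)
qed

lemma swap_rot_isotropic:
  assumes a: "\<And>i k. i \<in> {..<6} \<Longrightarrow> k \<in> {..<6} \<Longrightarrow> lam (a i) (a k) = theta i k"
    and Xa: "\<And>s i k. k \<in> {..<6} \<Longrightarrow> lam (X s i) (a k) = 0"
    and Za: "\<And>s i k. k \<in> {..<6} \<Longrightarrow> lam (Z s i) (a k) = 0"
    and t: "t * cnj t = 1" and ik: "i \<in> {..<6}" "k \<in> {..<6}"
  shows "lam (q i + t \<odot> a i) (q k + t \<odot> a k) = 0"
proof -
  have qa: "lam (q i) (a k) = 0" if "i \<in> {..<6}" "k \<in> {..<6}" for i k
    by (rule q_orth) (simp_all add: Xa Za that del: lessThan_iff)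
  have "t * (cnj t * w) = w" for w using t by (simp add: mult.assoc[symmetric])
  then show ?thesis
    using qa[OF ik] lam_zero_sym[OF qa[OF ik(2,1)]]
    by (simp add: lam_simps gram_q[OF ik] a[OF ik] r_double)
qed

lemma T_at_1_sym_map: "T_at_1 p = p + sym_map [(nB, k0 Sp_A + k1 Sp_A), (nA, k0 Sp_B + k1 Sp_B)] p"
  by (simp add: T_at_1_def sym_map_def AB0_def AB1_def BA0_def BA1_def frame_simps vec_nf)

lemma T_at_1_isotropic:
  assumes "v \<in> {nA, nB, k0 Sp_A + k1 Sp_A, k0 Sp_B + k1 Sp_B}" "w \<in> {nA, nB, k0 Sp_A + k1 Sp_A, k0 Sp_B + k1 Sp_B}"
  shows "lam v w = 0"
  using assms
  by (elim insertE emptyE; simp add: nA_def nB_def gram_jk frame_simps ring_nf)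

text \<open>
  The terms of \<open>T\<close> grouped by the operator whose commutation is measured (second component).
\<close>

definition T_terms where "T_terms =
  [((x0 * (1 + z0)) \<odot> j1 Sp_B, j2 Sp_A), ((y0 * (1 + z0)) \<odot> j2 Sp_B, j1 Sp_A),
   (k1 Sp_B + z0 \<odot> k0 Sp_B, nA), (nB, k0 Sp_A), (z0 \<odot> nB, k1 Sp_A),
   ((x1 * (1 + z1)) \<odot> j2 Sp_A, j1 Sp_B), ((y1 * (1 + z1)) \<odot> j1 Sp_A, j2 Sp_B),
   (nA, k1 Sp_B), (z1 \<odot> nA, k0 Sp_B), (k0 Sp_A + z1 \<odot> k1 Sp_A, nB)]"

lemma T_lin: "T p = p + lin T_terms p"
  by (simp add: T_def lin_def T_terms_def AB0_def AB1_def BA0_def BA1_def vec_nf)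

definition j3 where "j3 s = X s 2 + (x0 * z1) \<odot> Z s 0 + z1 \<odot> Z s 1"

text \<open>
  These values are compared below with the definition of the QCA by cup products.
\<close>

lemma T_Z:
  "T (Z Sp_A 0) = Z Sp_A 0 + (y0 * z0) \<odot> ((1 + z1) \<odot> j2 Sp_B + (1 + y1) \<odot> j3 Sp_B)"
  "T (Z Sp_A 1) = Z Sp_A 1 + (x0 * z0) \<odot> ((1 + z1) \<odot> j1 Sp_B + (1 + x1) \<odot> j3 Sp_B)"
  "T (Z Sp_A 2) = Z Sp_A 2 + (x0 * y0) \<odot> ((1 + y1) \<odot> j1 Sp_B + (1 + x1) \<odot> j2 Sp_B)"
  "T (Z Sp_B 0) = Z Sp_B 0 + x1 \<odot> ((1 + z1) \<odot> j2 Sp_A + (1 + y1) \<odot> j3 Sp_A)"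
  "T (Z Sp_B 1) = Z Sp_B 1 + y1 \<odot> ((1 + z1) \<odot> j1 Sp_A + (1 + x1) \<odot> j3 Sp_A)"
  "T (Z Sp_B 2) = Z Sp_B 2 + z1 \<odot> ((1 + y1) \<odot> j1 Sp_A + (1 + x1) \<odot> j2 Sp_A)"
  by (simp_all add: T_def AB0_def AB1_def BA0_def BA1_def nA_def nB_def j1_def j2_def j3_def k0_def k1_def
      frame_simps dirs3 vec_nf)

lemma T_X:
  "T (X s 0) = X s 0 + (x1 * z0) \<odot> (Z s 2 + T (Z s 2)) + x1 \<odot> (Z s 1 + T (Z s 1))"
  "T (X s 1) = X s 1 + z0 \<odot> (Z s 2 + T (Z s 2)) + y1 \<odot> (Z s 0 + T (Z s 0))"
  "T (X s 2) = X s 2 + y0 \<odot> (Z s 1 + T (Z s 1)) + (Z s 0 + T (Z s 0))"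
  by (cases s; simp add: T_Z; simp add: T_def AB0_def AB1_def BA0_def BA1_def nA_def nB_def j1_def j2_def j3_def k0_def k1_def
      frame_simps dirs3 vec_nf)+

end

lemma dirs2: "(0::2) \<noteq> 1" "(1::2) \<noteq> 0"
  using directions_2(2) by auto

section \<open>The pump of one layer of edges\<close>

text \<open>
  One edge of each direction at the origin of a layer.
\<close>

locale edge_frame = laurent_module +
  fixes X Z :: "species \<Rightarrow> 2 \<Rightarrow> 'b"
  assumes lam_XX: "lam (X s i) (X t k) = 0"
    and lam_ZZ: "lam (Z s i) (Z t k) = 0"
    and lam_XZ: "lam (X s i) (Z t k) = of_bool (s = t \<and> i = k)"
begin

lemma lam_ZX: "lam (Z s i) (X t k) = of_bool (s = t \<and> i = k)"
  using arg_cong[OF lam_XZ[of t k s i], of cnj] by (auto simp: cnj_lam cnj_0 cnj_1)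

lemmas frame_simps = unit_simps lam_XX lam_ZZ lam_XZ lam_ZX

text \<open>
  The operators \<open>A\<close> and \<open>Abar\<close> of the layered system at the origin, for (species, direction) in the order
  (A, 0), (A, 1), (B, 0), (B, 1). The two families commute with each other, and together they generate.
\<close>

definition a where "a = (!) [
  X Sp_A 0 + (1 + y0) \<odot> Z Sp_A 0 + Z Sp_A 1,
  X Sp_A 1 + (x1 + x1 * y0 + y0) \<odot> Z Sp_A 0 + (1 + x1) \<odot> Z Sp_A 1,
  X Sp_B 0 + x0 \<odot> Z Sp_A 1 + (1 + y1) \<odot> Z Sp_B 0 + (y1 + x0 * y1 + x0) \<odot> Z Sp_B 1,
  X Sp_B 1 + y0 \<odot> Z Sp_A 0 + Z Sp_B 0 + (1 + x0) \<odot> Z Sp_B 1]"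

definition abar where "abar = (!) [
  X Sp_A 0 + (1 + y1) \<odot> Z Sp_A 0 + (y1 + x0 * y1 + x0) \<odot> Z Sp_A 1 + y1 \<odot> Z Sp_B 1,
  X Sp_A 1 + Z Sp_A 0 + (1 + x0) \<odot> Z Sp_A 1 + x1 \<odot> Z Sp_B 0,
  X Sp_B 0 + (1 + y0) \<odot> Z Sp_B 0 + Z Sp_B 1,
  X Sp_B 1 + (x1 + x1 * y0 + y0) \<odot> Z Sp_B 0 + (1 + x1) \<odot> Z Sp_B 1]"

lemma less4: "{..<4::nat} = {0,1,2,3}" by auto

lemma gram_a: "i \<in> {..<4} \<Longrightarrow> k \<in> {..<4} \<Longrightarrow> lam (a i) (a k) = theta i k"
  unfolding less4 theta_def
  by (elim insertE emptyE; simp add: a_def frame_simps dirs2 ring_nf)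

lemma a_abar: "i \<in> {..<4} \<Longrightarrow> k \<in> {..<4} \<Longrightarrow> lam (a i) (abar k) = 0"
  unfolding less4
  by (elim insertE emptyE; simp add: a_def abar_def frame_simps dirs2 ring_nf)

lemma theta_inv_theta4: "i \<in> {..<4} \<Longrightarrow> k \<in> {..<4} \<Longrightarrow>
  (\<Sum>j\<in>{..<4}. theta_inv i j * theta j k) = of_bool (i = k)"
  unfolding less4 theta_def theta_inv_def
  by (elim insertE emptyE; simp add: ring_nf)

lemma gram_a_inverse:
  assumes "i \<in> {..<4}" "k \<in> {..<4}"
  shows "(\<Sum>j\<in>{..<4}. theta_inv i j * lam (a j) (a k)) = of_bool (i = k)"
proof -
  have "(\<Sum>j\<in>{..<4}. theta_inv i j * lam (a j) (a k)) = (\<Sum>j\<in>{..<4}. theta_inv i j * theta j k)"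
    by (rule sum.cong) (simp_all only: gram_a assms)
  then show ?thesis by (simp only: theta_inv_theta4[OF assms])
qed

text \<open>
  Each \<open>a i + abar i\<close> is a combination of \<open>Z\<close> operators; the coefficients are the entries of
  \<open>theta\<close>, so they can be solved for.
\<close>

lemma Z_from_a:
  "Z Sp_A 0 = (\<Sum>i\<in>{..<4}. theta_inv i 0 \<odot> (a i + abar i))"
  "Z Sp_A 1 = (\<Sum>i\<in>{..<4}. theta_inv i 1 \<odot> (a i + abar i))"
  "Z Sp_B 0 = (\<Sum>i\<in>{..<4}. theta_inv i 2 \<odot> (a i + abar i))"
  "Z Sp_B 1 = (\<Sum>i\<in>{..<4}. theta_inv i 3 \<odot> (a i + abar i))"
  unfolding less4 by (simp_all add: a_def abar_def theta_inv_def vec_nf)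

lemma X_from_a:
  "X Sp_A 0 = a 0 + (1 + y0) \<odot> Z Sp_A 0 + Z Sp_A 1"
  "X Sp_A 1 = a 1 + (x1 + x1 * y0 + y0) \<odot> Z Sp_A 0 + (1 + x1) \<odot> Z Sp_A 1"
  "X Sp_B 0 = a 2 + x0 \<odot> Z Sp_A 1 + (1 + y1) \<odot> Z Sp_B 0 + (y1 + x0 * y1 + x0) \<odot> Z Sp_B 1"
  "X Sp_B 1 = a 3 + y0 \<odot> Z Sp_A 0 + Z Sp_B 0 + (1 + x0) \<odot> Z Sp_B 1"
  by (simp_all add: a_def vec_nf)

definition pump where "pump p = p + (1 + z0) \<odot> cross theta_inv {..<4} a a p"

definition pump_terms where "pump_terms = (let c = 1 + z0 in concat (map (\<lambda>i. map (\<lambda>j. ((c * theta_inv i j) \<odot> a i, a j)) [0,1,2,3]) [0,1,2,3]))"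

lemma pump_lin: "pump p = p + lin pump_terms p"
  unfolding pump_def cross_def less4
  by (simp add: pump_terms_def lin_def Let_def scale_right_distrib mult_ac add_ac)

lemma pump_a: "i \<in> {..<4} \<Longrightarrow> pump (a i) = z0 \<odot> a i"
proof -
  assume i: "i \<in> {..<4}"
  have "cross theta_inv {..<4} a a (a i) = a i"
    by (rule cross_gen[OF _ i]) (simp_all only: gram_a_inverse[OF _ i] finite_lessThan)
  then show ?thesis by (simp add: pump_def vec_nf)
qed

lemma pump_abar: "i \<in> {..<4} \<Longrightarrow> pump (abar i) = abar i"
proof -
  assume i: "i \<in> {..<4}"
  have "cross theta_inv {..<4} a a (abar i) = 0" by (rule cross_orth) (rule a_abar[OF _ i])
  then show ?thesis by (simp add: pump_def)
qed

end

section \<open>The Pauli group as a hermitian module over Laurent polynomials\<close>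

text \<open>
  The type \<open>bit\<close> is used only as the field with two elements, so sums and products must stay in the
  form to which the ring laws apply.
\<close>

declare add_bit_eq_xor [simp del] mult_bit_eq_and [simp del]

abbreviation "lookup \<equiv> Poly_Mapping.lookup"
abbreviation "keys \<equiv> Poly_Mapping.keys"
abbreviation "single \<equiv> Poly_Mapping.single"

lemma bit_double: "(b::bit) + b = 0"
  by (cases b) simp_all

lemma pauli_double: "(P::'q pauli) + P = 0"
  by (rule poly_mapping_eqI) (simp add: lookup_add bit_double prod_eq_iff)

lemma poly_mapping_sum:
  fixes p :: "'a \<Rightarrow>\<^sub>0 'b::comm_monoid_add"
  shows "(\<Sum>k\<in>keys p. single k (lookup p k)) = p"
  by (rule poly_mapping_eqI) (auto simp: lookup_sum lookup_single when_def in_keys_iff)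

lemma poly_mapping_additive_induct:
  fixes p :: "'a \<Rightarrow>\<^sub>0 'b::comm_monoid_add"
  assumes "\<And>k v. P (single k v)" "\<And>p q. P p \<Longrightarrow> P q \<Longrightarrow> P (p + q)"
  shows "P p"
proof -
  have "P (single undefined 0)" by (rule assms)
  then have 0: "P 0" by simp
  have "P (\<Sum>k\<in>S. single k (lookup p k))" if "finite S" for S
    using that by (induction S) (auto intro: assms 0)
  from this[of "keys p"] show ?thesis by (simp add: poly_mapping_sum)
qed

lemma relabel_add: "relabel g (P + R) = relabel g P + relabel g R"
  unfolding relabel_def by (rule setsum_keys_plus_distrib) (simp_all add: single_add)

lemma relabel_zero: "relabel g 0 = 0"
  by (simp add: relabel_def)

lemma relabel_single: "relabel g (single q v) = single (g q) v"
  by (simp add: relabel_def)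

lemma relabel_sum: "relabel g (sum f S) = (\<Sum>i\<in>S. relabel g (f i))"
  by (induction S rule: infinite_finite_induct) (auto simp: relabel_zero relabel_add)

lemma relabel_relabel: "relabel g (relabel h P) = relabel (g \<circ> h) P"
  by (induction P rule: poly_mapping_additive_induct) (simp_all add: relabel_single relabel_add)

lemma relabel_id: "relabel id P = P"
  by (induction P rule: poly_mapping_additive_induct) (simp_all add: relabel_single relabel_add)

lemma relabel_cong: "(\<And>q. q \<in> keys P \<Longrightarrow> g q = h q) \<Longrightarrow> relabel g P = relabel h P"
  by (auto simp: relabel_def intro: sum.cong)

lemma keys_relabel: "keys (relabel g P) \<subseteq> g ` keys P"
proof -
  have "keys (relabel g P) \<subseteq> (\<Union>q\<in>keys P. keys (single (g q) (lookup P q)))"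
    unfolding relabel_def by (rule keys_sum)
  then show ?thesis by (auto split: if_splits)
qed

lemma lookup_relabel:
  assumes "inj_on g S" "keys P \<subseteq> S" "q \<in> S"
  shows "lookup (relabel g P) (g q) = lookup P q"
proof -
  have "lookup (relabel g P) (g q) = (\<Sum>k\<in>keys P. if k = q then lookup P k else 0)"
    unfolding relabel_def lookup_sum lookup_single when_def
    by (rule sum.cong) (use assms in \<open>auto simp: inj_on_def\<close>)
  then show ?thesis by (simp add: in_keys_iff)
qed

lemma paulis_add: "P \<in> paulis Q \<Longrightarrow> R \<in> paulis Q \<Longrightarrow> P + R \<in> paulis Q"
  using keys_add[of P R] by (auto simp: paulis_def)

lemma paulis_zero: "0 \<in> paulis Q"
  by (simp add: paulis_def)

lemma paulis_sum: "(\<And>i. i \<in> S \<Longrightarrow> f i \<in> paulis Q) \<Longrightarrow> sum f S \<in> paulis Q"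
  by (induction S rule: infinite_finite_induct) (auto simp: paulis_zero paulis_add)

lemma paulis_relabel: "P \<in> paulis Q \<Longrightarrow> (\<And>q. q \<in> Q \<Longrightarrow> g q \<in> Q') \<Longrightarrow> relabel g P \<in> paulis Q'"
  using keys_relabel[of g P] unfolding paulis_def by blast

lemma paulis_single: "q \<in> Q \<Longrightarrow> single q v \<in> paulis Q"
  by (auto simp: paulis_def)

lemma paulis_induct [consumes 1, case_names X Z add zero]:
  assumes "P \<in> paulis Q" "\<And>q. q \<in> Q \<Longrightarrow> A (PX q)" "\<And>q. q \<in> Q \<Longrightarrow> A (PZ q)"
    "\<And>P R. P \<in> paulis Q \<Longrightarrow> R \<in> paulis Q \<Longrightarrow> A P \<Longrightarrow> A R \<Longrightarrow> A (P + R)" "A 0"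
  shows "A P"
proof -
  have s: "A (single q v)" if "q \<in> Q" for q v
  proof (cases v)
    case (Pair a b)
    have "single q v = single q (a, 0) + single q (0, b)"
      by (simp add: Pair flip: single_add)
    moreover have "A (single q (a, 0))"
      using assms(2)[OF that] assms(5) by (cases a) (simp_all add: PX_def flip: zero_prod_def)
    moreover have "A (single q (0, b))"
      using assms(3)[OF that] assms(5) by (cases b) (simp_all add: PZ_def flip: zero_prod_def)
    ultimately show ?thesis using assms(4) paulis_single[OF that] by simp
  qed
  have "A (\<Sum>k\<in>S. single k (lookup P k)) \<and> (\<Sum>k\<in>S. single k (lookup P k)) \<in> paulis Q"
    if "finite S" "S \<subseteq> Q" for S
    using that by (induction S) (auto intro!: assms(4,5) s paulis_zero paulis_add paulis_single)
  from this[of "keys P"] assms(1) show ?thesis by (simp add: poly_mapping_sum paulis_def)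
qed

definition comm_form :: "'q pauli \<Rightarrow> 'q pauli \<Rightarrow> bit" where
  "comm_form P R = (\<Sum>q\<in>keys P \<union> keys R.
        fst (lookup P q) * snd (lookup R q) + snd (lookup P q) * fst (lookup R q))"

lemma comm_form_superset:
  assumes "finite S" "keys P \<union> keys R \<subseteq> S"
  shows "comm_form P R = (\<Sum>q\<in>S.
        fst (lookup P q) * snd (lookup R q) + snd (lookup P q) * fst (lookup R q))"
  unfolding comm_form_def
  by (rule sum.mono_neutral_left) (use assms in \<open>auto simp: in_keys_iff\<close>)

lemma comm_form_sym: "comm_form P R = comm_form R P"
  unfolding comm_form_def by (rule sum.cong) (auto simp: mult.commute add.commute)

lemma comm_form_add: "comm_form P (R + R') = comm_form P R + comm_form P R'"
proof -
  let ?S = "keys P \<union> keys R \<union> keys R'"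
  have "keys (R + R') \<subseteq> ?S" using keys_add[of R R'] by auto
  then show ?thesis
    by (subst (1 2 3) comm_form_superset[where S = ?S])
      (auto simp: lookup_add algebra_simps sum.distrib)
qed

lemma comm_form_zero: "comm_form P 0 = 0"
  by (simp add: comm_form_def)

lemma comm_form_add_left: "comm_form (R + R') P = comm_form R P + comm_form R' P"
  by (metis comm_form_add comm_form_sym)

lemma comm_form_sum: "comm_form P (sum f S) = (\<Sum>i\<in>S. comm_form P (f i))"
  by (induction S rule: infinite_finite_induct) (auto simp: comm_form_zero comm_form_add)

lemma comm_form_single: "comm_form (single q v) (single q' w) =
    (if q = q' then fst v * snd w + snd v * fst w else 0)"
  by (subst comm_form_superset[where S = "{q, q'}"]) (auto simp: lookup_single when_def)

lemma comm_form_relabel: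
  assumes "inj_on g (keys P \<union> keys R)"
  shows "comm_form (relabel g P) (relabel g R) = comm_form P R"
proof -
  let ?S = "keys P \<union> keys R"
  have "comm_form (relabel g P) (relabel g R) = (\<Sum>q\<in>g ` ?S.
        fst (lookup (relabel g P) q) * snd (lookup (relabel g R) q)
      + snd (lookup (relabel g P) q) * fst (lookup (relabel g R) q))"
    by (rule comm_form_superset) (use keys_relabel[of g P] keys_relabel[of g R] in auto)
  also have "\<dots> = comm_form P R"
    unfolding comm_form_def sum.reindex[OF assms]
    by (rule sum.cong) (auto simp: lookup_relabel[OF assms])
  finally show ?thesis .
qed

lemma comm_form_disjoint: "keys P \<inter> keys R = {} \<Longrightarrow> comm_form P R = 0"
  unfolding comm_form_def
proof (rule sum.neutral, rule ballI)
  fix q assume "keys P \<inter> keys R = {}"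
  then have "lookup P q = 0 \<or> lookup R q = 0" by (auto simp: in_keys_iff disjoint_iff)
  then show "fst (lookup P q) * snd (lookup R q) + snd (lookup P q) * fst (lookup R q) = 0" by auto
qed

lemma paulis_commute_iff: "paulis_commute P R \<longleftrightarrow> comm_form P R = 0"
  by (simp add: paulis_commute_def comm_form_def)

text \<open>
  Laurent polynomials are the group ring of the lattice of translations; \<open>conj\<close> inverts all translations.
\<close>

type_synonym 'd laurent = "(int, 'd) vec \<Rightarrow>\<^sub>0 bit"

definition mon :: "(int, 'd::finite) vec \<Rightarrow> 'd laurent" where "mon t = single t 1"
definition conj :: "'d::finite laurent \<Rightarrow> 'd laurent" where "conj r = Poly_Mapping.map_key uminus r"

lemma lookup_conj: "lookup (conj r) t = lookup r (- t)"
  by (simp add: conj_def map_key.rep_eq)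

lemma conj_single: "conj (single t v) = single (- t) v"
  by (rule poly_mapping_eqI) (auto simp: lookup_conj lookup_single when_def)

lemma conj_add: "conj (r + s) = conj r + conj s"
  by (rule poly_mapping_eqI) (auto simp: lookup_conj lookup_add)

lemma conj_mult: "conj (r * s) = conj r * conj s"
proof (induction r rule: poly_mapping_additive_induct)
  case (1 k v)
  show ?case
    by (induction s rule: poly_mapping_additive_induct)
      (simp_all add: conj_single mult_single conj_add distrib_left)
qed (simp add: conj_add distrib_right)

lemma conj_conj: "conj (conj r) = r"
  by (rule poly_mapping_eqI) (simp add: lookup_conj)

lemma mon_mult: "mon s * mon t = mon (s + t)"
  by (simp add: mon_def mult_single)

lemma mon_0: "mon 0 = 1"
  by (simp add: mon_def)

lemma conj_mon: "conj (mon t) = mon (- t)"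
  by (simp add: mon_def conj_single)

lemma lookup_mon_mult: "lookup (mon s * r) t = lookup r (t - s)"
proof (induction r rule: poly_mapping_additive_induct)
  case (1 k v)
  then show ?case by (auto simp: mon_def mult_single lookup_single when_def)
qed (simp add: distrib_left lookup_add)

lemma laurent_double: "(r::'d::finite laurent) + r = 0"
  by (rule poly_mapping_eqI) (simp only: lookup_add bit_double lookup_zero)

lemma laurent_induct:
  assumes "\<And>t. P (mon t)" "\<And>r s. P r \<Longrightarrow> P s \<Longrightarrow> P (r + s)"
  shows "P (r :: 'd::finite laurent)"
proof (rule poly_mapping_additive_induct)
  have "P (mon 0 + mon 0)" by (intro assms)
  then have 0: "P 0" by (simp add: laurent_double)
  show "P (single k v)" for k v
    using assms(1)[of k] 0 by (cases v) (simp_all add: mon_def)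
qed (rule assms)

locale lattice_qubits =
  fixes pos :: "'q \<Rightarrow> (int, 'd::finite) vec" and tr :: "(int, 'd) vec \<Rightarrow> 'q \<Rightarrow> 'q"
  assumes tr_0: "tr 0 q = q" and tr_add: "tr (s + t) q = tr s (tr t q)"
    and pos_tr: "pos (tr t q) = t + pos q"
begin

abbreviation trp :: "(int, 'd) vec \<Rightarrow> 'q pauli \<Rightarrow> 'q pauli" where "trp t \<equiv> relabel (tr t)"

lemma tr_inj: "inj_on (tr t) S"
  by (rule inj_on_inverseI[of _ "tr (- t)"]) (simp add: tr_0 flip: tr_add)

lemma trp_0: "trp 0 P = P"
  using relabel_cong[of P "tr 0" id] by (simp add: tr_0 relabel_id)

lemma trp_add: "trp (s + t) P = trp s (trp t P)"
  unfolding relabel_relabel by (rule relabel_cong) (simp add: tr_add)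

lemma comm_form_trp: "comm_form (trp t P) (trp t R) = comm_form P R"
  by (rule comm_form_relabel) (rule tr_inj)

lemma comm_form_trp_left: "comm_form (trp t P) R = comm_form P (trp (- t) R)"
  using comm_form_trp[of t P "trp (- t) R"] by (simp add: trp_0 flip: trp_add)

lemma comm_form_trp_nonzero:
  assumes "comm_form (trp t P) R \<noteq> 0"
  shows "\<exists>q\<in>keys P. tr t q \<in> keys R"
  using assms comm_form_disjoint[of "trp t P" R] keys_relabel[of "tr t" P] by auto

lemma comm_form_support: "finite {t. comm_form (trp t P) R \<noteq> 0}"
proof (rule finite_subset)
  show "{t. comm_form (trp t P) R \<noteq> 0} \<subseteq> (\<lambda>(q, q'). pos q' - pos q) ` (keys P \<times> keys R)"
  proof
    fix t assume "t \<in> {t. comm_form (trp t P) R \<noteq> 0}"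
    then obtain q where "q \<in> keys P" "tr t q \<in> keys R"
      using comm_form_trp_nonzero[of t P R] by auto
    then show "t \<in> (\<lambda>(q, q'). pos q' - pos q) ` (keys P \<times> keys R)"
      by (intro image_eqI[where x = "(q, tr t q)"]) (auto simp: pos_tr)
  qed
qed simp

text \<open>
  The coefficient of the monomial \<open>t\<close> tells whether \<open>R\<close> anticommutes with the translate of \<open>P\<close> by
  \<open>t\<close>. Only finitely many translates meet the support of \<open>R\<close>.
\<close>

definition lam :: "'q pauli \<Rightarrow> 'q pauli \<Rightarrow> 'd laurent" where
  "lam P R = Abs_poly_mapping (\<lambda>t. comm_form (trp t P) R)"

lemma lookup_lam: "lookup (lam P R) t = comm_form (trp t P) R"
  unfolding lam_def by (subst lookup_Abs_poly_mapping[OF comm_form_support]) (rule refl)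

definition scale :: "'d laurent \<Rightarrow> 'q pauli \<Rightarrow> 'q pauli" (infixr \<open>\<odot>\<close> 75) where
  "r \<odot> P = (\<Sum>t\<in>keys r. if lookup r t = 1 then trp t P else 0)"

lemma scale_mon: "mon t \<odot> P = trp t P"
  by (simp add: scale_def mon_def)

lemma scale_alt: "r \<odot> P = (\<Sum>t\<in>keys r. trp t P)"
  unfolding scale_def by (rule sum.cong) (auto simp: in_keys_iff)

lemma scale_add_left: "(r + s) \<odot> P = r \<odot> P + s \<odot> P"
  unfolding scale_def
proof (rule setsum_keys_plus_distrib)
  fix t show "(if lookup r t + lookup s t = 1 then trp t P else 0) =
      (if lookup r t = 1 then trp t P else 0) + (if lookup s t = 1 then trp t P else 0)"
    by (cases "lookup r t"; cases "lookup s t") (simp_all add: pauli_double)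
qed simp

lemma scale_add_right: "r \<odot> (P + R) = r \<odot> P + r \<odot> R"
  by (simp add: scale_alt relabel_add sum.distrib)

lemma scale_mon_mult: "(mon s * r) \<odot> P = trp s (r \<odot> P)"
  by (induction r rule: laurent_induct)
    (simp_all add: mon_mult scale_mon trp_add distrib_left scale_add_left relabel_add)

lemma scale_mult: "(r * s) \<odot> P = r \<odot> s \<odot> P"
  by (induction r rule: laurent_induct)
    (simp_all add: scale_mon_mult scale_mon distrib_right scale_add_left)

lemma pairing_add: "lam P (R + R') = lam P R + lam P R'"
  by (rule poly_mapping_eqI) (simp add: lookup_lam lookup_add comm_form_add)

lemma lam_trp_right: "lam P (trp s R) = mon s * lam P R"
  by (rule poly_mapping_eqI)
    (simp add: lookup_lam lookup_mon_mult comm_form_trp_left flip: trp_add)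

lemma pairing_scale: "lam P (r \<odot> R) = r * lam P R"
  by (induction r rule: laurent_induct)
    (simp_all add: scale_mon lam_trp_right scale_add_left pairing_add distrib_right)

lemma conj_lam: "conj (lam P R) = lam R P"
  by (rule poly_mapping_eqI)
    (simp only: lookup_conj lookup_lam comm_form_trp_left[of "- t" for t] minus_minus comm_form_sym[of P])

sublocale hermitian_module scale conj lam
proof
  show "(1::'d laurent) + 1 = 0" by (rule laurent_double)
qed (simp_all add: conj_add conj_mult conj_conj pairing_add pairing_scale conj_lam
    scale_add_left scale_add_right scale_mult scale_mon trp_0 flip: mon_0)

lemma keys_trp: "q \<in> keys (trp t P) \<Longrightarrow> \<exists>q'\<in>keys P. q = tr t q'"
  using keys_relabel[of "tr t" P] by auto

lemma comm_form_lookup_lam: "comm_form P R = lookup (lam P R) 0"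
  by (simp add: lookup_lam trp_0)

lemma comm_form_scale: "comm_form P (r \<odot> R) = (\<Sum>t\<in>keys r. lookup (lam R P) t)"
  unfolding scale_alt comm_form_sum lookup_lam by (simp add: comm_form_sym)

lemma keys_scale:
  assumes "q \<in> keys (r \<odot> P)"
  shows "\<exists>t\<in>keys r. \<exists>q'\<in>keys P. q = tr t q'"
proof -
  have "keys (r \<odot> P) \<subseteq> (\<Union>t\<in>keys r. keys (trp t P))"
    unfolding scale_alt by (rule keys_sum)
  with assms keys_trp show ?thesis by blast
qed

lemma keys_scale_lam:
  assumes "q \<in> keys (lam w p \<odot> v)"
  shows "\<exists>t. \<exists>q1\<in>keys v. \<exists>q2\<in>keys w. q = tr t q1 \<and> tr t q2 \<in> keys p"
proof -
  obtain t q1 where t: "t \<in> keys (lam w p)" "q1 \<in> keys v" "q = tr t q1"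
    using keys_scale[OF assms] by auto
  then have "comm_form (trp t w) p \<noteq> 0" by (simp only: in_keys_iff lookup_lam not_False_eq_True)
  from comm_form_trp_nonzero[OF this] t show ?thesis by blast
qed

definition restr :: "(int, 'd) vec set \<Rightarrow> 'd laurent \<Rightarrow> 'd laurent" where
  "restr S r = Abs_poly_mapping (\<lambda>t. if t \<in> S then lookup r t else 0)"

lemma lookup_restr: "lookup (restr S r) t = (if t \<in> S then lookup r t else 0)"
  unfolding restr_def
  by (subst lookup_Abs_poly_mapping) (auto intro: finite_subset[OF _ finite_keys[of r]] simp: in_keys_iff)

lemma restr_add: "restr S (r + s) = restr S r + restr S s"
  by (rule poly_mapping_eqI) (simp add: lookup_restr lookup_add)

text \<open>
  If \<open>v\<close> commutes with its translates, this is the product over \<open>t \<in> S\<close> of the Clifford rotations about the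
  translates of \<open>v\<close> by \<open>t\<close>, that is of conjugation by \<open>(1 + i V) / \<surd>2\<close>.
\<close>

definition rot :: "'q pauli \<Rightarrow> (int, 'd) vec set \<Rightarrow> 'q pauli \<Rightarrow> 'q pauli" where
  "rot v S p = p + restr S (lam v p) \<odot> v"

lemma rot_add: "rot v S (p + r) = rot v S p + rot v S r"
  by (simp add: rot_def lam_add_right restr_add scale_add_left add_ac)

lemma rot_rot:
  assumes "lam v v = 0" "S \<inter> S' = {}"
  shows "rot v S (rot v S' p) = rot v (S \<union> S') p"
proof -
  have "restr S (lam v p) + restr S' (lam v p) = restr (S \<union> S') (lam v p)"
    using assms(2) by (intro poly_mapping_eqI) (auto simp: lookup_restr lookup_add)
  then show ?thesis
    by (simp add: rot_def lam_add_right lam_scale_right assms(1) add_ac flip: scale_add_left)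
qed

lemma rot_invol: "lam v v = 0 \<Longrightarrow> rot v S (rot v S p) = p"
  by (simp add: rot_def lam_add_right lam_scale_right add.assoc p_double)

lemma rot_UNIV: "rot v UNIV p = p + lam v p \<odot> v"
proof -
  have "restr UNIV r = r" for r by (rule poly_mapping_eqI) (simp add: lookup_restr)
  then show ?thesis by (simp add: rot_def)
qed

lemma rot_empty: "rot v {} p = p"
proof -
  have "restr {} r = 0" for r by (rule poly_mapping_eqI) (simp add: lookup_restr)
  then show ?thesis by (simp add: rot_def)
qed

lemma comm_form_scale_restr:
  "comm_form p (restr S a \<odot> v) = (\<Sum>t\<in>S \<inter> (keys a \<inter> keys (lam v p)). lookup a t * lookup (lam v p) t)"
proof -
  have k: "keys (restr S a) = S \<inter> keys a" by (auto simp: in_keys_iff lookup_restr split: if_splits)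
  have "comm_form p (restr S a \<odot> v) = (\<Sum>t\<in>S \<inter> keys a. lookup a t * lookup (lam v p) t)"
    unfolding comm_form_scale k by (rule sum.cong) (auto simp: in_keys_iff)
  also have "\<dots> = (\<Sum>t\<in>S \<inter> (keys a \<inter> keys (lam v p)). lookup a t * lookup (lam v p) t)"
    by (rule sum.mono_neutral_right) (auto simp: in_keys_iff)
  finally show ?thesis .
qed

lemma comm_form_rot:
  assumes "lam v v = 0"
  shows "comm_form (rot v S p) (rot v S r) = comm_form p r"
proof -
  have "comm_form (a \<odot> v) (b \<odot> v) = 0" for a b
    by (simp add: comm_form_lookup_lam lam_scale_left lam_scale_right assms)
  moreover have "comm_form p (restr S (lam v r) \<odot> v) = comm_form (restr S (lam v p) \<odot> v) r"
    unfolding comm_form_sym[of _ r] comm_form_scale_restr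
    by (rule sum.cong) (auto simp: mult.commute)
  ultimately show ?thesis
    by (simp add: rot_def comm_form_add comm_form_add_left bit_double add_ac
        add.left_commute[of "comm_form (restr S (lam v p) \<odot> v) r"])
qed

end

section \<open>Circuits and shifts from module maps\<close>

lemma finite_depth_circuit_comp:
  "finite_depth_circuit Q pos \<alpha> \<Longrightarrow> finite_depth_circuit Q pos \<beta> \<Longrightarrow> finite_depth_circuit Q pos (\<alpha> \<circ> \<beta>)"
  by (induction rule: finite_depth_circuit.induct)
    (auto simp: comp_assoc intro: finite_depth_circuit.intros)

lemma circuit_shift_comp:
  "circuit_shift_composition Q pos \<alpha> \<Longrightarrow> circuit_shift_composition Q pos \<beta> \<Longrightarrow>
    circuit_shift_composition Q pos (\<alpha> \<circ> \<beta>)"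
  by (induction rule: circuit_shift_composition.induct)
    (auto simp: comp_assoc intro: circuit_shift_composition.intros)

lemma circuit_shift_circuit:
  "finite_depth_circuit Q pos \<alpha> \<Longrightarrow> circuit_shift_composition Q pos \<alpha>"
  using circuit_shift_composition.intros(2)[OF _ circuit_shift_composition.intros(1), of Q pos \<alpha>]
  by (simp only: comp_id)

lemma circuit_shift_shift:
  "qubit_shift Q pos \<alpha> \<Longrightarrow> circuit_shift_composition Q pos \<alpha>"
  using circuit_shift_composition.intros(3)[OF _ circuit_shift_composition.intros(1), of Q pos \<alpha>]
  by (simp only: comp_id)

lemma pauli_automorphism_comp:
  assumes "pauli_automorphism Q \<alpha>" "pauli_automorphism Q \<beta>"
  shows "pauli_automorphism Q (\<alpha> \<circ> \<beta>)"
proof -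
  have \<beta>: "\<beta> P \<in> paulis Q" if "P \<in> paulis Q" for P
    using assms(2) that by (auto simp: pauli_automorphism_def dest: bij_betwE)
  show ?thesis
    using assms \<beta> unfolding pauli_automorphism_def
    by (auto intro: bij_betw_trans)
qed

lemma pauli_automorphism_id: "pauli_automorphism Q id"
  by (simp add: pauli_automorphism_def)

lemma pauli_automorphism_cong:
  assumes "pauli_automorphism Q \<alpha>" "\<And>P. P \<in> paulis Q \<Longrightarrow> \<beta> P = \<alpha> P"
  shows "pauli_automorphism Q \<beta>"
  using assms unfolding pauli_automorphism_def
  by (auto simp: paulis_add cong: bij_betw_cong)

lemma finite_depth_circuit_automorphism:
  "finite_depth_circuit Q pos \<alpha> \<Longrightarrow> pauli_automorphism Q \<alpha>"
proof (induction rule: finite_depth_circuit.induct)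
  case (2 \<gamma> \<alpha>)
  then show ?case by (intro pauli_automorphism_comp) (auto simp: block_diagonal_def)
qed (rule pauli_automorphism_id)

lemma qubit_shift_automorphism:
  assumes "qubit_shift Q pos \<alpha>"
  shows "pauli_automorphism Q \<alpha>"
proof -
  obtain \<pi> where \<pi>: "bij_betw \<pi> Q Q" and \<alpha>: "\<And>P. P \<in> paulis Q \<Longrightarrow> \<alpha> P = relabel \<pi> P"
    using assms by (auto simp: qubit_shift_def)
  let ?g = "inv_into Q \<pi>"
  have Q: "\<pi> q \<in> Q" "?g q \<in> Q" "\<pi> (?g q) = q" "?g (\<pi> q) = q" if "q \<in> Q" for q
    using that \<pi> by (auto simp: bij_betw_def inv_into_into f_inv_into_f)
  have rel: "relabel f (relabel h P) = P" if "\<And>q. q \<in> Q \<Longrightarrow> f (h q) = q" "P \<in> paulis Q" for f h :: "'a \<Rightarrow> 'a" and P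
    unfolding relabel_relabel using that relabel_cong[of P "f \<circ> h" id]
    by (auto simp: relabel_id paulis_def)
  have "pauli_automorphism Q (relabel \<pi>)"
    unfolding pauli_automorphism_def paulis_commute_iff
  proof (intro conjI ballI)
    show "bij_betw (relabel \<pi>) (paulis Q) (paulis Q)"
      by (rule bij_betw_byWitness[where f' = "relabel ?g"])
        (auto intro: rel paulis_relabel simp: Q)
    fix P R assume "P \<in> paulis Q" "R \<in> paulis Q"
    then have "inj_on \<pi> (keys P \<union> keys R)"
      using \<pi> by (auto simp: bij_betw_def paulis_def intro: inj_on_subset)
    then show "(comm_form (relabel \<pi> P) (relabel \<pi> R) = 0) = (comm_form P R = 0)"
      by (simp add: comm_form_relabel)
  qed (rule relabel_add)
  then show ?thesis using \<alpha> by (rule pauli_automorphism_cong)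
qed

lemma circuit_shift_automorphism:
  "circuit_shift_composition Q pos \<alpha> \<Longrightarrow> pauli_automorphism Q \<alpha>"
proof (induction rule: circuit_shift_composition.induct)
  case (2 \<gamma> \<alpha>)
  show ?case by (rule pauli_automorphism_comp[OF finite_depth_circuit_automorphism[OF 2(1)] 2(3)])
next
  case (3 \<gamma> \<alpha>)
  show ?case by (rule pauli_automorphism_comp[OF qubit_shift_automorphism[OF 3(1)] 3(3)])
qed (rule pauli_automorphism_id)

lemma finite_bounded_vec: "finite {c :: (int, 'd::finite) vec. \<forall>i. 0 \<le> c $ i \<and> c $ i < L}"
proof (rule finite_subset)
  show "{c :: (int, 'd) vec. \<forall>i. 0 \<le> c $ i \<and> c $ i < L} \<subseteq>
      (\<lambda>f. \<chi> i. f i) ` (PiE UNIV (\<lambda>_. {0..<L}))"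
  proof
    fix c :: "(int, 'd) vec" assume "c \<in> {c. \<forall>i. 0 \<le> c $ i \<and> c $ i < L}"
    then show "c \<in> (\<lambda>f. \<chi> i. f i) ` (PiE UNIV (\<lambda>_. {0..<L}))"
      by (intro image_eqI[where x = "\<lambda>i. c $ i"]) auto
  qed
qed (intro finite_imageI finite_PiE, auto)

locale qubit_system = lattice_qubits pos tr
  for pos :: "'q \<Rightarrow> (int, 'd::finite) vec" and tr :: "(int, 'd) vec \<Rightarrow> 'q \<Rightarrow> 'q" +
  fixes Q :: "'q set"
  assumes tr_Q: "q \<in> Q \<Longrightarrow> tr t q \<in> Q"
begin

lemma trp_Q: "P \<in> paulis Q \<Longrightarrow> trp t P \<in> paulis Q"
  by (rule paulis_relabel[of P Q]) (auto intro: tr_Q)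

lemma scale_Q: "P \<in> paulis Q \<Longrightarrow> r \<odot> P \<in> paulis Q"
  unfolding scale_alt by (rule paulis_sum) (rule trp_Q)

lemma pauli_automorphismI:
  assumes "\<And>P. P \<in> paulis Q \<Longrightarrow> \<alpha> P \<in> paulis Q" "\<And>P. P \<in> paulis Q \<Longrightarrow> \<beta> P \<in> paulis Q"
    "\<And>P. P \<in> paulis Q \<Longrightarrow> \<alpha> (\<beta> P) = P" "\<And>P. P \<in> paulis Q \<Longrightarrow> \<beta> (\<alpha> P) = P"
    "\<And>P R. P \<in> paulis Q \<Longrightarrow> R \<in> paulis Q \<Longrightarrow> \<alpha> (P + R) = \<alpha> P + \<alpha> R"
    "\<And>P R. P \<in> paulis Q \<Longrightarrow> R \<in> paulis Q \<Longrightarrow> comm_form (\<alpha> P) (\<alpha> R) = comm_form P R"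
  shows "pauli_automorphism Q \<alpha>"
  unfolding pauli_automorphism_def paulis_commute_iff
proof (intro conjI ballI)
  show "bij_betw \<alpha> (paulis Q) (paulis Q)"
    by (rule bij_betw_byWitness[where f' = \<beta>]) (use assms(1-4) in auto)
qed (simp_all add: assms(5,6))

lemma rot_Q: "v \<in> paulis Q \<Longrightarrow> P \<in> paulis Q \<Longrightarrow> rot v S P \<in> paulis Q"
  unfolding rot_def by (intro paulis_add scale_Q)

lemma rot_automorphism:
  assumes "v \<in> paulis Q" "lam v v = 0"
  shows "pauli_automorphism Q (rot v S)"
  by (rule pauli_automorphismI[where \<beta> = "rot v S"])
    (simp_all add: rot_Q assms rot_invol rot_add comm_form_rot)

text \<open>
  Translates of \<open>v\<close> by vectors congruent to \<open>c\<close> modulo \<open>L\<close> have supports in distinct cubes of side \<open>L\<close>, centred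
  at those vectors. The rotations about them therefore act block by block.
\<close>

lemma rot_block_diagonal:
  assumes v: "v \<in> paulis Q" "lam v v = 0"
    and l: "\<And>q i. q \<in> keys v \<Longrightarrow> \<bar>pos q $ i\<bar> \<le> l" "0 \<le> l"
  defines "L \<equiv> 2 * l + 1"
  shows "block_diagonal Q pos (rot v {t. \<forall>i. t $ i mod L = c $ i mod L})" (is "block_diagonal Q pos (rot v ?S)")
proof -
  \<comment> \<open>The coordinates of the cube of side L that contains a site; the offset l centres the cubes at the sites congruent to c.\<close>
  define blk where "blk u = (\<chi> i. (u $ i - c $ i + l) div L)" for u :: "(int, 'd) vec"
  let ?\<B> = "(\<lambda>u. {w. blk w = blk u}) ` UNIV"
  have L: "L > 0" using l(2) by (simp add: L_def)
  have part: "partition_on UNIV ?\<B>"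
    by (rule partition_onI) (auto simp: disjnt_def)
  have diam: "site_dist u w \<le> int CARD('d) * L" if "blk u = blk w" for u w
  proof -
    have "\<bar>u $ i - w $ i\<bar> \<le> L" for i
    proof -
      have "(u $ i - c $ i + l) div L = (w $ i - c $ i + l) div L"
        using that by (auto simp: blk_def vec_eq_iff)
      then have "(u $ i - c $ i + l) - (w $ i - c $ i + l) =
          (u $ i - c $ i + l) mod L - (w $ i - c $ i + l) mod L"
        by (metis add_diff_cancel_left div_mult_mod_eq)
      moreover have "0 \<le> (u $ i - c $ i + l) mod L" "(u $ i - c $ i + l) mod L < L"
        "0 \<le> (w $ i - c $ i + l) mod L" "(w $ i - c $ i + l) mod L < L"
        using L by auto
      ultimately show ?thesis by linarith
    qed
    then show ?thesis
      unfolding site_dist_def by (rule order_trans[OF sum_mono]) simp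
  qed
  have blk_tr: "blk (pos (tr t q)) = blk (pos (tr t q'))" if "t \<in> ?S" "q \<in> keys v" "q' \<in> keys v" for t q q'
  proof -
    have "(t $ i + pos p $ i - c $ i + l) div L = (t $ i - c $ i) div L" if "p \<in> keys v" for p i
    proof -
      have "(t $ i - c $ i) mod L = 0" using \<open>t \<in> ?S\<close> by (simp add: mod_diff_eq[symmetric, of "t $ i"])
      then obtain m where m: "t $ i - c $ i = L * m" by (auto simp: mod_eq_0_iff_dvd dvd_def)
      have "t $ i + pos p $ i - c $ i + l = (pos p $ i + l) + L * m" using m by simp
      moreover have "(pos p $ i + l) div L = 0"
        using l(1)[OF that, of i] by (intro div_pos_pos_trivial) (auto simp: L_def)
      ultimately have "(t $ i + pos p $ i - c $ i + l) div L = m"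
        using L by (metis add_0_right div_mult_self2 less_irrefl add.commute)
      then show ?thesis using L by (simp add: m)
    qed
    then show ?thesis using that by (simp add: blk_def pos_tr)
  qed
  have inv: "rot v ?S P \<in> paulis {q \<in> Q. blk (pos q) = b}" if P: "P \<in> paulis {q \<in> Q. blk (pos q) = b}" for P b
  proof -
    have PQ: "P \<in> paulis Q" using P by (auto simp: paulis_def)
    have "q \<in> Q \<and> blk (pos q) = b" if q: "q \<in> keys (restr ?S (lam v P) \<odot> v)" for q
    proof -
      have "q \<in> Q" using q scale_Q[OF v(1)] by (auto simp: paulis_def)
      obtain t q1 where t: "t \<in> keys (restr ?S (lam v P))" "q1 \<in> keys v" "q = tr t q1"
        using keys_scale[OF q] by auto
      then have tS: "t \<in> ?S" and "comm_form (trp t v) P \<noteq> 0"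
        by (auto simp only: in_keys_iff lookup_restr lookup_lam split: if_splits)
      then obtain q2 where "q2 \<in> keys v" "tr t q2 \<in> keys P"
        using comm_form_trp_nonzero by blast
      with P blk_tr[OF tS t(2), of q2] t(3) \<open>q \<in> Q\<close> show ?thesis by (auto simp: paulis_def)
    qed
    then show ?thesis
      unfolding rot_def by (intro paulis_add P) (auto simp: paulis_def)
  qed
  have "rot v ?S ` paulis {q \<in> Q. blk (pos q) = b} = paulis {q \<in> Q. blk (pos q) = b}" for b
  proof
    show "paulis {q \<in> Q. blk (pos q) = b} \<subseteq> rot v ?S ` paulis {q \<in> Q. blk (pos q) = b}"
    proof
      fix P assume "P \<in> paulis {q \<in> Q. blk (pos q) = b}"
      then have "rot v ?S P \<in> paulis {q \<in> Q. blk (pos q) = b}" by (rule inv)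
      moreover have "P = rot v ?S (rot v ?S P)" by (rule rot_invol[OF v(2), symmetric])
      ultimately show "P \<in> rot v ?S ` paulis {q \<in> Q. blk (pos q) = b}" by blast
    qed
  qed (use inv in auto)
  then have "\<forall>B\<in>?\<B>. rot v ?S ` paulis {q \<in> Q. pos q \<in> B} = paulis {q \<in> Q. pos q \<in> B}"
    by simp
  then show ?thesis
    unfolding block_diagonal_def using rot_automorphism[OF v] part diam
    by (intro conjI exI[of _ ?\<B>] exI[of _ "int CARD('d) * L"]) auto
qed

text \<open>
  The translations fall into finitely many congruence classes modulo \<open>L\<close>, and each class is one block
  diagonal step.
\<close>

lemma rotation_circuit:
  assumes v: "v \<in> paulis Q" "lam v v = 0"
  shows "finite_depth_circuit Q pos (\<lambda>p. p + lam v p \<odot> v)"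
proof -
  define l where "l = (\<Sum>q\<in>keys v. \<Sum>i\<in>UNIV. \<bar>pos q $ i\<bar>)"
  have l0: "0 \<le> l" by (auto simp: l_def intro: sum_nonneg)
  have l: "\<bar>pos q $ i\<bar> \<le> l" if "q \<in> keys v" for q i
  proof -
    have "\<bar>pos q $ i\<bar> \<le> (\<Sum>i\<in>UNIV. \<bar>pos q $ i\<bar>)"
      by (rule member_le_sum) auto
    also have "\<dots> \<le> l" unfolding l_def
      by (rule member_le_sum[OF that]) (auto intro: sum_nonneg)
    finally show ?thesis .
  qed
  define L where "L = 2 * l + 1"
  have L: "L > 0" using l0 by (simp add: L_def)
  define cls where "cls c = {t :: (int, 'd) vec. \<forall>i. t $ i mod L = c $ i mod L}" for c
  let ?C = "{c :: (int, 'd) vec. \<forall>i. 0 \<le> c $ i \<and> c $ i < L}"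
  have "finite_depth_circuit Q pos (rot v (\<Union> (cls ` K)))" if "finite K" "K \<subseteq> ?C" for K
    using that
  proof (induction K)
    case empty
    have "rot v {} = id" by (rule ext) (simp add: rot_empty)
    then show ?case by (simp only: image_empty Union_empty finite_depth_circuit.intros(1))
  next
    case (insert c K)
    have "cls c \<inter> \<Union> (cls ` K) = {}"
    proof -
      have "c = c'" if "c' \<in> K" "t \<in> cls c" "t \<in> cls c'" for c' t
      proof (rule vec_eq_iff[THEN iffD2], rule allI)
        fix i
        have "c $ i mod L = c' $ i mod L" using that by (simp add: cls_def)
        moreover have "c $ i mod L = c $ i" "c' $ i mod L = c' $ i"
          using insert.prems that(1) by auto
        ultimately show "c $ i = c' $ i" by simp
      qed
      then show ?thesis using insert.hyps by blast
    qed
    then have "rot v (\<Union> (cls ` insert c K)) = rot v (cls c) \<circ> rot v (\<Union> (cls ` K))"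
      by (intro ext) (simp add: rot_rot v(2))
    moreover have "block_diagonal Q pos (rot v (cls c))"
      unfolding cls_def L_def by (rule rot_block_diagonal) (use v l l0 in auto)
    moreover have "finite_depth_circuit Q pos (rot v (\<Union> (cls ` K)))" using insert by simp
    ultimately show ?case by (simp only: finite_depth_circuit.intros(2))
  qed
  from this[OF finite_bounded_vec] have "finite_depth_circuit Q pos (rot v (\<Union> (cls ` ?C)))" by simp
  moreover have "\<Union> (cls ` ?C) = UNIV"
  proof (rule UNIV_eq_I[symmetric])
    fix t :: "(int, 'd) vec"
    have "t \<in> cls (\<chi> i. t $ i mod L)" by (simp add: cls_def)
    moreover have "(\<chi> i. t $ i mod L) \<in> ?C" using L by simp
    ultimately show "t \<in> \<Union> (cls ` ?C)" by blast
  qed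
  moreover have "rot v UNIV = (\<lambda>p. p + lam v p \<odot> v)" by (rule ext) (rule rot_UNIV)
  ultimately show ?thesis by simp
qed

text \<open>
  In characteristic 2 the quadratic expression for \<open>v + w\<close> exceeds the sum of those for \<open>v\<close> and
  \<open>w\<close> by exactly the two mixed terms.
\<close>

lemma pair_circuit:
  assumes "v \<in> paulis Q" "w \<in> paulis Q" "lam v v = 0" "lam w w = 0" "lam v w = 0"
  shows "finite_depth_circuit Q pos (\<lambda>p. p + (lam w p \<odot> v + lam v p \<odot> w))"
proof -
  have wv: "lam w v = 0" by (rule lam_zero_sym) (rule assms)
  have "(\<lambda>p. p + (lam w p \<odot> v + lam v p \<odot> w)) =
     (\<lambda>p. p + lam (v + w) p \<odot> (v + w)) \<circ> ((\<lambda>p. p + lam v p \<odot> v) \<circ> (\<lambda>p. p + lam w p \<odot> w))"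
    by (rule ext) (simp add: lam_simps assms wv scale_add_left scale_add_right p_double p_double' add_ac)
  moreover have "finite_depth_circuit Q pos \<dots>"
    by (intro finite_depth_circuit_comp rotation_circuit)
      (simp_all add: assms wv lam_simps paulis_add)
  ultimately show ?thesis by simp
qed

lemma sym_map_circuit:
  assumes "\<And>v w. (v, w) \<in> set L \<Longrightarrow> v \<in> V \<and> w \<in> V" "V \<subseteq> paulis Q" "\<And>v w. v \<in> V \<Longrightarrow> w \<in> V \<Longrightarrow> lam v w = 0"
  shows "finite_depth_circuit Q pos (\<lambda>p. p + sym_map L p)"
  using assms(1)
proof (induction L)
  case Nil
  have "(\<lambda>p::'q pauli. p + sym_map [] p) = id" by (rule ext) (simp add: sym_map_def)
  then show ?case by (simp add: finite_depth_circuit.intros(1))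
next
  case (Cons vw L)
  obtain v w where vw: "vw = (v, w)" by (cases vw)
  have V: "v \<in> V" "w \<in> V" using Cons.prems vw by auto
  have "lam v' (sym_map L p) = 0" if "v' \<in> V" for v' p
  proof -
    have "set L \<subseteq> V \<times> V" using Cons.prems by auto
    then show ?thesis
      using that by (induction L) (auto simp: sym_map_def lam_simps assms(3))
  qed
  then have "(\<lambda>p. p + sym_map (vw # L) p) =
      (\<lambda>p. p + (lam w p \<odot> v + lam v p \<odot> w)) \<circ> (\<lambda>p. p + sym_map L p)"
    using V by (intro ext, simp add: vw lam_simps, simp add: sym_map_def add_ac)
  moreover have "finite_depth_circuit Q pos \<dots>"
    using V assms(2) by (intro finite_depth_circuit_comp pair_circuit Cons.IH Cons.prems assms(3)) auto
  ultimately show ?case by simp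
qed

definition orbit_shift :: "'q \<Rightarrow> (int, 'd) vec \<Rightarrow> 'q \<Rightarrow> 'q" where
  "orbit_shift q0 s q = (if q \<in> range (\<lambda>t. tr t q0) then tr s q else q)"

lemma orbit_shift:
  "qubit_shift Q pos (relabel (orbit_shift q0 s))" (is ?shift)
  "relabel (orbit_shift q0 s) p = p + (1 + mon s) \<odot> (lam (PZ q0) p \<odot> PX q0 + lam (PX q0) p \<odot> PZ q0)"
proof -
  let ?g = "orbit_shift q0 s"
  have orb: "tr t q \<in> range (\<lambda>t. tr t q0) \<longleftrightarrow> q \<in> range (\<lambda>t. tr t q0)" for t q
  proof
    assume "tr t q \<in> range (\<lambda>t. tr t q0)"
    then obtain u where "tr t q = tr u q0" by auto
    then have "tr (- t) (tr t q) = tr (- t + u) q0" by (simp only: tr_add)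
    then have "q = tr (- t + u) q0" by (simp only: tr_add[symmetric] left_minus tr_0)
    then show "q \<in> range (\<lambda>t. tr t q0)" by blast
  next
    assume "q \<in> range (\<lambda>t. tr t q0)"
    then obtain u where "q = tr u q0" by auto
    then have "tr t q = tr (t + u) q0" by (simp only: tr_add)
    then show "tr t q \<in> range (\<lambda>t. tr t q0)" by blast
  qed
  have inv: "tr (- s) (tr s q) = q" "tr s (tr (- s) q) = q" for s q
    by (simp_all only: tr_add[symmetric] left_minus right_minus tr_0)
  have "bij_betw ?g Q Q"
    by (rule bij_betw_byWitness[where f' = "\<lambda>q. if q \<in> range (\<lambda>t. tr t q0) then tr (- s) q else q"])
      (auto simp: orbit_shift_def orb tr_Q inv)
  moreover have "site_dist (pos (?g q)) (pos q) \<le> site_dist s 0" for q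
    by (auto simp: orbit_shift_def pos_tr site_dist_def intro: sum_nonneg)
  ultimately show ?shift
    unfolding qubit_shift_def by blast
  let ?F = "\<lambda>p. p + (1 + mon s) \<odot> (lam (PZ q0) p \<odot> PX q0 + lam (PX q0) p \<odot> PZ q0)"
  show "relabel ?g p = ?F p"
  proof (induction p rule: poly_mapping_additive_induct)
    case (1 k v)
    show ?case
    proof (cases "k \<in> range (\<lambda>t. tr t q0)")
      case True
      then obtain t where k: "k = tr t q0" by blast
      have "lam (single q0 a) (single q0 b) = (if fst a * snd b + snd a * fst b = 1 then 1 else 0)" for a b
      proof (rule poly_mapping_eqI)
        fix u
        have "tr u q0 = q0 \<longleftrightarrow> u = 0"
          using pos_tr[of u q0] tr_0[of q0] by auto
        then show "lookup (lam (single q0 a) (single q0 b)) u =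
            lookup (if fst a * snd b + snd a * fst b = 1 then 1 else 0) u"
          by (auto simp: lookup_lam relabel_single comm_form_single lookup_one when_def)
      qed
      then have l: "lam (PZ q0) (single q0 v) = of_bool (fst v = 1)" "lam (PX q0) (single q0 v) = of_bool (snd v = 1)"
        by (simp_all add: PX_def PZ_def)
      have "lam (PZ q0) (single q0 v) \<odot> PX q0 + lam (PX q0) (single q0 v) \<odot> PZ q0 = single q0 v"
        unfolding l by (cases v; cases "fst v"; cases "snd v")
          (simp_all add: PX_def PZ_def single_add[symmetric] zero_prod_def[symmetric])
      moreover have "single k v = trp t (single q0 v)" by (simp add: k relabel_single)
      ultimately have "lam (PZ q0) (single k v) \<odot> PX q0 + lam (PX q0) (single k v) \<odot> PZ q0 = single k v"
        by (simp only: lam_trp_right scale_mult scale_mon flip: relabel_add)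
      then show ?thesis
        by (simp add: relabel_single orbit_shift_def True scale_add_left scale_mon add.assoc[symmetric] p_double)
    next
      case False
      have "lam (single q0 a) (single k v) = 0" for a
      proof (rule poly_mapping_eqI)
        show "lookup (lam (single q0 a) (single k v)) t = lookup 0 t" for t
          using False by (auto simp: lookup_lam relabel_single comm_form_single)
      qed
      then show ?thesis
        by (simp add: relabel_single orbit_shift_def False PX_def PZ_def)
    qed
  qed (simp add: relabel_add lam_simps scale_add_left scale_add_right add_ac)
qed

lemma lam_PX_PZ:
  "lam (PX q) (PX q') = 0" "lam (PZ q) (PZ q') = 0"
  by (rule poly_mapping_eqI, simp add: lookup_lam PX_def PZ_def relabel_single comm_form_single)+

lemma lam_PX_PZ_base:
  assumes "pos q = 0" "pos q' = 0"
  shows "lam (PX q) (PZ q') = of_bool (q = q')"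
proof (rule poly_mapping_eqI)
  fix t
  have "tr t q = q' \<longleftrightarrow> t = 0 \<and> q = q'"
    using pos_tr[of t q] tr_0[of q] assms by auto
  then show "lookup (lam (PX q) (PZ q')) t = lookup (of_bool (q = q')) t"
    by (auto simp: lookup_lam PX_def PZ_def relabel_single comm_form_single lookup_one when_def)
qed

text \<open>
  The map spreads an operator only by the differences of positions between the two components of the
  finitely many pairs in the list.
\<close>

lemma lin_local:
  "\<exists>r. \<forall>p. \<forall>q\<in>keys (p + lin L p). \<exists>q'\<in>keys p. site_dist (pos q) (pos q') \<le> r"
proof (induction L)
  case Nil
  have "site_dist u u = 0" for u :: "(int, 'd) vec" by (simp add: site_dist_def)
  then have "\<forall>p. \<forall>q\<in>keys (p + lin [] p). \<exists>q'\<in>keys p. site_dist (pos q) (pos q') \<le> 0"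
  proof (intro allI ballI)
    fix p q assume "q \<in> keys (p + lin [] p)"
    then have "q \<in> keys p" by (simp add: lin_def)
    then show "\<exists>q'\<in>keys p. site_dist (pos q) (pos q') \<le> 0"
      using \<open>site_dist (pos q) (pos q) = 0\<close> by (intro bexI[of _ q]) auto
  qed
  then show ?case by blast
next
  case (Cons vw L)
  obtain v w where vw: "vw = (v, w)" by (cases vw)
  obtain r where r: "\<And>p q. q \<in> keys (p + lin L p) \<Longrightarrow> \<exists>q'\<in>keys p. site_dist (pos q) (pos q') \<le> r"
    using Cons by blast
  \<comment> \<open>The translates of v and w that meet have the same offset, so finitely many distances occur.\<close>
  define r' where "r' = Max (insert r ((\<lambda>(q1, q2). site_dist (pos q1) (pos q2)) ` (keys v \<times> keys w)))"
  have "\<exists>q'\<in>keys p. site_dist (pos q) (pos q') \<le> r'" if q: "q \<in> keys (p + lin (vw # L) p)" for p q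
  proof -
    have "p + lin (vw # L) p = (p + lin L p) + lam w p \<odot> v"
      by (simp add: lin_def vw add_ac)
    with q have "q \<in> keys (p + lin L p) \<or> q \<in> keys (lam w p \<odot> v)"
      using keys_add[of "p + lin L p" "lam w p \<odot> v"] by auto
    then show ?thesis
    proof
      assume "q \<in> keys (p + lin L p)"
      then obtain q' where "q' \<in> keys p" "site_dist (pos q) (pos q') \<le> r" using r by blast
      moreover have "r \<le> r'" unfolding r'_def by (rule Max_ge) auto
      ultimately show ?thesis by force
    next
      assume "q \<in> keys (lam w p \<odot> v)"
      then obtain t q1 q2 where t: "q1 \<in> keys v" "q2 \<in> keys w" "q = tr t q1" "tr t q2 \<in> keys p"
        using keys_scale_lam by blast
      have "site_dist (pos q) (pos (tr t q2)) = site_dist (pos q1) (pos q2)"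
        by (simp add: t(3) pos_tr site_dist_def)
      also have "\<dots> \<le> r'" unfolding r'_def by (rule Max_ge) (use t in auto)
      finally show ?thesis using t(4) by blast
    qed
  qed
  then show ?case by blast
qed

lemma clifford_qca_lin:
  assumes "pauli_automorphism Q \<alpha>" "\<And>p. p \<in> paulis Q \<Longrightarrow> \<alpha> p = p + lin L p"
  shows "clifford_qca Q pos \<alpha>"
proof -
  obtain r where "\<forall>p. \<forall>q\<in>keys (p + lin L p). \<exists>q'\<in>keys p. site_dist (pos q) (pos q') \<le> r"
    using lin_local by blast
  then show ?thesis unfolding clifford_qca_def using assms by auto
qed

lemma translation_invariant_lin:
  assumes "\<And>p. p \<in> paulis Q \<Longrightarrow> \<alpha> p = p + lin L p"
  shows "translation_invariant Q tr \<alpha>"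
  unfolding translation_invariant_def
proof (intro allI ballI)
  fix t P assume P: "P \<in> paulis Q"
  show "\<alpha> (trp t P) = trp t (\<alpha> P)"
    unfolding assms[OF P] assms[OF trp_Q[OF P]] relabel_add
    by (simp only: lin_scale flip: scale_mon)
qed

end

section \<open>Stabilization\<close>

definition stab_tr :: "((int, 'd::finite) vec \<Rightarrow> 'q \<Rightarrow> 'q) \<Rightarrow> (int, 'd) vec \<Rightarrow>
    'q + (int, 'd) vec \<times> nat \<Rightarrow> 'q + (int, 'd) vec \<times> nat" where
  "stab_tr tr t = map_sum (tr t) (map_prod ((+) t) id)"

lemma (in qubit_system) stab_system: "qubit_system (stab_pos pos) (stab_tr tr) (stab_qubits Q m)"
proof
  fix s t and q :: "'q + (int, 'd) vec \<times> nat"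
  show "stab_tr tr 0 q = q" by (cases q) (auto simp: stab_tr_def tr_0)
  show "stab_tr tr (s + t) q = stab_tr tr s (stab_tr tr t q)"
    by (cases q) (auto simp: stab_tr_def tr_add add.assoc)
  show "stab_pos pos (stab_tr tr t q) = t + stab_pos pos q"
    by (cases q) (auto simp: stab_tr_def stab_pos_def pos_tr)
  show "q \<in> stab_qubits Q m \<Longrightarrow> stab_tr tr t q \<in> stab_qubits Q m"
    by (auto simp: stab_tr_def stab_qubits_def tr_Q)
qed

locale embedding = A: qubit_system posA trA Q + B: lattice_qubits posB trB
  for posA :: "'q \<Rightarrow> (int, 'd::finite) vec" and trA Q
    and posB :: "'r \<Rightarrow> (int, 'd) vec" and trB +
  fixes g :: "'q \<Rightarrow> 'r"
  assumes inj: "inj_on g Q" and equivariant: "g (trA t q) = trB t (g q)"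
begin

lemma relabel_trp: "relabel g (A.trp t P) = B.trp t (relabel g P)"
  unfolding relabel_relabel by (rule relabel_cong) (simp add: equivariant)

lemma relabel_scale: "relabel g (A.scale r P) = B.scale r (relabel g P)"
  by (simp add: A.scale_alt B.scale_alt relabel_sum relabel_trp)

lemma lam_relabel:
  assumes "P \<in> paulis Q" "R \<in> paulis Q"
  shows "B.lam (relabel g P) (relabel g R) = A.lam P R"
proof (rule poly_mapping_eqI)
  fix t
  have "keys (A.trp t P) \<union> keys R \<subseteq> Q"
    using A.trp_Q[OF assms(1)] assms(2) by (auto simp: paulis_def)
  then show "lookup (B.lam (relabel g P) (relabel g R)) t = lookup (A.lam P R) t"
    unfolding A.lookup_lam B.lookup_lam relabel_trp[symmetric]
    by (intro comm_form_relabel inj_on_subset[OF inj])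
qed

lemma relabel_lin:
  assumes "set L \<subseteq> paulis Q \<times> paulis Q" "P \<in> paulis Q"
  shows "relabel g (A.lin L P) = B.lin (map (map_prod (relabel g) (relabel g)) L) (relabel g P)"
  using assms(1)
proof (induction L)
  case (Cons vw L)
  then show ?case
    by (cases vw) (auto simp: A.lin_def B.lin_def relabel_add relabel_scale lam_relabel assms(2))
qed (simp add: A.lin_def B.lin_def relabel_zero)

end

lemma (in lattice_qubits) lin_zero:
  "(\<And>v w. (v, w) \<in> set L \<Longrightarrow> lam w p = 0) \<Longrightarrow> lin L p = 0"
proof (induction L)
  case (Cons vw L)
  obtain v w where vw: "vw = (v, w)" by (cases vw)
  have "lin L p = 0" "lam w p = 0" using Cons vw by auto
  then show ?case by (simp add: lin_def vw)
qed (simp add: lin_def)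

text \<open>
  A list of local terms on the original qubits commutes with every operator on the added ones.
  Consequently the stabilized map has the same presentation, with the terms transported along the
  identification \<open>\<sigma>\<close> of the qubits.
\<close>

lemma stabilize_lin:
  fixes \<sigma> :: "'q + (int, 'd::finite) vec \<times> nat \<Rightarrow> 'r"
  assumes A: "qubit_system posA trA Q" and B: "lattice_qubits posB trB"
    and sigma_inj: "inj_on \<sigma> (stab_qubits Q m)"
    and equivariant: "\<And>t q. \<sigma> (Inl (trA t q)) = trB t (\<sigma> (Inl q))"
    and \<alpha>: "\<And>p. p \<in> paulis Q \<Longrightarrow> \<alpha> p = p + hermitian_module.lin (lattice_qubits.scale trA) (lattice_qubits.lam trA) L p"
    and L: "set L \<subseteq> paulis Q \<times> paulis Q"
    and P: "P \<in> paulis (stab_qubits Q m)"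
  shows "relabel \<sigma> (stabilize \<alpha> P) = relabel \<sigma> P +
    hermitian_module.lin (lattice_qubits.scale trB) (lattice_qubits.lam trB)
      (map (map_prod (relabel (\<sigma> \<circ> Inl)) (relabel (\<sigma> \<circ> Inl))) L) (relabel \<sigma> P)"
proof -
  interpret A: qubit_system posA trA Q by (rule A)
  interpret B: lattice_qubits posB trB by (rule B)
  have "inj_on (\<sigma> \<circ> Inl) Q"
    using sigma_inj by (auto simp: inj_on_def stab_qubits_def)
  then interpret embedding posA trA Q posB trB "\<sigma> \<circ> Inl"
    by unfold_locales (auto simp: equivariant)
  let ?L = "map (map_prod (relabel (\<sigma> \<circ> Inl)) (relabel (\<sigma> \<circ> Inl))) L"
  define P1 where "P1 = Poly_Mapping.map_key Inl P"
  define P2 where "P2 = Poly_Mapping.map_key Inr P"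
  have lP: "lookup P1 q = lookup P (Inl q)" "lookup P2 x = lookup P (Inr x)" for q x
    by (simp_all add: P1_def P2_def map_key.rep_eq)
  have kP: "keys P \<subseteq> stab_qubits Q m" using P by (simp add: paulis_def)
  have P1: "P1 \<in> paulis Q"
    unfolding paulis_def
  proof (rule CollectI, rule subsetI)
    fix q assume "q \<in> keys P1"
    then have "Inl q \<in> keys P" by (simp add: in_keys_iff lP)
    then have "(Inl q :: 'q + (int, 'd) vec \<times> nat) \<in> stab_qubits Q m" by (rule subsetD[OF kP])
    then show "q \<in> Q" by (auto simp only: stab_qubits_def Plus_def)
  qed
  have dec: "relabel Inl P1 + relabel Inr P2 = P"
  proof (rule poly_mapping_eqI)
    fix k :: "'q + (int, 'd) vec \<times> nat"
    have l: "lookup (relabel Inl P1) (Inl q :: 'q + (int, 'd) vec \<times> nat) = lookup P1 q"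
      "lookup (relabel Inr P2) (Inr x :: 'q + (int, 'd) vec \<times> nat) = lookup P2 x" for q x
      by (rule lookup_relabel[of _ UNIV]; simp)+
    have z: "lookup (relabel Inl P1) (Inr x :: 'q + (int, 'd) vec \<times> nat) = 0"
      "lookup (relabel Inr P2) (Inl q :: 'q + (int, 'd) vec \<times> nat) = 0" for q x
      using keys_relabel[of "Inl :: 'q \<Rightarrow> 'q + (int, 'd) vec \<times> nat" P1]
        keys_relabel[of "Inr :: _ \<Rightarrow> 'q + (int, 'd) vec \<times> nat" P2]
      by (auto simp flip: not_in_keys_iff_lookup_eq_zero)
    show "lookup (relabel Inl P1 + relabel Inr P2) k = lookup P k"
      by (cases k) (simp_all add: lookup_add l z lP)
  qed
  have "stabilize \<alpha> P = P + relabel Inl (A.lin L P1)"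
    unfolding stabilize_def P1_def[symmetric] P2_def[symmetric] \<alpha>[OF P1] relabel_add
    using arg_cong[OF dec, of "\<lambda>R. R + relabel Inl (A.lin L P1)"] by (simp only: add_ac)
  then have "relabel \<sigma> (stabilize \<alpha> P) = relabel \<sigma> P + B.lin ?L (relabel (\<sigma> \<circ> Inl) P1)"
    by (simp only: relabel_add relabel_relabel relabel_lin[OF L P1, symmetric])
  also have "B.lin ?L (relabel (\<sigma> \<circ> Inl) P1) = B.lin ?L (relabel \<sigma> P)"
  proof -
    have "B.lin ?L (relabel (\<sigma> \<circ> Inr) P2) = 0"
    proof (rule B.lin_zero)
      fix v w assume "(v, w) \<in> set ?L"
      then obtain w' where w: "w = relabel (\<sigma> \<circ> Inl) w'" "w' \<in> paulis Q" using L by auto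
      show "B.lam w (relabel (\<sigma> \<circ> Inr) P2) = 0"
      proof (rule poly_mapping_eqI)
        fix t
        have k1: "keys (B.trp t w) \<subseteq> (\<sigma> \<circ> Inl) ` Q"
        proof -
          have "keys (A.trp t w') \<subseteq> Q" using A.trp_Q[OF w(2), of t] by (simp add: paulis_def)
          then show ?thesis
            unfolding w(1) relabel_trp[symmetric]
            by (rule order_trans[OF keys_relabel image_mono])
        qed
        have k2: "keys (relabel (\<sigma> \<circ> Inr) P2) \<subseteq> (\<sigma> \<circ> Inr) ` {x. Inr x \<in> stab_qubits Q m}"
        proof (rule order_trans[OF keys_relabel image_mono], rule subsetI, rule CollectI)
          fix x assume "x \<in> keys P2"
          then have "Inr x \<in> keys P" by (simp add: in_keys_iff lP)
          then show "Inr x \<in> stab_qubits Q m" by (rule subsetD[OF kP])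
        qed
        have "(\<sigma> \<circ> Inl) ` Q \<inter> (\<sigma> \<circ> Inr) ` {x. Inr x \<in> stab_qubits Q m} = {}"
        proof (rule ccontr)
          assume "(\<sigma> \<circ> Inl) ` Q \<inter> (\<sigma> \<circ> Inr) ` {x. Inr x \<in> stab_qubits Q m} \<noteq> {}"
          then obtain q x where qx: "q \<in> Q" "Inr x \<in> stab_qubits Q m" "\<sigma> (Inl q) = \<sigma> (Inr x)" by auto
          have "Inl q = Inr x"
            by (rule inj_onD[OF sigma_inj qx(3)]) (use qx in \<open>auto simp: stab_qubits_def\<close>)
          then show False by simp
        qed
        with k1 k2 have "keys (B.trp t w) \<inter> keys (relabel (\<sigma> \<circ> Inr) P2) = {}" by blast
        then show "lookup (B.lam w (relabel (\<sigma> \<circ> Inr) P2)) t = lookup 0 t"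
          by (simp add: B.lookup_lam comm_form_disjoint)
      qed
    qed
    moreover have "relabel \<sigma> P = relabel (\<sigma> \<circ> Inl) P1 + relabel (\<sigma> \<circ> Inr) P2"
      using arg_cong[OF dec, of "relabel \<sigma>"] by (simp only: relabel_add relabel_relabel)
    ultimately show ?thesis by (simp only: B.lin_add add_0_right)
  qed
  finally show ?thesis .
qed

section \<open>Cup products in three dimensions\<close>

abbreviation ev :: "'d::finite \<Rightarrow> (int, 'd) vec" where "ev i \<equiv> e_sum {i}"

lemma cell_prod_cong:
  "(\<And>c. card (snd c) = n \<Longrightarrow> k c = k' c) \<Longrightarrow> cell_prod n F k = cell_prod n F k'"
  unfolding cell_prod_def by (rule sum.cong) auto

lemma ind_eq: "ind c c' = of_bool (c' = c)"
  by (simp add: ind_def)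

lemma cell_prod_list:
  assumes "\<And>c. c \<in> set L \<Longrightarrow> card (snd c) = n"
  shows "cell_prod n F (\<lambda>c. \<Sum>c'\<leftarrow>L. ind c' c) = (\<Sum>c\<leftarrow>L. F c)"
  using assms
proof (induction L)
  case Nil
  then show ?case by (simp add: cell_prod_def)
next
  case (Cons c L)
  let ?k = "\<lambda>c. \<Sum>c'\<leftarrow>L. ind c' c"
  have fin: "finite {c. card (snd c) = n \<and> ?k c = 1}"
  proof (rule finite_subset)
    show "{c. card (snd c) = n \<and> ?k c = 1} \<subseteq> set L"
    proof (rule subsetI, rule ccontr)
      fix d assume "d \<in> {c. card (snd c) = n \<and> ?k c = 1}" "d \<notin> set L"
      moreover have "?k d = 0" if "d \<notin> set L" for d
        using that by (induction L) (auto simp: ind_eq)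
      ultimately show False by simp
    qed
  qed simp
  have S: "{d. card (snd d) = n \<and> ind c d + ?k d = 1} =
      (if ?k c = 1 then {d. card (snd d) = n \<and> ?k d = 1} - {c}
       else insert c {d. card (snd d) = n \<and> ?k d = 1})"
    using Cons.prems[of c] by (cases "?k c") (auto simp: ind_eq)
  have "cell_prod n F (\<lambda>d. ind c d + ?k d) = F c + cell_prod n F ?k"
  proof (cases "?k c = 1")
    case True
    have "cell_prod n F ?k = F c + (\<Sum>d\<in>{d. card (snd d) = n \<and> ?k d = 1} - {c}. F d)"
      unfolding cell_prod_def by (rule sum.remove[OF fin]) (use True Cons.prems[of c] in simp)
    then show ?thesis
      unfolding cell_prod_def[of n F "\<lambda>d. ind c d + ?k d"] S
      by (simp add: True add.assoc[symmetric] pauli_double)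
  next
    case False
    then show ?thesis
      unfolding cell_prod_def S by (simp add: fin)
  qed
  then show ?case using Cons by simp
qed

text \<open>
  Sums of indicator cochains give the exponents in all products over cells. A repeated cell cancels
  on both sides.
\<close>

lemma cell_prod_of_list:
  assumes "\<And>c. card (snd c) = n \<Longrightarrow> k c = (\<Sum>c'\<leftarrow>L. ind c' c)" "\<And>c. c \<in> set L \<Longrightarrow> card (snd c) = n"
  shows "cell_prod n F k = (\<Sum>c\<leftarrow>L. F c)"
proof -
  have "cell_prod n F k = cell_prod n F (\<lambda>c. \<Sum>c'\<leftarrow>L. ind c' c)"
    by (rule cell_prod_cong) (rule assms(1))
  also have "\<dots> = (\<Sum>c\<leftarrow>L. F c)"
    by (rule cell_prod_list) (rule assms(2))
  finally show ?thesis .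
qed

lemma coboundary_ind: "coboundary (ind e) c = lookup (cell_boundary c) e"
proof -
  have "coboundary (ind e) c = (\<Sum>c'\<in>keys (cell_boundary c). if c' = e then lookup (cell_boundary c) e else 0)"
    unfolding coboundary_def by (rule sum.cong) (auto simp: ind_eq)
  then show ?thesis by (simp add: in_keys_iff)
qed

lemma lookup_cell_boundary:
  "lookup (cell_boundary (w, J)) e = (\<Sum>i\<in>J. ind (w, J - {i}) e + ind (w + ev i, J - {i}) e)"
  by (simp add: cell_boundary_def lookup_sum lookup_add lookup_single ind_eq when_def of_bool_def eq_commute)

text \<open>
  \<open>Sum_any\<close> is additive only for finitely supported functions.
\<close>

definition fsupp :: "('a \<Rightarrow> bit) \<Rightarrow> bool" where "fsupp f \<longleftrightarrow> finite {v. f v \<noteq> 0}"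

lemma lattice_integral_add:
  "fsupp f \<Longrightarrow> fsupp g \<Longrightarrow> lattice_integral (\<lambda>v. f v + g v) = lattice_integral f + lattice_integral g"
  unfolding lattice_integral_def fsupp_def by (rule Sum_any.distrib)

lemma fsupp_add: "fsupp f \<Longrightarrow> fsupp g \<Longrightarrow> fsupp (\<lambda>v. f v + g v)"
  unfolding fsupp_def
  by (rule finite_subset[of _ "{v. f v \<noteq> 0} \<union> {v. g v \<noteq> 0}"]) auto

lemma fsupp_term: "fsupp (\<lambda>v. ind c (v + s, G) * b v)"
  unfolding fsupp_def by (rule finite_subset[of _ "{fst c - s}"]) (auto simp: ind_eq)

lemmas fsupp_terms = fsupp_term fsupp_term[where s = 0, simplified]

lemma lattice_integral_term:
  "lattice_integral (\<lambda>v. ind c (v + s, G) * ind c' (v + s', G')) =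
    (if snd c = G then ind (fst c - s + s', G') c' else 0)"
proof -
  have "lattice_integral (\<lambda>v. ind c (v + s, G) * ind c' (v + s', G')) =
      Sum_any (\<lambda>v. (if snd c = G then ind (fst c - s + s', G') c' else 0) when v = fst c - s)"
    unfolding lattice_integral_def
  proof (rule Sum_any.cong)
    fix v
    show "ind c (v + s, G) * ind c' (v + s', G') =
        ((if snd c = G then ind (fst c - s + s', G') c' else 0) when v = fst c - s)"
    proof (cases "v = fst c - s")
      case True
      then have "v + s = fst c" by simp
      then show ?thesis
        by (cases c; cases c') (auto simp: ind_eq True)
    next
      case False
      then have "v + s \<noteq> fst c" by (metis add_diff_cancel_right')
      then show ?thesis using False by (cases c) (auto simp: ind_eq)
    qed
  qed
  then show ?thesis by simp
qed

lemma UNIV_minus_3: "UNIV - {0::3} = {1, 2}" "UNIV - {1::3} = {0, 2}" "UNIV - {2::3} = {0, 1}"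
  unfolding directions_3(1) by (auto simp: dirs3)

lemma Compl_3: "- {0::3} = {1, 2}" "- {1::3} = {0, 2}" "- {2::3} = {0, 1}"
  "- {1, 2::3} = {0}" "- {0, 2::3} = {1}" "- {0, 1::3} = {2}"
  using UNIV_minus_3 dirs3 by (auto simp: Compl_eq_Diff_UNIV)

lemma splittings:
  assumes "i \<noteq> j"
  shows "{(I, J). I \<union> J = {i, j} \<and> I \<inter> J = {} \<and> card I = 2 - 1} = {({i}, {j}), ({j}, {i})}"
proof (intro equalityI subsetI)
  fix p assume "p \<in> {(I, J). I \<union> J = {i, j} \<and> I \<inter> J = {} \<and> card I = 2 - 1}"
  then obtain I J where p: "p = (I, J)" and IJ: "I \<union> J = {i, j}" "I \<inter> J = {}" "card I = 1" by auto
  obtain k where k: "I = {k}" using IJ(3) by (rule card_1_singletonE)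
  have "J = {i, j} - {k}" using IJ(2) unfolding IJ(1)[symmetric] k by auto
  moreover have "k \<in> {i, j}" unfolding IJ(1)[symmetric] k by simp
  ultimately show "p \<in> {({i}, {j}), ({j}, {i})}" using assms p k by auto
next
  fix p assume "p \<in> {({i}, {j}), ({j}, {i})}"
  then show "p \<in> {(I, J). I \<union> J = {i, j} \<and> I \<inter> J = {} \<and> card I = 2 - 1}"
    using assms by auto
qed

lemma sum_UNIV_3: "sum f (UNIV :: 3 set) = f 0 + f 1 + (f 2 :: 'b::comm_monoid_add)"
  unfolding directions_3(1) by (simp add: dirs3 add.assoc)

lemma filter_single: "{j. j = k \<and> P j} = (if P k then {k} else {})"
  by auto

lemma e_sum_empty: "e_sum {} = 0"
  by (simp add: e_sum_def vec_eq_iff)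

lemma cup1_3:
  fixes a b :: "3 cell \<Rightarrow> bit"
  shows "cup1 2 a b v =
    a (v + ev 2, {0, 1}) * b (v, {0, 2}) + a (v + ev 1, {0, 2}) * b (v, {0, 1})
  + a (v + ev 2, {0, 1}) * b (v + ev 0, {1, 2}) + a (v, {1, 2}) * b (v, {0, 1})
  + a (v, {0, 2}) * b (v + ev 0, {1, 2}) + a (v, {1, 2}) * b (v + ev 1, {0, 2})"
proof -
  have o: "(0::3) < 1" "(0::3) < 2" "(1::3) < 2" "\<not> (1::3) < 0" "\<not> (2::3) < 0" "\<not> (2::3) < 1"
    using directions_3(2,3) by auto
  show ?thesis
    unfolding cup1_def sum_UNIV_3 UNIV_minus_3 splittings[OF dirs3(1)] splittings[OF dirs3(3)] splittings[OF dirs3(5)]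
    by (simp add: dirs3 filter_single o e_sum_empty insert_commute add_ac)
qed

lemmas lattice_integral_terms = lattice_integral_term lattice_integral_term[where s = 0, simplified]
  lattice_integral_term[where s' = 0, simplified] lattice_integral_term[where s = 0 and s' = 0, simplified]

lemma faces_3: "card (I :: 3 set) = 2 \<longleftrightarrow> I = {1, 2} \<or> I = {0, 2} \<or> I = {0, 1}"
proof
  assume "card I = 2"
  have "card (UNIV - I) = CARD(3) - card I" by (rule card_Diff_subset) auto
  with \<open>card I = 2\<close> have "card (- I) = 1" by (simp add: Compl_eq_Diff_UNIV)
  then obtain k where "- I = {k}" by (rule card_1_singletonE)
  then have "I = - {k}" by blast
  moreover have "k \<in> {0, 1, 2}" using directions_3(1) by blast
  ultimately show "I = {1, 2} \<or> I = {0, 2} \<or> I = {0, 1}" using Compl_3 by auto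
qed (auto simp: dirs3)

lemma edges_3: "card (I :: 3 set) = 1 \<longleftrightarrow> I = {0} \<or> I = {1} \<or> I = {2}"
proof
  assume "card I = 1"
  then obtain k where "I = {k}" by (rule card_1_singletonE)
  moreover have "k \<in> {0, 1, 2}" using directions_3(1) by blast
  ultimately show "I = {0} \<or> I = {1} \<or> I = {2}" by auto
qed auto

lemma sets_3: "{0::3} \<noteq> {1}" "{1::3} \<noteq> {2}" "{0::3} \<noteq> {2}" "{1::3} \<noteq> {0}" "{2::3} \<noteq> {1}" "{2::3} \<noteq> {0}"
  "{1,2::3} \<noteq> {0,2}" "{1,2::3} \<noteq> {0,1}" "{0,2::3} \<noteq> {0,1}" "{0,2::3} \<noteq> {1,2}" "{0,1::3} \<noteq> {1,2}" "{0,1::3} \<noteq> {0,2}"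
  using dirs3 by (auto simp: doubleton_eq_iff)

lemma cup_3:
  fixes a b :: "3 cell \<Rightarrow> bit"
  shows "cup 2 a b v = a (v, {1, 2}) * b (v + e_sum {1, 2}, {0})
      + a (v, {0, 2}) * b (v + e_sum {0, 2}, {1}) + a (v, {0, 1}) * b (v + e_sum {0, 1}, {2})"
    and "cup 1 a b v = a (v, {0}) * b (v + ev 0, {1, 2})
      + a (v, {1}) * b (v + ev 1, {0, 2}) + a (v, {2}) * b (v + ev 2, {0, 1})"
proof -
  have f: "{I :: 3 set. card I = 2} = {{1, 2}, {0, 2}, {0, 1}}" using faces_3 by auto
  have e: "{I :: 3 set. card I = 1} = {{0}, {1}, {2}}" using edges_3 by auto
  show "cup 2 a b v = a (v, {1, 2}) * b (v + e_sum {1, 2}, {0})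
      + a (v, {0, 2}) * b (v + e_sum {0, 2}, {1}) + a (v, {0, 1}) * b (v + e_sum {0, 1}, {2})"
    unfolding cup_def f by (simp add: sets_3 Compl_3 add_ac)
  show "cup 1 a b v = a (v, {0}) * b (v + ev 0, {1, 2})
      + a (v, {1}) * b (v + ev 1, {0, 2}) + a (v, {2}) * b (v + ev 2, {0, 1})"
    unfolding cup_def e by (simp add: sets_3 Compl_3 add_ac)
qed

lemma cup1_int: "lattice_integral (cup1 2 (ind c) (ind c')) =
   (if snd c = {0, 1} then ind (fst c - ev 2, {0, 2}) c' else 0)
 + (if snd c = {0, 2} then ind (fst c - ev 1, {0, 1}) c' else 0)
 + (if snd c = {0, 1} then ind (fst c - ev 2 + ev 0, {1, 2}) c' else 0)
 + (if snd c = {1, 2} then ind (fst c, {0, 1}) c' else 0)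
 + (if snd c = {0, 2} then ind (fst c + ev 0, {1, 2}) c' else 0)
 + (if snd c = {1, 2} then ind (fst c + ev 1, {0, 2}) c' else (0::bit))" for c :: "3 cell"
proof -
  have *: "cup1 2 (ind c) (ind c') = (\<lambda>v. cup1 2 (ind c) (ind c') v)" ..
  show ?thesis
    by (subst *, unfold cup1_3)
      (simp only: lattice_integral_add fsupp_add fsupp_terms lattice_integral_terms diff_zero add_0_right)
qed

lemma fsupp_cup1: "fsupp (cup1 2 (ind c) b)" for c :: "3 cell"
proof -
  have "cup1 2 (ind c) b = (\<lambda>v. cup1 2 (ind c) b v)" ..
  then show ?thesis
    unfolding cup1_3 by (simp only: fsupp_add fsupp_terms)
qed

lemma cup1_add: "cup1 2 (\<lambda>c. a c + a' c) b = (\<lambda>v. cup1 2 a b v + cup1 2 a' b v)" for a :: "3 cell \<Rightarrow> bit"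
  by (rule ext) (simp only: cup1_3 distrib_right add_ac)

lemma cup1_int_list: "fsupp (cup1 2 (\<lambda>c. \<Sum>c0\<leftarrow>L. ind c0 c) b) \<and>
  lattice_integral (cup1 2 (\<lambda>c. \<Sum>c0\<leftarrow>L. ind c0 c) b) = (\<Sum>c0\<leftarrow>L. lattice_integral (cup1 2 (ind c0) b))"
  for b :: "3 cell \<Rightarrow> bit"
proof (induction L)
  case Nil
  have "cup1 2 (\<lambda>c. 0) b = (\<lambda>v. 0)" by (rule ext) (simp add: cup1_3)
  then show ?case by (simp add: fsupp_def lattice_integral_def)
next
  case (Cons c0 L)
  then show ?case by (simp add: cup1_add lattice_integral_add fsupp_add fsupp_cup1)
qed

lemma cup_int: "lattice_integral (cup 2 (ind c) (ind c')) =
   (if snd c = {1, 2} then ind (fst c + e_sum {1, 2}, {0}) c' else 0)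
 + (if snd c = {0, 2} then ind (fst c + e_sum {0, 2}, {1}) c' else 0)
 + (if snd c = {0, 1} then ind (fst c + e_sum {0, 1}, {2}) c' else 0)"
  "lattice_integral (cup 1 (ind c) (ind c')) =
   (if snd c = {0} then ind (fst c + ev 0, {1, 2}) c' else 0)
 + (if snd c = {1} then ind (fst c + ev 1, {0, 2}) c' else 0)
 + (if snd c = {2} then ind (fst c + ev 2, {0, 1}) c' else 0)" for c :: "3 cell"
proof -
  have *: "cup p (ind c) (ind c') = (\<lambda>v. cup p (ind c) (ind c') v)" for p ..
  show "lattice_integral (cup 2 (ind c) (ind c')) =
   (if snd c = {1, 2} then ind (fst c + e_sum {1, 2}, {0}) c' else 0)
 + (if snd c = {0, 2} then ind (fst c + e_sum {0, 2}, {1}) c' else 0)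
 + (if snd c = {0, 1} then ind (fst c + e_sum {0, 1}, {2}) c' else 0)"
    by (subst *, unfold cup_3) (simp only: lattice_integral_add fsupp_add fsupp_terms lattice_integral_terms
        diff_zero add_0_right)
  show "lattice_integral (cup 1 (ind c) (ind c')) =
   (if snd c = {0} then ind (fst c + ev 0, {1, 2}) c' else 0)
 + (if snd c = {1} then ind (fst c + ev 1, {0, 2}) c' else 0)
 + (if snd c = {2} then ind (fst c + ev 2, {0, 1}) c' else 0)"
    by (subst *, unfold cup_3) (simp only: lattice_integral_add fsupp_add fsupp_terms lattice_integral_terms
        diff_zero add_0_right)
qed

definition cobdry3 :: "(int, 3) vec \<Rightarrow> 3 \<Rightarrow> 3 cell list" where
  "cobdry3 v i = (if i = 0 then [(v, {0, 2}), (v - ev 2, {0, 2}), (v, {0, 1}), (v - ev 1, {0, 1})]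
    else if i = 1 then [(v, {1, 2}), (v - ev 2, {1, 2}), (v, {0, 1}), (v - ev 0, {0, 1})]
    else [(v, {1, 2}), (v - ev 1, {1, 2}), (v, {0, 2}), (v - ev 0, {0, 2})])"

lemma dirs_3_cases: "(i::3) = 0 \<or> i = 1 \<or> i = 2"
  using directions_3(1) by blast

lemma coboundary_edge:
  assumes "card (snd c) = 2"
  shows "coboundary (ind (v, {i})) c = (\<Sum>c0\<leftarrow>cobdry3 v i. ind c0 c)"
proof -
  obtain w J where c: "c = (w, J)" by (cases c)
  have s: "{1,2} - {1::3} = {2}" "{1,2} - {2::3} = {1}" "{0,2} - {0::3} = {2}" "{0,2} - {2::3} = {0}"
    "{0,1} - {0::3} = {1}" "{0,1} - {1::3} = {0}" using dirs3 by auto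
  have w: "v = w + ev k \<longleftrightarrow> w = v - ev k" for k by (auto simp: algebra_simps)
  have J: "J = {1, 2} \<or> J = {0, 2} \<or> J = {0, 1}" using assms c faces_3 by simp
  show ?thesis
    using dirs_3_cases[of i] J
    by (elim disjE; simp add: c coboundary_ind lookup_cell_boundary cobdry3_def ind_eq dirs3 sets_3 s w
        eq_commute[of v w]; simp add: add_ac)
qed

lemma cup1_cong:
  fixes a :: "3 cell \<Rightarrow> bit"
  assumes "\<And>c. card (snd c) = 2 \<Longrightarrow> a c = a' c"
  shows "cup1 2 a b = cup1 2 a' b"
proof (rule ext)
  have "a (v, {1, 2}) = a' (v, {1, 2})" "a (v, {0, 2}) = a' (v, {0, 2})" "a (v, {0, 1}) = a' (v, {0, 1})" for v
    by (rule assms; simp add: dirs3)+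
  then show "cup1 2 a b v = cup1 2 a' b v" for v by (simp only: cup1_3)
qed

text \<open>
  The cells \<open>f\<close> for which the integral of \<open>c \<cup>\<^sub>1 f\<close> is nonzero, and likewise \<open>cup1_left\<close> for the integral of
  \<open>f \<cup>\<^sub>1 c\<close>.
\<close>

definition cup1_right :: "3 cell \<Rightarrow> 3 cell list" where
  "cup1_right c = (case c of (w, F) \<Rightarrow>
     if F = {1, 2} then [(w, {0, 1}), (w + ev 1, {0, 2})]
     else if F = {0, 2} then [(w - ev 1, {0, 1}), (w + ev 0, {1, 2})]
     else [(w - ev 2, {0, 2}), (w - ev 2 + ev 0, {1, 2})])"

definition cup1_left :: "3 cell \<Rightarrow> 3 cell list" where
  "cup1_left c = (case c of (w, F) \<Rightarrow>
     if F = {1, 2} then [(w - ev 0 + ev 2, {0, 1}), (w - ev 0, {0, 2})]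
     else if F = {0, 2} then [(w + ev 2, {0, 1}), (w - ev 1, {1, 2})]
     else [(w + ev 1, {0, 2}), (w, {1, 2})])"

lemma cup1_int_right:
  assumes "card (snd c) = 2"
  shows "lattice_integral (cup1 2 (ind c) (ind c')) = (\<Sum>f\<leftarrow>cup1_right c. ind f c')"
proof -
  obtain w F where c: "c = (w, F)" by (cases c)
  have "F = {1, 2} \<or> F = {0, 2} \<or> F = {0, 1}" using assms c faces_3 by simp
  then show ?thesis
    by (elim disjE; simp add: c cup1_int cup1_right_def sets_3 add_ac)
qed

lemma ind_other: "F \<noteq> F' \<Longrightarrow> ind (w, F) (w', F') = 0"
  by (auto simp: ind_eq)

lemma cup1_int_left:
  assumes "card (snd c) = 2" "card (snd c') = 2"
  shows "lattice_integral (cup1 2 (ind c') (ind c)) = (\<Sum>f\<leftarrow>cup1_left c. ind f c')"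
proof -
  obtain w F where c: "c = (w, F)" by (cases c)
  obtain w' F' where c': "c' = (w', F')" by (cases c')
  have F: "F = {1, 2} \<or> F = {0, 2} \<or> F = {0, 1}" "F' = {1, 2} \<or> F' = {0, 2} \<or> F' = {0, 1}"
    using assms c c' faces_3 by simp_all
  have i: "ind (w' - ev 2 + ev 0, G) (w, G) = ind (w - ev 0 + ev 2, H) (w', H)"
    "ind (w' + t, G) (w, G) = ind (w - t, H) (w', H)" "ind (w' - t, G) (w, G) = ind (w + t, H) (w', H)"
    "ind (w', G) (w, G) = ind (w, H) (w', H)" for G H t
    by (auto simp: ind_eq algebra_simps)
  show ?thesis
    using F
    by (elim disjE; simp add: c c' cup1_int cup1_left_def sets_3 ind_other i)
qed

lemma sum_list_concat_map:
  "(\<Sum>c\<leftarrow>L. \<Sum>d\<leftarrow>M c. f d) = (\<Sum>d\<leftarrow>concat (map M L). f d)"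
  by (induction L) auto

lemma card_cobdry3: "c \<in> set (cobdry3 v i) \<Longrightarrow> card (snd c) = 2"
  by (auto simp: cobdry3_def dirs3 split: if_splits)

lemma card_cup1_right: "f \<in> set (cup1_right c) \<Longrightarrow> card (snd f) = 2"
  by (cases c) (auto simp: cup1_right_def dirs3 split: if_splits)

lemma card_cup1_left: "f \<in> set (cup1_left c) \<Longrightarrow> card (snd f) = 2"
  by (cases c) (auto simp: cup1_left_def dirs3 split: if_splits)

text \<open>
  By bilinearity of the cup product the edge operator is the product over the faces in the coboundary
  of the edge of one operator per face.
\<close>

definition flux :: "species \<Rightarrow> 3 cell \<Rightarrow> 3 cell_qubit pauli" where
  "flux s c = PX (c, s) + (\<Sum>f\<leftarrow>cup1_right c. PZ (f, s))"

lemma tqft_G_flux: "tqft_G s (v, {i}) = (\<Sum>c\<leftarrow>cobdry3 v i. flux s c)"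
proof -
  let ?L = "cobdry3 v i"
  have 1: "cell_prod 2 (\<lambda>f. PX (f, s)) (coboundary (ind (v, {i}))) = (\<Sum>c\<leftarrow>?L. PX (c, s))"
    by (rule cell_prod_of_list[OF coboundary_edge card_cobdry3])
  have "lattice_integral (cup1 2 (coboundary (ind (v, {i}))) (ind f')) =
      (\<Sum>c\<leftarrow>?L. lattice_integral (cup1 2 (ind c) (ind f')))" for f'
  proof -
    have "cup1 2 (coboundary (ind (v, {i}))) (ind f') = cup1 2 (\<lambda>c. \<Sum>c0\<leftarrow>?L. ind c0 c) (ind f')"
      by (rule cup1_cong) (rule coboundary_edge)
    then show ?thesis using cup1_int_list[of ?L "ind f'"] by (simp only:)
  qed
  also have "(\<Sum>c\<leftarrow>?L. lattice_integral (cup1 2 (ind c) (ind f'))) = (\<Sum>c\<leftarrow>?L. \<Sum>f\<leftarrow>cup1_right c. ind f f')" for f'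
    by (rule arg_cong[where f = sum_list], rule map_cong) (auto intro: cup1_int_right card_cobdry3)
  finally have 2: "cell_prod 2 (\<lambda>f'. PZ (f', s)) (\<lambda>f'. lattice_integral (cup1 2 (coboundary (ind (v, {i}))) (ind f')))
      = (\<Sum>c\<leftarrow>?L. \<Sum>f\<leftarrow>cup1_right c. PZ (f, s))"
    unfolding sum_list_concat_map
    by (simp only:) (rule cell_prod_list, auto intro: card_cup1_right)
  show ?thesis
    unfolding tqft_G_def 1 2 flux_def by (simp add: sum_list_addf)
qed

lemma tqft_Zbar_A: "tqft_Zbar ((v, {1, 2}), Sp_A) = PZ ((v, {1, 2}), Sp_A) + tqft_G Sp_B (v + e_sum {1, 2}, {0})"
  "tqft_Zbar ((v, {0, 2}), Sp_A) = PZ ((v, {0, 2}), Sp_A) + tqft_G Sp_B (v + e_sum {0, 2}, {1})"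
  "tqft_Zbar ((v, {0, 1}), Sp_A) = PZ ((v, {0, 1}), Sp_A) + tqft_G Sp_B (v + e_sum {0, 1}, {2})"
  using cell_prod_list[of "[(v + e_sum {1, 2}, {0})]" 1 "tqft_G Sp_B"]
    cell_prod_list[of "[(v + e_sum {0, 2}, {1})]" 1 "tqft_G Sp_B"]
    cell_prod_list[of "[(v + e_sum {0, 1}, {2})]" 1 "tqft_G Sp_B"]
  by (simp_all add: tqft_Zbar_def cup_int sets_3)

lemma tqft_Zbar_B: "tqft_Zbar ((v, {1, 2}), Sp_B) = PZ ((v, {1, 2}), Sp_B) + tqft_G Sp_A (v - ev 0, {0})"
  "tqft_Zbar ((v, {0, 2}), Sp_B) = PZ ((v, {0, 2}), Sp_B) + tqft_G Sp_A (v - ev 1, {1})"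
  "tqft_Zbar ((v, {0, 1}), Sp_B) = PZ ((v, {0, 1}), Sp_B) + tqft_G Sp_A (v - ev 2, {2})"
proof -
  have k: "lattice_integral (cup 1 (ind c) (ind (v, F))) = (\<Sum>d\<leftarrow>[(v - ev i, {i})]. ind d c)"
    if "card (snd c) = 1" "(F, i) \<in> {({1, 2}, 0), ({0, 2}, 1), ({0, 1}, 2)}" for c F i
  proof -
    obtain w J where c: "c = (w, J)" by (cases c)
    have "J = {0} \<or> J = {1} \<or> J = {2}" using that(1) c edges_3 by simp
    then show ?thesis
      using that(2) by (elim disjE insertE emptyE; simp add: c cup_int(2)[unfolded One_nat_def] sets_3 ind_other; auto simp: ind_eq)
  qed
  have "cell_prod 1 (tqft_G Sp_A) (\<lambda>e. lattice_integral (cup 1 (ind e) (ind (v, F)))) = tqft_G Sp_A (v - ev i, {i})"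
    if "(F, i) \<in> {({1, 2}, 0), ({0, 2}, 1), ({0, 1}, 2)}" for F i
    by (subst cell_prod_of_list[OF k[OF _ that]]) simp_all
  from this[of "{1,2}" 0] this[of "{0,2}" 1] this[of "{0,1}" 2]
  show "tqft_Zbar ((v, {1, 2}), Sp_B) = PZ ((v, {1, 2}), Sp_B) + tqft_G Sp_A (v - ev 0, {0})"
    "tqft_Zbar ((v, {0, 2}), Sp_B) = PZ ((v, {0, 2}), Sp_B) + tqft_G Sp_A (v - ev 1, {1})"
    "tqft_Zbar ((v, {0, 1}), Sp_B) = PZ ((v, {0, 1}), Sp_B) + tqft_G Sp_A (v - ev 2, {2})"
    by (simp_all add: tqft_Zbar_def)
qed

lemma tqft_Xbar_eq:
  assumes "card (snd f) = 2"
  shows "tqft_Xbar (f, s) = PX (f, s) + (\<Sum>f'\<leftarrow>cup1_left f. PZ (f', s) + tqft_Zbar (f', s))"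
proof -
  have "cell_prod 2 (\<lambda>f'. PZ (f', s) + tqft_Zbar (f', s)) (\<lambda>f'. lattice_integral (cup1 2 (ind f') (ind f))) =
      (\<Sum>f'\<leftarrow>cup1_left f. PZ (f', s) + tqft_Zbar (f', s))"
    by (rule cell_prod_of_list[OF cup1_int_left[OF assms] card_cup1_left])
  then show ?thesis by (simp add: tqft_Xbar_def)
qed

section \<open>The TQFT automorphism\<close>

locale qubit_system_3 = qubit_system pos tr Q
  for pos :: "'q \<Rightarrow> (int, 3) vec" and tr Q

sublocale qubit_system_3 \<subseteq> laurent_module scale conj lam
  "mon (ev 0)" "mon (- ev 0)" "mon (ev 1)" "mon (- ev 1)" "mon (ev 2)" "mon (- ev 2)"
  by unfold_locales (simp_all add: mon_mult conj_mon mon_0)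

lemma hom_ext_add:
  fixes x z :: "'q \<Rightarrow> 'r pauli"
  shows "hom_ext x z (P + R) = hom_ext x z P + hom_ext x z R"
  unfolding hom_ext_def
proof (rule setsum_keys_plus_distrib)
  fix k show "(if fst (lookup P k + lookup R k) = 1 then x k else 0) +
         (if snd (lookup P k + lookup R k) = 1 then z k else 0) =
         (if fst (lookup P k) = 1 then x k else 0) + (if snd (lookup P k) = 1 then z k else 0) +
         ((if fst (lookup R k) = 1 then x k else 0) + (if snd (lookup R k) = 1 then z k else 0))"
  proof -
    have h: "(if a + b = 1 then p else 0) = (if a = 1 then p else 0) + (if b = 1 then p else 0)"
      for a b :: bit and p :: "'r pauli"
      by (cases a; cases b) (simp_all add: pauli_double)
    show ?thesis by (simp only: fst_add snd_add h add_ac)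
  qed
qed simp

lemma hom_ext_PX: "hom_ext x z (PX q) = x q" and hom_ext_PZ: "hom_ext x z (PZ q) = z q"
  by (simp_all add: hom_ext_def PX_def PZ_def zero_prod_def)

lemma (in face_frame) T_scale: "T (a \<odot> p) = a \<odot> T p"
  by (simp only: T_lin lin_scale scale_right_distrib)

lemma (in face_frame) T_add: "T (p + r) = T p + T r"
  by (simp only: T_lin lin_add add_ac)

context qubit_system_3
begin

lemma cross_Q: "(\<And>i. i \<in> I \<Longrightarrow> v i \<in> paulis Q) \<Longrightarrow> cross N I v w p \<in> paulis Q"
  unfolding cross_def by (intro paulis_sum scale_Q)

text \<open>
  The bound \<open>n\<close> admits both the six-dimensional frames and the four-dimensional frame of a layer.
\<close>

lemma pump_automorphism:
  assumes v: "\<And>i k. i \<in> {..<n} \<Longrightarrow> k \<in> {..<n} \<Longrightarrow> (\<Sum>j\<in>{..<n}. theta_inv i j * lam (v j) (v k)) = of_bool (i = k)"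
    and n: "n \<le> 6" and vQ: "\<And>i. i \<in> {..<n} \<Longrightarrow> v i \<in> paulis Q"
  shows "pauli_automorphism Q (\<lambda>p. p + (1 + mon t) \<odot> cross theta_inv {..<n} v v p)"
proof -
  have t: "mon t * conj (mon t) = 1" by (simp add: conj_mon mon_mult mon_0)
  have N: "conj (theta_inv i j) = theta_inv j i" if "i \<in> {..<n}" "j \<in> {..<n}" for i j
    by (rule cnj_theta_inv) (use that n in auto)
  note iso = pump_isometry[OF finite_lessThan t v N]
  show ?thesis
  proof (rule pauli_automorphismI[where \<beta> = "\<lambda>p. p + (1 + conj (mon t)) \<odot> cross theta_inv {..<n} v v p"])
    fix P R :: "'q pauli" assume P: "P \<in> paulis Q" and "R \<in> paulis Q"
    show "P + (1 + mon t) \<odot> cross theta_inv {..<n} v v P \<in> paulis Q"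
      by (intro paulis_add scale_Q cross_Q P vQ)
    show "P + (1 + conj (mon t)) \<odot> cross theta_inv {..<n} v v P \<in> paulis Q"
      by (intro paulis_add scale_Q cross_Q P vQ)
    show "(P + R) + (1 + mon t) \<odot> cross theta_inv {..<n} v v (P + R) =
        (P + (1 + mon t) \<odot> cross theta_inv {..<n} v v P) + (R + (1 + mon t) \<odot> cross theta_inv {..<n} v v R)"
      by (simp only: cross_add scale_right_distrib add_ac)
  qed (simp_all only: comm_form_lookup_lam iso)
qed

end

locale face_system = qubit_system_3 pos tr Q
  for pos :: "'q \<Rightarrow> (int, 3) vec" and tr Q +
  fixes face_q :: "species \<Rightarrow> 3 \<Rightarrow> 'q"
  assumes face_q_Q: "face_q s i \<in> Q" and face_q_pos: "pos (face_q s i) = 0"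
    and face_q_inj: "face_q s i = face_q t k \<longleftrightarrow> s = t \<and> i = k"
begin

sublocale face_frame scale conj lam
  "mon (ev 0)" "mon (- ev 0)" "mon (ev 1)" "mon (- ev 1)" "mon (ev 2)" "mon (- ev 2)"
  "\<lambda>s i. PX (face_q s i)" "\<lambda>s i. PZ (face_q s i)"
  by unfold_locales (simp_all add: lam_PX_PZ lam_PX_PZ_base face_q_pos face_q_inj)

lemma XZ_Q: "PX (face_q s i) \<in> paulis Q" "PZ (face_q s i) \<in> paulis Q"
  unfolding PX_def PZ_def by (rule paulis_single[OF face_q_Q])+

lemma jk_Q: "j1 s \<in> paulis Q" "j2 s \<in> paulis Q" "k0 s \<in> paulis Q" "k1 s \<in> paulis Q"
  unfolding j1_def j2_def k0_def k1_def by (intro paulis_add scale_Q XZ_Q)+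

lemma n_Q: "nA \<in> paulis Q" "nB \<in> paulis Q"
  unfolding nA_def nB_def by (intro paulis_add scale_Q jk_Q)+

lemma u_Q: "i \<in> {..<6} \<Longrightarrow> u i \<in> paulis Q"
  unfolding less6 u_def nu_def h1_def h2_def
  by (elim insertE emptyE; simp; intro paulis_add scale_Q XZ_Q)

lemma q_Q: "i \<in> {..<6} \<Longrightarrow> q i \<in> paulis Q"
  unfolding q_def AB1_def by (intro paulis_add scale_Q jk_Q n_Q u_Q)

lemma T_terms_Q: "set T_terms \<subseteq> paulis Q \<times> paulis Q"
  unfolding T_terms_def by (simp, intro conjI paulis_add scale_Q jk_Q n_Q)

lemma T_at_1_circuit: "finite_depth_circuit Q pos T_at_1"
proof -
  let ?V = "{nA, nB, k0 Sp_A + k1 Sp_A, k0 Sp_B + k1 Sp_B}"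
  have "finite_depth_circuit Q pos (\<lambda>p. p + sym_map [(nB, k0 Sp_A + k1 Sp_A), (nA, k0 Sp_B + k1 Sp_B)] p)"
  proof (rule sym_map_circuit[where V = ?V])
    show "?V \<subseteq> paulis Q" using n_Q jk_Q by (auto intro: paulis_add)
    show "lam v w = 0" if "v \<in> ?V" "w \<in> ?V" for v w by (rule T_at_1_isotropic[OF that])
  qed auto
  then show ?thesis unfolding T_at_1_sym_map[abs_def] .
qed

text \<open>
  The vectors \<open>q i + t \<odot> a i\<close> have Gram matrix \<open>theta + t * conj t * theta = 0\<close>, so all the rotations commute.
\<close>

lemma swap_rot_circuit:
  assumes a: "\<And>i k. i \<in> {..<6} \<Longrightarrow> k \<in> {..<6} \<Longrightarrow> lam (a i) (a k) = theta i k"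
    and Xa: "\<And>s i k. k \<in> {..<6} \<Longrightarrow> lam (PX (face_q s i)) (a k) = 0"
    and Za: "\<And>s i k. k \<in> {..<6} \<Longrightarrow> lam (PZ (face_q s i)) (a k) = 0"
    and aQ: "\<And>k. k \<in> {..<6} \<Longrightarrow> a k \<in> paulis Q"
    and t: "t * conj t = 1"
  shows "finite_depth_circuit Q pos (swap_rot a t)"
proof -
  let ?w = "\<lambda>i. q i + t \<odot> a i"
  let ?V = "{r \<odot> ?w i | r i. i \<in> {..<6}}"
  have w: "?w i \<in> ?V" if "i \<in> {..<6}" for i
    by (rule CollectI, rule exI[of _ 1], rule exI[of _ i]) (use that in simp)
  have rw: "r \<odot> ?w i \<in> ?V" if "i \<in> {..<6}" for r i using that by blast
  have six: "0 \<in> {..<6::nat}" "1 \<in> {..<6::nat}" "2 \<in> {..<6::nat}" "3 \<in> {..<6::nat}" "4 \<in> {..<6::nat}" "5 \<in> {..<6::nat}"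
    by auto
  have "finite_depth_circuit Q pos (\<lambda>p. p + cross theta_inv {..<6} ?w ?w p)"
    unfolding cross_theta_inv
  proof (rule sym_map_circuit[where V = ?V])
    show "?V \<subseteq> paulis Q" using q_Q aQ by (auto intro!: scale_Q paulis_add)
    show "lam v w = 0" if "v \<in> ?V" "w \<in> ?V" for v w
      using that swap_rot_isotropic[OF a Xa Za t] by (auto simp: lam_scale_left lam_scale_right)
    fix v w assume "(v, w) \<in> set [(mon (ev 0) \<odot> ?w 0, ?w 0),
      (((1 + mon (ev 1)) * (1 + mon (- ev 0))) \<odot> ?w 0, ?w 1), (mon (ev 1) \<odot> ?w 0, ?w 3), (mon (ev 1) \<odot> ?w 1, ?w 1),
      (mon (ev 0) \<odot> ?w 1, ?w 2), (mon (ev 0) \<odot> ?w 2, ?w 2), (((1 + mon (ev 1)) * (1 + mon (- ev 0))) \<odot> ?w 2, ?w 3),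
      (mon (ev 1) \<odot> ?w 3, ?w 3), (?w 4, ?w 5)]"
    then show "v \<in> ?V \<and> w \<in> ?V"
      unfolding list.set by (elim insertE emptyE; simp only: prod.inject; elim conjE; simp only:; intro conjI w rw six)
  qed
  then show ?thesis unfolding swap_rot_def[abs_def] .
qed

lemma shift1_shift: "shift1 i = relabel (orbit_shift (face_q Sp_A i) (- ev 2))"
  by (rule ext) (simp only: shift1_def orbit_shift(2))

lemma lower_A_circuit: "circuit_shift_composition Q pos lower_A"
  unfolding lower_A_shift1 shift1_shift
  by (intro circuit_shift_comp circuit_shift_shift orbit_shift(1))

lemma T_automorphism: "pauli_automorphism Q T"
proof -
  have "pauli_automorphism Q (\<lambda>p. p + (1 + mon (ev 2)) \<odot> projQ p)"
    unfolding projQ_def by (rule pump_automorphism, rule theta_gram_inverse[OF gram_q]) (simp_all add: q_Q del: lessThan_iff)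
  then have "pauli_automorphism Q (lower_A \<circ> ((\<lambda>p. p + (1 + mon (ev 2)) \<odot> projQ p) \<circ> T_at_1))"
    by (intro pauli_automorphism_comp circuit_shift_automorphism[OF lower_A_circuit]
      finite_depth_circuit_automorphism[OF T_at_1_circuit])
  moreover have "T = lower_A \<circ> ((\<lambda>p. p + (1 + mon (ev 2)) \<odot> projQ p) \<circ> T_at_1)"
    by (rule ext) (simp add: T_factor)
  ultimately show ?thesis by simp
qed

end

interpretation tq: qubit_system_3 tqft_pos tqft_translate tqft_qubits
  by unfold_locales (auto simp: tqft_pos_def tqft_translate_def tqft_qubits_def add_ac split: prod.splits)

interpretation tqf: face_system tqft_pos tqft_translate tqft_qubits "\<lambda>s i. ((0, - {i}), s)"
proof
  show "((0, - {i}), s) \<in> tqft_qubits" for s and i :: 3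
  proof -
    consider "i = 0" | "i = 1" | "i = 2" using dirs_3_cases by blast
    then show ?thesis by cases (simp_all add: Compl_3 dirs3 tqft_qubits_def)
  qed
qed (auto simp: tqft_pos_def)

lemma cell_scale:
  "PX ((v, F), s) = tq.scale (mon v) (PX ((0, F), s))" "PZ ((v, F), s) = tq.scale (mon v) (PZ ((0, F), s))"
  by (simp_all add: PX_def PZ_def tq.scale_mon relabel_single tqft_translate_def)

lemma mon_diff: "mon (v - t) = mon v * mon (- t)" "mon (v + t) = mon v * mon t"
  by (simp_all add: mon_mult)

lemma flux_scale:
  "flux s (v, {1, 2}) = tq.scale (mon v) (tqf.j1 s)"
  "flux s (v, {0, 2}) = tq.scale (mon v) (tqf.j2 s)"
  "flux s (v, {0, 1}) = tq.scale (mon v) (tqf.j3 s)"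
  unfolding flux_def cup1_right_def tqf.j1_def tqf.j2_def tqf.j3_def Compl_3
  by (simp_all add: sets_3 cell_scale[of v] cell_scale[of "_ + _"] cell_scale[of "_ - _"] mon_diff tq.scale_right_distrib
    mult_ac add_ac)

lemma tqft_G_scale:
  "tqft_G s (v, {0}) = tq.scale (mon v) (tq.scale (1 + mon (- ev 2)) (tqf.j2 s) + tq.scale (1 + mon (- ev 1)) (tqf.j3 s))"
  "tqft_G s (v, {1}) = tq.scale (mon v) (tq.scale (1 + mon (- ev 2)) (tqf.j1 s) + tq.scale (1 + mon (- ev 0)) (tqf.j3 s))"
  "tqft_G s (v, {2}) = tq.scale (mon v) (tq.scale (1 + mon (- ev 1)) (tqf.j1 s) + tq.scale (1 + mon (- ev 0)) (tqf.j2 s))"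
  unfolding tqft_G_flux cobdry3_def
  by (simp_all add: dirs3 flux_scale mon_diff tq.scale_right_distrib tq.scale_left_distrib add_ac distrib_left)

lemma e_sum_insert: "i \<noteq> j \<Longrightarrow> e_sum {i, j} = ev i + ev j"
  by (auto simp: e_sum_def vec_eq_iff)

lemma Zbar_T: "tqft_Zbar ((v, - {i}), s) = tq.scale (mon v) (tqf.T (PZ ((0, - {i}), s)))"
proof -
  note Z = tqf.T_Z[unfolded Compl_3]
  note simps = tqft_Zbar_A tqft_Zbar_B tqft_G_scale Z e_sum_insert[OF dirs3(1)] e_sum_insert[OF dirs3(3)]
    e_sum_insert[OF dirs3(5)] cell_scale[of v] tq.scale_right_distrib mon_diff tq.scale_scale mult_ac
  have "tqft_Zbar ((v, {1, 2}), s) = tq.scale (mon v) (tqf.T (PZ ((0, {1, 2}), s)))"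
    "tqft_Zbar ((v, {0, 2}), s) = tq.scale (mon v) (tqf.T (PZ ((0, {0, 2}), s)))"
    "tqft_Zbar ((v, {0, 1}), s) = tq.scale (mon v) (tqf.T (PZ ((0, {0, 1}), s)))"
    by (cases s; simp only: simps)+
  note eqs = this[folded Compl_3(1-3)]
  consider "i = 0" | "i = 1" | "i = 2" using dirs_3_cases by blast
  then show ?thesis by cases (simp_all only: eqs)
qed

lemma Xbar_T: "tqft_Xbar ((v, - {i}), s) = tq.scale (mon v) (tqf.T (PX ((0, - {i}), s)))"
proof -
  note X = tqf.T_X[unfolded Compl_3]
  note Zb = Zbar_T[of _ 0, unfolded Compl_3] Zbar_T[of _ 1, unfolded Compl_3] Zbar_T[of _ 2, unfolded Compl_3]
  have c: "card (snd (v, {1, 2::3})) = 2" "card (snd (v, {0, 2::3})) = 2" "card (snd (v, {0, 1::3})) = 2"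
    by (simp_all add: dirs3)
  note simps = X cup1_left_def sets_3 Zb cell_scale[of v] cell_scale[of "_ + _"] cell_scale[of "_ - _"]
      tq.scale_right_distrib mon_diff mult_ac add_ac
  have "tqft_Xbar ((v, {1, 2}), s) = tq.scale (mon v) (tqf.T (PX ((0, {1, 2}), s)))"
    "tqft_Xbar ((v, {0, 2}), s) = tq.scale (mon v) (tqf.T (PX ((0, {0, 2}), s)))"
    "tqft_Xbar ((v, {0, 1}), s) = tq.scale (mon v) (tqf.T (PX ((0, {0, 1}), s)))"
    unfolding c[THEN tqft_Xbar_eq] by (simp_all add: simps)
  note eqs = this[folded Compl_3(1-3)]
  consider "i = 0" | "i = 1" | "i = 2" using dirs_3_cases by blast
  then show ?thesis by cases (simp_all only: eqs)
qed

text \<open>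
  Both maps are additive, and the images of the single-qubit operators computed from the cup products
  are those of \<open>T\<close>.
\<close>

lemma alpha_TQFT_eq_T:
  assumes "P \<in> paulis tqft_qubits"
  shows "alpha_TQFT P = tqf.T P"
  using assms
proof (induction P rule: paulis_induct)
  case (X q)
  obtain v F s where q: "q = ((v, F), s)" by (cases q) auto
  then have "card F = 2" using X by (simp add: tqft_qubits_def)
  then obtain i where F: "F = - {i}" using faces_3 Compl_3 by metis
  then show ?case
    unfolding q F by (simp only: alpha_TQFT_def hom_ext_PX Xbar_T) (simp only: cell_scale[of v] tqf.T_scale)
next
  case (Z q)
  obtain v F s where q: "q = ((v, F), s)" by (cases q) auto
  then have "card F = 2" using Z by (simp add: tqft_qubits_def)
  then obtain i where F: "F = - {i}" using faces_3 Compl_3 by metis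
  then show ?case
    unfolding q F by (simp only: alpha_TQFT_def hom_ext_PZ Zbar_T) (simp only: cell_scale[of v] tqf.T_scale)
next
  case (add P R)
  then show ?case by (simp add: alpha_TQFT_def hom_ext_add tqf.T_add)
next
  case zero
  show ?case using tqf.T_add[of 0 0] by (simp add: alpha_TQFT_def hom_ext_def)
qed

lemma tqft_clifford: "clifford_qca tqft_qubits tqft_pos alpha_TQFT"
  by (rule tq.clifford_qca_lin[where L = tqf.T_terms])
    (rule pauli_automorphism_cong[OF tqf.T_automorphism alpha_TQFT_eq_T], simp_all add: alpha_TQFT_eq_T tqf.T_lin)

lemma tqft_translation_invariant: "translation_invariant tqft_qubits tqft_translate alpha_TQFT"
  by (rule tq.translation_invariant_lin[where L = tqf.T_terms]) (simp add: alpha_TQFT_eq_T tqf.T_lin)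

section \<open>Cup products in two dimensions\<close>

lemma sets_UNIV_2: "insert (1::2) {0} = {0, 1}" "(UNIV::2 set) - {0} = {1}" "(UNIV::2 set) - {1} = {0}"
  "- {0::2} = {1}" "- {1::2} = {0}"
  using directions_2 dirs2 by (auto simp: Compl_eq_Diff_UNIV)

lemma sum_UNIV_2: "sum f (UNIV :: 2 set) = f 0 + (f 1 :: 'b::comm_monoid_add)"
  unfolding directions_2(1) by (simp add: dirs2)

lemma dirs_2_cases: "(i::2) = 0 \<or> i = 1"
  using directions_2(1) by blast

lemma edges_2: "card (I :: 2 set) = 1 \<longleftrightarrow> I = {0} \<or> I = {1}"
proof
  assume "card I = 1"
  then obtain k where "I = {k}" by (rule card_1_singletonE)
  then show "I = {0} \<or> I = {1}" using dirs_2_cases[of k] by auto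
qed auto

lemma faces_2: "card (I :: 2 set) = 2 \<longleftrightarrow> I = {0, 1}"
proof
  assume "card I = 2"
  then have "I = UNIV" by (intro card_subset_eq) auto
  then show "I = {0, 1}" using directions_2(1) by simp
qed (simp add: dirs2)

lemma sets_2: "{0::2} \<noteq> {1}" "{1::2} \<noteq> {0}"
  using dirs2 by auto

lemma cup_2:
  fixes a b :: "2 cell \<Rightarrow> bit"
  shows "cup 1 a b v = a (v, {0}) * b (v + ev 0, {1}) + a (v, {1}) * b (v + ev 1, {0})"
proof -
  have e: "{I :: 2 set. card I = 1} = {{0}, {1}}" using edges_2 by auto
  show ?thesis
    unfolding cup_def e by (simp add: sets_2 sets_UNIV_2)
qed

lemma splittings_2:
  "{(I, J). I \<union> J = {k::2} \<and> I \<inter> J = {} \<and> card I = 2 - 1} = {({k}, {})}"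
  "{(I, J). I \<union> J = {k::2} \<and> I \<inter> J = {} \<and> card I = 1 - 1} = {({}, {k})}"
  by (auto simp: Un_singleton_iff)

lemma cup1_2:
  fixes a b :: "2 cell \<Rightarrow> bit"
  shows "cup1 2 a b v = a (v, {0, 1}) * b (v, {0}) + a (v, {0, 1}) * b (v + ev 0, {1})"
    and "cup1 1 a b v = a (v + ev 1, {0}) * b (v, {0, 1}) + a (v, {1}) * b (v, {0, 1})"
proof -
  have o: "(0::2) < 1" "\<not> (1::2) < 0" using directions_2(2) by auto
  show "cup1 2 a b v = a (v, {0, 1}) * b (v, {0}) + a (v, {0, 1}) * b (v + ev 0, {1})"
    "cup1 1 a b v = a (v + ev 1, {0}) * b (v, {0, 1}) + a (v, {1}) * b (v, {0, 1})"
    unfolding cup1_def sum_UNIV_2 sets_UNIV_2 splittings_2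
    by (simp_all add: filter_single o e_sum_empty insert_commute)
qed

lemma cup_int_2:
  fixes c :: "2 cell"
  shows "lattice_integral (cup 1 (ind c) (ind c')) =
      (if snd c = {0} then ind (fst c + ev 0, {1}) c' else 0)
    + (if snd c = {1} then ind (fst c + ev 1, {0}) c' else 0)"
    and "lattice_integral (cup1 2 (ind c) (ind c')) =
      (if snd c = {0, 1} then ind (fst c, {0}) c' else 0)
    + (if snd c = {0, 1} then ind (fst c + ev 0, {1}) c' else 0)"
    and "lattice_integral (cup1 1 (ind c) (ind c')) =
      (if snd c = {0} then ind (fst c - ev 1, {0, 1}) c' else 0)
    + (if snd c = {1} then ind (fst c, {0, 1}) c' else 0)"
proof -
  have *: "cup p (ind c) (ind c') = (\<lambda>v. cup p (ind c) (ind c') v)"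
    "cup1 p (ind c) (ind c') = (\<lambda>v. cup1 p (ind c) (ind c') v)" for p by (rule refl)+
  note simps = lattice_integral_add fsupp_add fsupp_terms lattice_integral_terms diff_zero add_0_right
  show "lattice_integral (cup 1 (ind c) (ind c')) =
      (if snd c = {0} then ind (fst c + ev 0, {1}) c' else 0)
    + (if snd c = {1} then ind (fst c + ev 1, {0}) c' else 0)"
    by (subst *, unfold cup_2) (simp only: simps)
  show "lattice_integral (cup1 2 (ind c) (ind c')) =
      (if snd c = {0, 1} then ind (fst c, {0}) c' else 0)
    + (if snd c = {0, 1} then ind (fst c + ev 0, {1}) c' else 0)"
    by (subst *, unfold cup1_2) (simp only: simps)
  show "lattice_integral (cup1 1 (ind c) (ind c')) =
      (if snd c = {0} then ind (fst c - ev 1, {0, 1}) c' else 0)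
    + (if snd c = {1} then ind (fst c, {0, 1}) c' else 0)"
    by (subst *, unfold cup1_2) (simp only: simps)
qed

lemma isa_W_eq: "isa_W s (v, {0, 1}) =
    PZ ((v, {1}), s) + PZ ((v + ev 0, {1}), s) + PZ ((v, {0}), s) + PZ ((v + ev 1, {0}), s)"
proof -
  have d: "{0, 1} - {0::2} = {1}" "{0, 1} - {1::2} = {0}" using dirs2 by auto
  have "isa_W s (v, {0, 1}) = (\<Sum>e\<leftarrow>[(v, {1}), (v + ev 0, {1}), (v, {0}), (v + ev 1, {0})]. PZ (e, s))"
    unfolding isa_W_def
    by (rule cell_prod_of_list) (auto simp: coboundary_ind lookup_cell_boundary dirs2 d add_ac)
  then show ?thesis by (simp add: add_ac)
qed

lemma isa_U_eq: "isa_U s (v, {0}) = PX ((v, {0}), s) + PZ ((v + ev 0, {1}), s)"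
  "isa_U s (v, {1}) = PX ((v, {1}), s) + PZ ((v + ev 1, {0}), s)"
  "cell_prod 1 (\<lambda>e'. PZ (e', s)) (\<lambda>e'. lattice_integral (cup 1 (ind (v, {0::2})) (ind e'))) = PZ ((v + ev 0, {1}), s)"
  "cell_prod 1 (\<lambda>e'. PZ (e', s)) (\<lambda>e'. lattice_integral (cup 1 (ind (v, {1::2})) (ind e'))) = PZ ((v + ev 1, {0}), s)"
proof -
  show 1: "cell_prod 1 (\<lambda>e'. PZ (e', s)) (\<lambda>e'. lattice_integral (cup 1 (ind (v, {0::2})) (ind e'))) = PZ ((v + ev 0, {1}), s)"
    by (subst cell_prod_of_list[where L = "[(v + ev 0, {1})]"]) (simp_all add: cup_int_2[unfolded One_nat_def] sets_2)
  show 2: "cell_prod 1 (\<lambda>e'. PZ (e', s)) (\<lambda>e'. lattice_integral (cup 1 (ind (v, {1::2})) (ind e'))) = PZ ((v + ev 1, {0}), s)"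
    by (subst cell_prod_of_list[where L = "[(v + ev 1, {0})]"]) (simp_all add: cup_int_2[unfolded One_nat_def] sets_2)
  show "isa_U s (v, {0}) = PX ((v, {0}), s) + PZ ((v + ev 0, {1}), s)"
    "isa_U s (v, {1}) = PX ((v, {1}), s) + PZ ((v + ev 1, {0}), s)"
    by (simp_all only: isa_U_def 1 2)
qed

lemma cell_prod_cup1:
  "cell_prod 2 F (\<lambda>f. lattice_integral (cup1 2 (ind f) (ind (v, {0::2})))) = F (v, {0, 1})"
  "cell_prod 2 F (\<lambda>f. lattice_integral (cup1 2 (ind f) (ind (v, {1::2})))) = F (v - ev 0, {0, 1})"
  "cell_prod 2 F (\<lambda>f. lattice_integral (cup1 1 (ind (v, {0::2})) (ind f))) = F (v - ev 1, {0, 1})"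
  "cell_prod 2 F (\<lambda>f. lattice_integral (cup1 1 (ind (v, {1::2})) (ind f))) = F (v, {0, 1})"
proof -
  have c2: "card {0, 1::2} = 2" by (simp add: dirs2)
  have l: "lattice_integral (cup1 2 (ind c) (ind (v, {0::2}))) = (\<Sum>d\<leftarrow>[(v, {0, 1})]. ind d c)"
    "lattice_integral (cup1 2 (ind c) (ind (v, {1::2}))) = (\<Sum>d\<leftarrow>[(v - ev 0, {0, 1})]. ind d c)"
    if "card (snd c) = 2" for c
  proof -
    obtain w F where "c = (w, F)" by (cases c)
    moreover from this that have "F = {0, 1}" by (simp add: faces_2)
    ultimately have c: "c = (w, {0, 1})" by simp
    have "v = w + ev 0 \<longleftrightarrow> w = v - ev 0" by (auto simp: algebra_simps)
    then show "lattice_integral (cup1 2 (ind c) (ind (v, {0::2}))) = (\<Sum>d\<leftarrow>[(v, {0, 1})]. ind d c)"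
      "lattice_integral (cup1 2 (ind c) (ind (v, {1::2}))) = (\<Sum>d\<leftarrow>[(v - ev 0, {0, 1})]. ind d c)"
      by (simp_all add: c cup_int_2 sets_2 ind_eq eq_commute[of v w])
  qed
  have r: "lattice_integral (cup1 1 (ind (v, {0::2})) (ind c)) = (\<Sum>d\<leftarrow>[(v - ev 1, {0, 1})]. ind d c)"
    "lattice_integral (cup1 1 (ind (v, {1::2})) (ind c)) = (\<Sum>d\<leftarrow>[(v, {0, 1})]. ind d c)" for c
    by (simp_all only: cup_int_2 fst_conv snd_conv sets_2 if_True if_False refl list.map sum_list.Cons sum_list.Nil
        add_0_left add_0_right)
  show "cell_prod 2 F (\<lambda>f. lattice_integral (cup1 2 (ind f) (ind (v, {0::2})))) = F (v, {0, 1})"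
    by (subst cell_prod_of_list[OF l(1)]) (simp_all add: c2)
  show "cell_prod 2 F (\<lambda>f. lattice_integral (cup1 2 (ind f) (ind (v, {1::2})))) = F (v - ev 0, {0, 1})"
    by (subst cell_prod_of_list[OF l(2)]) (simp_all add: c2)
  show "cell_prod 2 F (\<lambda>f. lattice_integral (cup1 1 (ind (v, {0::2})) (ind f))) = F (v - ev 1, {0, 1})"
    by (subst cell_prod_of_list[OF r(1)]) (simp_all add: c2)
  show "cell_prod 2 F (\<lambda>f. lattice_integral (cup1 1 (ind (v, {1::2})) (ind f))) = F (v, {0, 1})"
    by (subst cell_prod_of_list[OF r(2)]) (simp_all add: c2)
qed

lemma cell_prod_cup:
  "cell_prod 1 F (\<lambda>e'. lattice_integral (cup 1 (ind e') (ind (v, {0::2})))) = F (v - ev 1, {1})"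
  "cell_prod 1 F (\<lambda>e'. lattice_integral (cup 1 (ind e') (ind (v, {1::2})))) = F (v - ev 0, {0})"
proof -
  have c: "card (snd c) = 1 \<Longrightarrow> snd c = {0} \<or> snd c = {1}" for c :: "2 cell" using edges_2 by simp
  have k: "lattice_integral (cup 1 (ind c) (ind (v, {0::2}))) = (\<Sum>d\<leftarrow>[(v - ev 1, {1})]. ind d c)"
    "lattice_integral (cup 1 (ind c) (ind (v, {1::2}))) = (\<Sum>d\<leftarrow>[(v - ev 0, {0})]. ind d c)"
    if "card (snd c) = 1" for c
    using c[OF that] by (cases c; auto simp: cup_int_2[unfolded One_nat_def] sets_2 ind_eq algebra_simps)+
  show "cell_prod 1 F (\<lambda>e'. lattice_integral (cup 1 (ind e') (ind (v, {0::2})))) = F (v - ev 1, {1})"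
    by (subst cell_prod_of_list[OF k(1)]) simp_all
  show "cell_prod 1 F (\<lambda>e'. lattice_integral (cup 1 (ind e') (ind (v, {1::2})))) = F (v - ev 0, {0})"
    by (subst cell_prod_of_list[OF k(2)]) simp_all
qed

section \<open>The layered automorphism\<close>

definition stack_site :: "(int, 2) vec \<Rightarrow> int \<Rightarrow> (int, 3) vec" where
  "stack_site v j = (\<chi> i. if i = 0 then v $ 0 else if i = 1 then v $ 1 else j)"

lemma stack_site_simps:
  "stack_site (v + ev 0) j = stack_site v j + ev 0" "stack_site (v + ev 1) j = stack_site v j + ev 1"
  "stack_site (v - t) j = stack_site v j - stack_site t 0" "stack_site (ev 0) 0 = ev 0" "stack_site (ev 1) 0 = ev 1"
  "stack_site v (j + 1) = stack_site v j + ev 2"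
proof -
  have c: "i = 2" if "i \<noteq> 0" "i \<noteq> 1" for i :: 3 using dirs_3_cases[of i] that by simp
  show "stack_site (v + ev 0) j = stack_site v j + ev 0" "stack_site (v + ev 1) j = stack_site v j + ev 1"
    "stack_site (v - t) j = stack_site v j - stack_site t 0" "stack_site (ev 0) 0 = ev 0" "stack_site (ev 1) 0 = ev 1"
    by (simp_all add: stack_site_def e_sum_def vec_eq_iff dirs2 dirs3)
  show "stack_site v (j + 1) = stack_site v j + ev 2"
    by (auto simp: stack_site_def e_sum_def vec_eq_iff dirs2 dirs3 intro: c)
qed

lemma translate_site: "isa_translate (stack_site w j) (0, ((0, I), s)) = (j, ((w, I), s))"
proof -
  have "(\<chi> i. if i = 0 then stack_site w j $ 0 else stack_site w j $ 1) = w"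
    using dirs_2_cases by (auto simp: vec_eq_iff stack_site_def dirs3 dirs2)
  moreover have "stack_site w j $ 2 = j" by (simp add: stack_site_def dirs3)
  ultimately show ?thesis by (simp add: isa_translate_def)
qed

lemma site_translate:
  obtains w j where "v = stack_site w j" "isa_translate v (0, ((0, I), s)) = (j, ((w, I), s))"
proof -
  define w :: "(int, 2) vec" where "w = (\<chi> i. if i = 0 then v $ 0 else v $ 1)"
  have "v = stack_site w (v $ 2)"
    unfolding vec_eq_iff
  proof
    fix i :: 3
    consider "i = 0" | "i = 1" | "i = 2" using dirs_3_cases by blast
    then show "v $ i = stack_site w (v $ 2) $ i"
      by cases (simp_all add: stack_site_def w_def dirs2 dirs3)
  qed
  then show thesis using that[of w "v $ 2"] translate_site[of w "v $ 2" I s] by simp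
qed

interpretation st: qubit_system_3 isa_pos isa_translate isa_qubits
proof
  fix s t :: "(int, 3) vec" and q :: stack_qubit
  obtain j v I sp where q: "q = (j, ((v, I), sp))" by (cases q) auto
  have v: "(\<chi> i. if i = 0 then (0 :: (int, 3) vec) $ 0 else 0 $ 1) = (0 :: (int, 2) vec)"
    "(\<chi> i. if i = 0 then (s + t) $ 0 else (s + t) $ 1) =
      ((\<chi> i. if i = 0 then t $ 0 else t $ 1) + (\<chi> i. if i = 0 then s $ 0 else s $ 1) :: (int, 2) vec)"
    by (simp_all add: vec_eq_iff)
  show "isa_translate 0 q = q" by (simp only: isa_translate_def q v) simp
  show "isa_translate (s + t) q = isa_translate s (isa_translate t q)"
    by (simp only: isa_translate_def q v prod.case) (simp add: add_ac)
  show "isa_pos (isa_translate t q) = t + isa_pos q"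
    unfolding vec_eq_iff
  proof
    fix i :: 3
    consider "i = 0" | "i = 1" | "i = 2" using dirs_3_cases by blast
    then show "isa_pos (isa_translate t q) $ i = (t + isa_pos q) $ i"
      by cases (simp_all add: isa_translate_def q isa_pos_def dirs2 dirs3)
  qed
  show "q \<in> isa_qubits \<Longrightarrow> isa_translate t q \<in> isa_qubits"
    by (simp add: q isa_qubits_def isa_translate_def)
qed

locale edge_system = qubit_system_3 pos tr Q
  for pos :: "'q \<Rightarrow> (int, 3) vec" and tr Q +
  fixes edge_q :: "species \<Rightarrow> 2 \<Rightarrow> 'q"
  assumes edge_q_Q: "edge_q s i \<in> Q" and edge_q_pos: "pos (edge_q s i) = 0"
    and edge_q_inj: "edge_q s i = edge_q t k \<longleftrightarrow> s = t \<and> i = k"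
begin

sublocale edge_frame scale conj lam
  "mon (ev 0)" "mon (- ev 0)" "mon (ev 1)" "mon (- ev 1)" "mon (ev 2)" "mon (- ev 2)"
  "\<lambda>s i. PX (edge_q s i)" "\<lambda>s i. PZ (edge_q s i)"
  by unfold_locales (simp_all add: lam_PX_PZ lam_PX_PZ_base edge_q_pos edge_q_inj)

lemma XZ_Q: "PX (edge_q s i) \<in> paulis Q" "PZ (edge_q s i) \<in> paulis Q"
  unfolding PX_def PZ_def by (rule paulis_single[OF edge_q_Q])+

lemma a_Q: "i \<in> {..<4} \<Longrightarrow> a i \<in> paulis Q"
  unfolding less4 a_def by (elim insertE emptyE; simp; intro paulis_add scale_Q XZ_Q)

lemma abar_Q: "i \<in> {..<4} \<Longrightarrow> abar i \<in> paulis Q"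
  unfolding less4 abar_def by (elim insertE emptyE; simp; intro paulis_add scale_Q XZ_Q)

lemma pump_terms_Q: "set pump_terms \<subseteq> paulis Q \<times> paulis Q"
proof -
  have "a 0 \<in> paulis Q" "a 1 \<in> paulis Q" "a 2 \<in> paulis Q" "a 3 \<in> paulis Q"
    by (rule a_Q; simp)+
  then show ?thesis by (simp add: pump_terms_def Let_def scale_Q)
qed

lemma edge_pump_automorphism: "pauli_automorphism Q pump"
  unfolding pump_def[abs_def]
  by (rule pump_automorphism, rule gram_a_inverse) (simp_all add: a_Q del: lessThan_iff)

lemma pump_add: "pump (p + r) = pump p + pump r"
  by (simp only: pump_lin lin_add add_ac)

lemma pump_scale: "pump (b \<odot> p) = b \<odot> pump p"
  by (simp only: pump_lin lin_scale scale_right_distrib)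

text \<open>
  The \<open>a i\<close> and \<open>abar i\<close> generate the operators on edges as a module, so a map that is additive on
  them and their translates is determined.
\<close>

lemma agree_on_basis:
  assumes add: "\<And>P R. P \<in> paulis Q \<Longrightarrow> R \<in> paulis Q \<Longrightarrow> \<alpha> (P + R) = \<alpha> P + \<alpha> R"
    and a: "\<And>t i. i \<in> {..<4} \<Longrightarrow> \<alpha> (mon t \<odot> a i) = \<beta> (mon t \<odot> a i)"
    and abar: "\<And>t i. i \<in> {..<4} \<Longrightarrow> \<alpha> (mon t \<odot> abar i) = \<beta> (mon t \<odot> abar i)"
    and \<beta>: "\<And>P R. \<beta> (P + R) = \<beta> P + \<beta> R"
  shows "\<alpha> (r \<odot> PX (edge_q s i)) = \<beta> (r \<odot> PX (edge_q s i))" "\<alpha> (r \<odot> PZ (edge_q s i)) = \<beta> (r \<odot> PZ (edge_q s i))"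
proof -
  \<comment> \<open>Closing under multiples makes the set of operators of agreement a submodule.\<close>
  define G where "G p \<longleftrightarrow> p \<in> paulis Q \<and> (\<forall>r. \<alpha> (r \<odot> p) = \<beta> (r \<odot> p))" for p
  have G_add: "G (p + r)" if "G p" "G r" for p r
    using that unfolding G_def by (simp add: scale_right_distrib add \<beta> scale_Q paulis_add)
  have G_scale: "G (b \<odot> p)" if "G p" for b p
    using that unfolding G_def by (simp add: scale_Q)
  have G_gen: "G p" if "p \<in> paulis Q" "\<And>t. \<alpha> (mon t \<odot> p) = \<beta> (mon t \<odot> p)" for p
    unfolding G_def
  proof (intro conjI allI that(1))
    fix r show "\<alpha> (r \<odot> p) = \<beta> (r \<odot> p)"
      by (induction r rule: laurent_induct) (simp_all add: that scale_left_distrib add \<beta> scale_Q)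
  qed
  have ga: "G (a i)" "G (abar i)" if "i \<in> {..<4}" for i
    by (rule G_gen[OF a_Q[OF that] a[OF that]] G_gen[OF abar_Q[OF that] abar[OF that]])+
  have four: "0 \<in> {..<4::nat}" "1 \<in> {..<4::nat}" "2 \<in> {..<4::nat}" "3 \<in> {..<4::nat}" by auto
  have sum4: "(\<Sum>i\<in>{..<4}. f i) = f 0 + f 1 + f 2 + (f 3 :: 'q pauli)" for f :: "nat \<Rightarrow> 'q pauli"
    unfolding less4 by (simp add: add_ac)
  have Z: "G (PZ (edge_q Sp_A 0))" "G (PZ (edge_q Sp_A 1))" "G (PZ (edge_q Sp_B 0))" "G (PZ (edge_q Sp_B 1))"
    unfolding Z_from_a sum4 by (intro G_add G_scale ga four)+
  have X: "G (PX (edge_q Sp_A 0))" "G (PX (edge_q Sp_A 1))" "G (PX (edge_q Sp_B 0))" "G (PX (edge_q Sp_B 1))"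
    by (subst X_from_a, intro G_add G_scale Z ga four)+
  have "i = 0 \<or> i = 1" by (rule dirs_2_cases)
  then have "G (PX (edge_q s i))" "G (PZ (edge_q s i))"
    using X Z by (cases s; elim disjE; simp only:)+
  then show "\<alpha> (r \<odot> PX (edge_q s i)) = \<beta> (r \<odot> PX (edge_q s i))" "\<alpha> (r \<odot> PZ (edge_q s i)) = \<beta> (r \<odot> PZ (edge_q s i))"
    by (simp_all add: G_def)
qed

end

interpretation ste: edge_system isa_pos isa_translate isa_qubits "\<lambda>s i. (0, ((0, {i}), s))"
proof
  show "isa_pos (0, (0, {i}), s) = 0" for i s
    by (simp add: isa_pos_def vec_eq_iff)
qed (auto simp: isa_qubits_def)

lemma stack_scale:
  "relabel (Pair j) (PX ((v, I), s)) = st.scale (mon (stack_site v j)) (PX (0, ((0, I), s)))"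
  "relabel (Pair j) (PZ ((v, I), s)) = st.scale (mon (stack_site v j)) (PZ (0, ((0, I), s)))"
  by (simp_all add: PX_def PZ_def st.scale_mon relabel_single translate_site)

lemmas isa_op_simps = isa_A_def isa_Abar_def isa_U_eq isa_W_eq cell_prod_cup1 cell_prod_cup

lemma layer_simps:
  "in_layer j (p + r) = in_layer j p + in_layer j r"
  "in_layer j (PX ((v, I), s)) = st.scale (mon (stack_site v j)) (PX (0, ((0, I), s)))"
  "in_layer j (PZ ((v, I), s)) = st.scale (mon (stack_site v j)) (PZ (0, ((0, I), s)))"
  unfolding in_layer_def by (rule relabel_add stack_scale)+

lemma layer_a:
  "in_layer j (isa_A Sp_A (v, {0})) = st.scale (mon (stack_site v j)) (ste.a 0)"
  "in_layer j (isa_A Sp_A (v, {1})) = st.scale (mon (stack_site v j)) (ste.a 1)"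
  "in_layer j (isa_A Sp_B (v, {0})) = st.scale (mon (stack_site v j)) (ste.a 2)"
  "in_layer j (isa_A Sp_B (v, {1})) = st.scale (mon (stack_site v j)) (ste.a 3)"
  "in_layer j (isa_Abar Sp_A (v, {0})) = st.scale (mon (stack_site v j)) (ste.abar 0)"
  "in_layer j (isa_Abar Sp_A (v, {1})) = st.scale (mon (stack_site v j)) (ste.abar 1)"
  "in_layer j (isa_Abar Sp_B (v, {0})) = st.scale (mon (stack_site v j)) (ste.abar 2)"
  "in_layer j (isa_Abar Sp_B (v, {1})) = st.scale (mon (stack_site v j)) (ste.abar 3)"
  by (simp_all only: isa_op_simps species.case layer_simps stack_site_simps mon_diff)
    (simp_all add: ste.a_def ste.abar_def
    st.scale_right_distrib st.scale_left_distrib distrib_left st.p_double st.p_double' st.units st.units' add_ac mult_ac)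

lemma basis_pauli:
  assumes "q \<in> isa_qubits"
  obtains s i t where "PX q = st.scale (mon t) (PX (0, ((0, {i}), s)))" "PZ q = st.scale (mon t) (PZ (0, ((0, {i}), s)))"
proof -
  obtain j v I s where q: "q = (j, ((v, I), s))" by (cases q) auto
  then have "card I = 1" using assms by (simp add: isa_qubits_def)
  then obtain i where I: "I = {i}" by (rule card_1_singletonE)
  have "PX q = relabel (Pair j) (PX ((v, I), s))" "PZ q = relabel (Pair j) (PZ ((v, I), s))"
    by (simp_all add: q PX_def PZ_def relabel_single)
  then show thesis by (intro that[of "stack_site v j" i s]) (simp_all only: stack_scale I)
qed

lemma layer_pump:
  assumes "card (snd e) = 1"
  shows "ste.pump (in_layer j (isa_A s e)) = in_layer (j + 1) (isa_A s e)"
    and "ste.pump (in_layer j (isa_Abar s e)) = in_layer j (isa_Abar s e)"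
    and "in_layer j (isa_A s e) \<in> paulis isa_qubits" and "in_layer j (isa_Abar s e) \<in> paulis isa_qubits"
proof -
  obtain v I where e: "e = (v, I)" by (cases e)
  have I: "I = {0} \<or> I = {1}" using assms e edges_2 by simp
  have "\<exists>k. k \<in> {..<4} \<and> (\<forall>j. in_layer j (isa_A s e) = st.scale (mon (stack_site v j)) (ste.a k) \<and>
    in_layer j (isa_Abar s e) = st.scale (mon (stack_site v j)) (ste.abar k))"
  proof (cases s)
    case Sp_A
    from I show ?thesis
    proof
      assume "I = {0}" then show ?thesis unfolding Sp_A e by (intro exI[of _ 0]) (simp add: layer_a)
    next
      assume "I = {1}" then show ?thesis unfolding Sp_A e by (intro exI[of _ 1]) (simp add: layer_a)
    qed
  next
    case Sp_B
    from I show ?thesis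
    proof
      assume "I = {0}" then show ?thesis unfolding Sp_B e by (intro exI[of _ 2]) (simp add: layer_a)
    next
      assume "I = {1}" then show ?thesis unfolding Sp_B e by (intro exI[of _ 3]) (simp add: layer_a)
    qed
  qed
  then obtain k where k: "k \<in> {..<4}"
    "\<And>j. in_layer j (isa_A s e) = st.scale (mon (stack_site v j)) (ste.a k)"
    "\<And>j. in_layer j (isa_Abar s e) = st.scale (mon (stack_site v j)) (ste.abar k)" by blast
  show "ste.pump (in_layer j (isa_A s e)) = in_layer (j + 1) (isa_A s e)"
    by (simp only: k ste.pump_scale ste.pump_a[OF k(1)] st.scale_scale stack_site_simps mon_diff)
  show "ste.pump (in_layer j (isa_Abar s e)) = in_layer j (isa_Abar s e)"
    by (simp only: k ste.pump_scale ste.pump_abar[OF k(1)])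
  show "in_layer j (isa_A s e) \<in> paulis isa_qubits" "in_layer j (isa_Abar s e) \<in> paulis isa_qubits"
    unfolding k by (intro st.scale_Q ste.a_Q ste.abar_Q k(1))+
qed

lemma a_layer:
  assumes "k \<in> {..<4}"
  obtains s e j where "card (snd e) = 1" "st.scale (mon t) (ste.a k) = in_layer j (isa_A s e)"
    "st.scale (mon t) (ste.abar k) = in_layer j (isa_Abar s e)"
proof -
  obtain v j where t: "t = stack_site v j" by (rule site_translate)
  have "k = 0 \<or> k = 1 \<or> k = 2 \<or> k = 3" using assms by auto
  then show thesis
  proof (elim disjE)
    assume "k = 0" then show thesis using that[of "(v, {0})" j Sp_A] layer_a[of j v] t by simp
  next
    assume "k = 1" then show thesis using that[of "(v, {1})" j Sp_A] layer_a[of j v] t by simp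
  next
    assume "k = 2" then show thesis using that[of "(v, {0})" j Sp_B] layer_a[of j v] t by simp
  next
    assume "k = 3" then show thesis using that[of "(v, {1})" j Sp_B] layer_a[of j v] t by simp
  qed
qed

text \<open>
  The \<open>a\<close> are multiplied by the vertical translation and the \<open>abar\<close>, being orthogonal to them, are
  fixed, which is the defining property.
\<close>

lemma pump_is_alpha_ISA: "is_alpha_ISA (restrict ste.pump (paulis isa_qubits))"
proof -
  have "ste.pump P \<in> paulis isa_qubits" if "P \<in> paulis isa_qubits" for P
    using ste.edge_pump_automorphism that by (auto simp: pauli_automorphism_def dest: bij_betwE)
  then show ?thesis
    unfolding is_alpha_ISA_def
    by (auto simp: paulis_add ste.pump_add layer_pump)
qed

lemma is_alpha_ISA_unique:
  assumes "is_alpha_ISA \<alpha>"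
  shows "\<alpha> = restrict ste.pump (paulis isa_qubits)"
proof (rule extensionalityI)
  show "\<alpha> \<in> extensional (paulis isa_qubits)"
    using assms by (auto simp: is_alpha_ISA_def PiE_def)
  show "restrict ste.pump (paulis isa_qubits) \<in> extensional (paulis isa_qubits)" by simp
  have \<alpha>_add: "\<alpha> (P + R) = \<alpha> P + \<alpha> R" if "P \<in> paulis isa_qubits" "R \<in> paulis isa_qubits" for P R
    using assms that by (simp add: is_alpha_ISA_def)
  have H: "\<forall>j s e. card (snd e) = 1 \<longrightarrow> \<alpha> (in_layer j (isa_A s e)) = in_layer (j + 1) (isa_A s e) \<and>
      \<alpha> (in_layer j (isa_Abar s e)) = in_layer j (isa_Abar s e)"
    using assms unfolding is_alpha_ISA_def by (elim conjE)
  have gen: "\<alpha> (in_layer j (isa_A s e)) = ste.pump (in_layer j (isa_A s e))"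
    "\<alpha> (in_layer j (isa_Abar s e)) = ste.pump (in_layer j (isa_Abar s e))" if "card (snd e) = 1" for j s e
  proof -
    have "\<alpha> (in_layer j (isa_A s e)) = in_layer (j + 1) (isa_A s e) \<and>
        \<alpha> (in_layer j (isa_Abar s e)) = in_layer j (isa_Abar s e)"
      using H[rule_format, OF that] .
    then show "\<alpha> (in_layer j (isa_A s e)) = ste.pump (in_layer j (isa_A s e))"
      "\<alpha> (in_layer j (isa_Abar s e)) = ste.pump (in_layer j (isa_Abar s e))"
      by (simp_all only: layer_pump[OF that])
  qed
  have a: "\<alpha> (st.scale (mon t) (ste.a k)) = ste.pump (st.scale (mon t) (ste.a k))"
    "\<alpha> (st.scale (mon t) (ste.abar k)) = ste.pump (st.scale (mon t) (ste.abar k))" if k: "k \<in> {..<4}" for t k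
  proof -
    obtain s e j where "card (snd e) = 1" "st.scale (mon t) (ste.a k) = in_layer j (isa_A s e)"
      "st.scale (mon t) (ste.abar k) = in_layer j (isa_Abar s e)"
      by (rule a_layer[OF k])
    then show "\<alpha> (st.scale (mon t) (ste.a k)) = ste.pump (st.scale (mon t) (ste.a k))"
      "\<alpha> (st.scale (mon t) (ste.abar k)) = ste.pump (st.scale (mon t) (ste.abar k))"
      by (simp_all only: gen)
  qed
  note basis = ste.agree_on_basis[where \<alpha> = \<alpha> and \<beta> = ste.pump, OF \<alpha>_add a ste.pump_add]
  fix P assume P: "P \<in> paulis isa_qubits"
  then have "\<alpha> P = ste.pump P"
  proof (induction P rule: paulis_induct)
    case (X q)
    then obtain s i t where "PX q = st.scale (mon t) (PX (0, ((0, {i}), s)))" by (rule basis_pauli)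
    then show ?case by (simp only: basis)
  next
    case (Z q)
    then obtain s i t where "PZ q = st.scale (mon t) (PZ (0, ((0, {i}), s)))" by (rule basis_pauli)
    then show ?case by (simp only: basis)
  next
    case (add P R)
    then show ?case by (simp only: \<alpha>_add ste.pump_add)
  next
    case zero
    show ?case using \<alpha>_add[of 0 0] ste.pump_add[of 0 0] by (simp add: paulis_zero)
  qed
  then show "\<alpha> P = restrict ste.pump (paulis isa_qubits) P" using P by simp
qed

lemma ex1_alpha_ISA: "\<exists>!\<alpha>. is_alpha_ISA \<alpha>"
  using pump_is_alpha_ISA is_alpha_ISA_unique by (rule ex1I)

lemma alpha_ISA_restrict: "alpha_ISA = restrict ste.pump (paulis isa_qubits)"
  unfolding alpha_ISA_def by (rule the_equality, rule pump_is_alpha_ISA, rule is_alpha_ISA_unique)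

lemma alpha_ISA_pump: "P \<in> paulis isa_qubits \<Longrightarrow> alpha_ISA P = ste.pump P"
  by (rule trans[OF fun_cong[OF alpha_ISA_restrict] restrict_apply'])

lemma isa_clifford: "clifford_qca isa_qubits isa_pos alpha_ISA"
  by (rule st.clifford_qca_lin[where L = ste.pump_terms])
    (rule pauli_automorphism_cong[OF ste.edge_pump_automorphism alpha_ISA_pump], simp_all add: alpha_ISA_pump ste.pump_lin)

lemma isa_translation_invariant: "translation_invariant isa_qubits isa_translate alpha_ISA"
  by (rule st.translation_invariant_lin[where L = ste.pump_terms]) (simp add: alpha_ISA_pump ste.pump_lin)

section \<open>Equivalence\<close>

text \<open>
  The six face qubits at a site are identified with the added qubits 0 to 5 of the layered system,
  and the added qubits 0 to 3 of the face system with the four edge qubits at the site. The fifth added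
  qubit of the face system becomes number 6, the spare one, so the TQFT acts on the first six added qubits
  only and commutes with the layered system and with the spare qubit.
\<close>

definition stab_ident :: "3 cell_qubit + (int, 3) vec \<times> nat \<Rightarrow> stack_qubit + (int, 3) vec \<times> nat" where
  "stab_ident q = (case q of
     Inl ((v, F), s) \<Rightarrow> Inr (v, (if F = {1, 2} then 0 else if F = {0, 2} then 1 else 2) + (if s = Sp_A then 0 else 3))
   | Inr (v, n) \<Rightarrow> if n < 4 then Inl (isa_translate v (0, ((0, {if even n then 0 else 1}), if n < 2 then Sp_A else Sp_B)))
       else Inr (v, n + 2))"

definition stab_ident_inv :: "stack_qubit + (int, 3) vec \<times> nat \<Rightarrow> 3 cell_qubit + (int, 3) vec \<times> nat" where
  "stab_ident_inv q = (case q of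
     Inl (j, ((w, I), s)) \<Rightarrow> Inr (stack_site w j, (if I = {0} then 0 else 1) + (if s = Sp_A then 0 else 2))
   | Inr (v, n) \<Rightarrow> if n < 6 then Inl ((v, if n mod 3 = 0 then {1, 2} else if n mod 3 = 1 then {0, 2} else {0, 1}),
        if n < 3 then Sp_A else Sp_B) else Inr (v, n - 2))"

lemma Plus_iff: "Inl x \<in> A <+> B \<longleftrightarrow> x \<in> A" "Inr y \<in> A <+> B \<longleftrightarrow> y \<in> B"
  by auto

lemma stab_ident_bij: "bij_betw stab_ident (stab_qubits tqft_qubits 5) (stab_qubits isa_qubits 7)"
proof (rule bij_betw_byWitness[where f' = stab_ident_inv])
  have A: "stab_ident_inv (stab_ident q) = q \<and> stab_ident q \<in> stab_qubits isa_qubits 7"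
    if "q \<in> stab_qubits tqft_qubits 5" for q
  proof (cases q)
    case (Inl q')
    obtain v F s where q': "q' = ((v, F), s)" by (cases q') auto
    have "card F = 2" using that by (auto simp: Inl q' stab_qubits_def tqft_qubits_def)
    then have "F = {1, 2} \<or> F = {0, 2} \<or> F = {0, 1}" by (simp only: faces_3)
    then show ?thesis
      using that by (elim disjE; cases s; simp add: Inl q' stab_ident_def stab_ident_inv_def sets_3 stab_qubits_def Plus_iff)
  next
    case (Inr x)
    obtain v n where x: "x = (v, n)" by (cases x)
    have "n < 5" using that by (auto simp: Inr x stab_qubits_def)
    then consider "n = 0" | "n = 1" | "n = 2" | "n = 3" | "n = 4" by linarith
    moreover obtain w j where w: "v = stack_site w j" by (rule site_translate)
    ultimately show ?thesis
      by cases (simp_all add: Inr x stab_ident_def stab_ident_inv_def translate_site sets_2 stab_qubits_def Plus_iff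
          isa_qubits_def)
  qed
  have B: "stab_ident (stab_ident_inv q) = q \<and> stab_ident_inv q \<in> stab_qubits tqft_qubits 5"
    if "q \<in> stab_qubits isa_qubits 7" for q
  proof (cases q)
    case (Inl q')
    obtain j w I s where q': "q' = (j, ((w, I), s))" by (cases q') auto
    have "card I = 1" using that by (auto simp: Inl q' stab_qubits_def isa_qubits_def)
    then have "I = {0} \<or> I = {1}" by (simp only: edges_2)
    then show ?thesis
      by (elim disjE; cases s; simp add: Inl q' stab_ident_def stab_ident_inv_def sets_2 stab_qubits_def Plus_iff translate_site)
  next
    case (Inr x)
    obtain v n where x: "x = (v, n)" by (cases x)
    have "n < 7" using that by (auto simp: Inr x stab_qubits_def)
    then consider "n = 0" | "n = 1" | "n = 2" | "n = 3" | "n = 4" | "n = 5" | "n = 6" by linarith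
    then show ?thesis
      by cases (simp_all add: Inr x stab_ident_def stab_ident_inv_def sets_3 stab_qubits_def Plus_iff tqft_qubits_def dirs3)
  qed
  show "\<forall>a\<in>stab_qubits tqft_qubits 5. stab_ident_inv (stab_ident a) = a"
    "stab_ident ` stab_qubits tqft_qubits 5 \<subseteq> stab_qubits isa_qubits 7" using A by auto
  show "\<forall>a'\<in>stab_qubits isa_qubits 7. stab_ident (stab_ident_inv a') = a'"
    "stab_ident_inv ` stab_qubits isa_qubits 7 \<subseteq> stab_qubits tqft_qubits 5" using B by auto
qed

lemma stab_ident_pos: "stab_pos isa_pos (stab_ident q) = stab_pos tqft_pos q"
proof (cases q)
  case (Inl q')
  then show ?thesis
    by (cases q') (auto simp: stab_ident_def stab_pos_def tqft_pos_def split: prod.splits)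
next
  case (Inr x)
  have "isa_pos (0, ((0, I), s)) = 0" for I s by (simp add: isa_pos_def vec_eq_iff)
  then show ?thesis
    by (cases x) (simp add: Inr stab_ident_def stab_pos_def st.pos_tr)
qed

lemma stab_ident_equivariant:
  "stab_ident (Inl (tqft_translate t q)) = stab_tr isa_translate t (stab_ident (Inl q))"
  by (auto simp: stab_ident_def stab_tr_def tqft_translate_def add_ac split: prod.splits)

interpretation cs: qubit_system_3 "stab_pos isa_pos" "stab_tr isa_translate" "stab_qubits isa_qubits 7"
  unfolding qubit_system_3_def by (rule st.stab_system)

interpretation csf: face_system "stab_pos isa_pos" "stab_tr isa_translate" "stab_qubits isa_qubits 7"
  "\<lambda>s i. stab_ident (Inl ((0, - {i}), s))"
proof
  fix s t and i k :: 3
  have T: "Inl ((0, - {i}), s) \<in> stab_qubits tqft_qubits 5" for s i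
    using tqf.face_q_Q[of i s] by (auto simp: stab_qubits_def)
  show "stab_ident (Inl ((0, - {i}), s)) \<in> stab_qubits isa_qubits 7"
    using stab_ident_bij T by (auto dest: bij_betwE)
  show "stab_pos isa_pos (stab_ident (Inl ((0, - {i}), s))) = 0"
    unfolding stab_ident_pos by (simp add: stab_pos_def tqft_pos_def)
  have "stab_ident (Inl ((0, - {i}), s)) = stab_ident (Inl ((0, - {k}), t)) \<longleftrightarrow>
      (Inl ((0, - {i}), s) :: 3 cell_qubit + (int, 3) vec \<times> nat) = Inl ((0, - {k}), t)"
    by (rule inj_on_eq_iff[OF bij_betw_imp_inj_on[OF stab_ident_bij] T T])
  then show "stab_ident (Inl ((0, - {i}), s)) = stab_ident (Inl ((0, - {k}), t)) \<longleftrightarrow> s = t \<and> i = k"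
    by auto
qed

interpretation cse: edge_system "stab_pos isa_pos" "stab_tr isa_translate" "stab_qubits isa_qubits 7"
  "\<lambda>s i. Inl (0, ((0, {i}), s))"
  using ste.edge_q_Q ste.edge_q_pos
  by unfold_locales (auto simp: stab_qubits_def stab_pos_def)

interpretation emT: embedding tqft_pos tqft_translate tqft_qubits "stab_pos isa_pos" "stab_tr isa_translate" "stab_ident \<circ> Inl"
proof
  have "inj_on stab_ident (Inl ` tqft_qubits)"
    by (rule inj_on_subset[OF bij_betw_imp_inj_on[OF stab_ident_bij]]) (auto simp: stab_qubits_def)
  then show "inj_on (stab_ident \<circ> Inl) tqft_qubits" by (rule comp_inj_on[rotated]) simp
qed (simp add: stab_ident_equivariant)

interpretation emI: embedding isa_pos isa_translate isa_qubits "stab_pos isa_pos" "stab_tr isa_translate" Inl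
  by unfold_locales (auto simp: stab_tr_def)

lemma relabel_PX_PZ: "relabel g (PX q) = PX (g q)" "relabel g (PZ q) = PZ (g q)"
  by (simp_all add: PX_def PZ_def relabel_single)

lemma T_terms_relabel: "map (map_prod (relabel (stab_ident \<circ> Inl)) (relabel (stab_ident \<circ> Inl))) tqf.T_terms = csf.T_terms"
proof -
  let ?r = "relabel (stab_ident \<circ> Inl)"
  have jk: "?r (tqf.j1 s) = csf.j1 s" "?r (tqf.j2 s) = csf.j2 s" "?r (tqf.k0 s) = csf.k0 s" "?r (tqf.k1 s) = csf.k1 s" for s
    by (simp_all only: tqf.j1_def csf.j1_def tqf.j2_def csf.j2_def tqf.k0_def csf.k0_def tqf.k1_def csf.k1_def
        relabel_add emT.relabel_scale relabel_PX_PZ comp_apply)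
  have n: "?r tqf.nA = csf.nA" "?r tqf.nB = csf.nB"
    by (simp_all only: tqf.nA_def csf.nA_def tqf.nB_def csf.nB_def relabel_add emT.relabel_scale jk)
  show ?thesis
    by (simp only: tqf.T_terms_def csf.T_terms_def list.map map_prod_simp relabel_add emT.relabel_scale jk n)
qed

lemma pump_terms_relabel: "map (map_prod (relabel (Inl)) (relabel (Inl))) ste.pump_terms = cse.pump_terms"
proof -
  let ?r = "relabel (Inl) :: stack_qubit pauli \<Rightarrow> (stack_qubit + (int, 3) vec \<times> nat) pauli"
  have a: "?r (ste.a i) = cse.a i" if "i \<in> {..<4}" for i
    using that unfolding ste.less4
    by (elim insertE emptyE; simp add: ste.a_def cse.a_def relabel_add emI.relabel_scale relabel_PX_PZ)
  have "?r (ste.a 0) = cse.a 0" "?r (ste.a 1) = cse.a 1" "?r (ste.a 2) = cse.a 2" "?r (ste.a 3) = cse.a 3"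
    by (rule a; simp)+
  then show ?thesis
    by (simp only: ste.pump_terms_def cse.pump_terms_def Let_def list.map concat.simps append.simps map_prod_simp emI.relabel_scale)
qed

lemma stabilize_TQFT:
  assumes "P \<in> paulis (stab_qubits tqft_qubits 5)"
  shows "relabel stab_ident (stabilize alpha_TQFT P) = csf.T (relabel stab_ident P)"
proof -
  have "relabel stab_ident (stabilize alpha_TQFT P) = relabel stab_ident P +
      cs.lin (map (map_prod (relabel (stab_ident \<circ> Inl)) (relabel (stab_ident \<circ> Inl))) tqf.T_terms) (relabel stab_ident P)"
    by (rule stabilize_lin[OF tq.qubit_system_axioms cs.lattice_qubits_axioms bij_betw_imp_inj_on[OF stab_ident_bij]
          stab_ident_equivariant _ tqf.T_terms_Q assms])
      (simp only: alpha_TQFT_eq_T tqf.T_lin)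
  then show ?thesis by (simp only: T_terms_relabel csf.T_lin)
qed

lemma stabilize_ISA:
  assumes "P \<in> paulis (stab_qubits isa_qubits 7)"
  shows "stabilize alpha_ISA P = cse.pump P"
proof -
  have "relabel id (stabilize alpha_ISA P) = relabel id P +
      cs.lin (map (map_prod (relabel (id \<circ> Inl)) (relabel (id \<circ> Inl))) ste.pump_terms) (relabel id P)"
    by (rule stabilize_lin[OF st.qubit_system_axioms cs.lattice_qubits_axioms inj_on_id _ _ ste.pump_terms_Q assms])
      (simp_all add: stab_tr_def alpha_ISA_pump ste.pump_lin)
  then show ?thesis by (simp only: id_comp pump_terms_relabel cse.pump_lin relabel_id)
qed

abbreviation spare :: "stack_qubit + (int, 3) vec \<times> nat" where "spare \<equiv> Inr (0, 6)"

text \<open>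
  The operators \<open>A\<close> of the layers, completed by the spare qubit to a frame with Gram matrix \<open>theta\<close>.
\<close>

definition isa_frame :: "nat \<Rightarrow> (stack_qubit + (int, 3) vec \<times> nat) pauli" where
  "isa_frame k = (if k < 4 then cse.a k else if k = 4 then PX spare else PZ spare)"

lemma spare_pos: "stab_pos isa_pos spare = 0"
  by (simp add: stab_pos_def)

lemma base_orth:
  assumes "stab_pos isa_pos q = 0" "stab_pos isa_pos q' = 0" "q \<noteq> q'"
  shows "cs.lam (PX q) (PX q') = 0" "cs.lam (PX q) (PZ q') = 0" "cs.lam (PZ q) (PX q') = 0" "cs.lam (PZ q) (PZ q') = 0"
proof -
  show "cs.lam (PX q) (PX q') = 0" "cs.lam (PZ q) (PZ q') = 0" by (rule cs.lam_PX_PZ)+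
  show "cs.lam (PX q) (PZ q') = 0" using assms by (simp add: cs.lam_PX_PZ_base)
  show "cs.lam (PZ q) (PX q') = 0" by (rule cs.lam_zero_sym) (use assms in \<open>simp add: cs.lam_PX_PZ_base\<close>)
qed

lemma a_orth:
  assumes "stab_pos isa_pos q = 0" "\<And>s i. q \<noteq> Inl (0, ((0, {i}), s))" "k \<in> {..<4}"
  shows "cs.lam (PX q) (cse.a k) = 0" "cs.lam (PZ q) (cse.a k) = 0"
proof -
  have o: "cs.lam (PX q) (PX (Inl (0, ((0, {i}), s)))) = 0" "cs.lam (PX q) (PZ (Inl (0, ((0, {i}), s)))) = 0"
    "cs.lam (PZ q) (PX (Inl (0, ((0, {i}), s)))) = 0" "cs.lam (PZ q) (PZ (Inl (0, ((0, {i}), s)))) = 0" for s i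
    by (rule base_orth[OF assms(1) cse.edge_q_pos assms(2)])+
  show "cs.lam (PX q) (cse.a k) = 0" "cs.lam (PZ q) (cse.a k) = 0"
    using assms(3) unfolding cse.less4
    by (elim insertE emptyE; simp add: cse.a_def cs.lam_simps o)+
qed

lemma spare_lam: "cs.lam (PX spare) (PZ spare) = 1" "cs.lam (PZ spare) (PX spare) = 1"
proof -
  show 1: "cs.lam (PX spare) (PZ spare) = 1" by (simp add: cs.lam_PX_PZ_base spare_pos)
  show "cs.lam (PZ spare) (PX spare) = 1" by (metis 1 cs.cnj_lam cs.cnj_1)
qed

lemma gram_isa_frame:
  assumes "i \<in> {..<6}" "k \<in> {..<6}"
  shows "cs.lam (isa_frame i) (isa_frame k) = cs.theta i k"
proof -
  have s: "cs.lam (PX spare) (cse.a k) = 0" "cs.lam (PZ spare) (cse.a k) = 0"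
    "cs.lam (cse.a k) (PX spare) = 0" "cs.lam (cse.a k) (PZ spare) = 0" if "k < 4" for k
  proof -
    have k: "k \<in> {..<4}" using that by simp
    note o = a_orth[of spare, OF spare_pos _ k]
    show "cs.lam (PX spare) (cse.a k) = 0" "cs.lam (PZ spare) (cse.a k) = 0" by (rule o; simp)+
    then show "cs.lam (cse.a k) (PX spare) = 0" "cs.lam (cse.a k) (PZ spare) = 0" by (auto intro: cs.lam_zero_sym)
  qed
  have th: "cs.theta i k = 0" "cs.theta k i = 0" if "i \<in> {..<4}" "k \<in> {4, 5}" for i k
    using that unfolding cse.less4 by (elim insertE emptyE; simp add: cs.theta_def)+
  have th2: "cs.theta 4 4 = 0" "cs.theta 4 5 = 1" "cs.theta 5 4 = 1" "cs.theta 5 5 = 0"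
    by (simp_all add: cs.theta_def)
  have c: "i < 4 \<or> i = 4 \<or> i = 5" if "i \<in> {..<6}" for i :: nat using that by auto
  show ?thesis
    using c[OF assms(1)] c[OF assms(2)]
    by (elim disjE; simp add: isa_frame_def s th th2 spare_lam cs.lam_PX_PZ cse.gram_a)
qed

lemma face_spare: "stab_ident (Inl ((0, - {i}), s)) \<noteq> spare"
  using bij_betw_imp_inj_on[OF stab_ident_bij]
proof -
  have "(if (- {i}) = {1, 2} then 0 else if (- {i}) = {0, 2} then 1 else 2) + (if s = Sp_A then 0 else 3) \<noteq> (6::nat)" for i :: 3
    by simp
  then show ?thesis by (simp add: stab_ident_def)
qed

lemma lam_face_isa_frame:
  assumes "k \<in> {..<6}"
  shows "cs.lam (PX (stab_ident (Inl ((0, - {i}), s)))) (isa_frame k) = 0"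
    "cs.lam (PZ (stab_ident (Inl ((0, - {i}), s)))) (isa_frame k) = 0"
proof -
  let ?q = "stab_ident (Inl ((0, - {i}), s))"
  have "?q \<noteq> Inl (0, ((0, {i'}), s'))" for i' s' by (simp add: stab_ident_def)
  note a = a_orth[of ?q, OF csf.face_q_pos this]
  note b = base_orth[of ?q spare, OF csf.face_q_pos spare_pos face_spare]
  have "k < 4 \<or> k = 4 \<or> k = 5" using assms by auto
  then show "cs.lam (PX ?q) (isa_frame k) = 0" "cs.lam (PZ ?q) (isa_frame k) = 0"
    by (elim disjE; simp add: isa_frame_def a b)+
qed

lemma isa_frame_Q: "k \<in> {..<6} \<Longrightarrow> isa_frame k \<in> paulis (stab_qubits isa_qubits 7)"
proof -
  have "PX spare \<in> paulis (stab_qubits isa_qubits 7)" "PZ spare \<in> paulis (stab_qubits isa_qubits 7)"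
    unfolding PX_def PZ_def by (rule paulis_single; simp add: stab_qubits_def Plus_iff)+
  then show ?thesis using cse.a_Q by (simp add: isa_frame_def)
qed

text \<open>
  Pumping the hyperbolic pair of a single qubit is the same as shifting that qubit.
\<close>

lemma pump_isa_frame:
  "p + cs.scale (1 + mon (ev 2)) (cs.cross cs.theta_inv {..<6} isa_frame isa_frame p) =
    relabel (cs.orbit_shift spare (ev 2)) (cse.pump p)"
proof -
  have o: "cs.lam (PX spare) (cse.a k) = 0" "cs.lam (PZ spare) (cse.a k) = 0" if "k \<in> {..<4}" for k
    by (rule a_orth[of spare, OF spare_pos _ that]; simp)+
  have s: "cs.lam (PX spare) (cse.pump p) = cs.lam (PX spare) p" "cs.lam (PZ spare) (cse.pump p) = cs.lam (PZ spare) p"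
    by (simp_all add: cse.pump_def cs.lam_simps cs.cross_def cs.lam_sum_right o)
  have i: "{..<6} = insert 4 (insert 5 {..<4::nat})" by auto
  have th: "cs.theta_inv i k = 0" "cs.theta_inv k i = 0" if "i \<in> {..<4}" "k \<in> {4, 5}" for i k
    using that unfolding cse.less4 by (elim insertE emptyE; simp add: cs.theta_inv_def)+
  have th2: "cs.theta_inv 4 4 = 0" "cs.theta_inv 4 5 = 1" "cs.theta_inv 5 4 = 1" "cs.theta_inv 5 5 = 0"
    by (simp_all add: cs.theta_inv_def)
  have "cs.cross cs.theta_inv {..<6} isa_frame isa_frame p = cs.cross cs.theta_inv {..<4} cse.a cse.a p
      + (cs.scale (cs.lam (PZ spare) p) (PX spare) + cs.scale (cs.lam (PX spare) p) (PZ spare))"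
    unfolding i cs.cross_def by (simp add: th th2 isa_frame_def add_ac)
  then show ?thesis
    unfolding cs.orbit_shift(2) s by (simp add: cse.pump_def cs.scale_right_distrib add_ac)
qed

lemma TQFT_ISA_equivalent:
  "qca_equivalent tqft_qubits tqft_pos alpha_TQFT isa_qubits isa_pos alpha_ISA"
proof -
  let ?Q = "stab_qubits isa_qubits 7" and ?pos = "stab_pos isa_pos"
  \<comment> \<open>The factor standing in front of the pump in T_pump, with the shift of the spare qubit that the pump of the frame contains.\<close>
  define \<gamma> where "\<gamma> = csf.lower_A \<circ> (csf.swap_rot isa_frame 1 \<circ> (csf.swap_rot isa_frame (mon (ev 2)) \<circ> (csf.T_at_1 \<circ> relabel (cs.orbit_shift spare (ev 2)))))"
  have t: "1 * conj 1 = (1 :: 3 laurent)" "mon (ev 2) * conj (mon (ev 2)) = (1 :: 3 laurent)"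
    by (simp_all add: cs.cnj_1 conj_mon mon_mult mon_0)
  have "circuit_shift_composition ?Q ?pos \<gamma>"
    unfolding \<gamma>_def
    by (intro circuit_shift_comp csf.lower_A_circuit circuit_shift_circuit csf.T_at_1_circuit circuit_shift_shift
        cs.orbit_shift(1) csf.swap_rot_circuit[OF gram_isa_frame lam_face_isa_frame isa_frame_Q t(1)] csf.swap_rot_circuit[OF gram_isa_frame lam_face_isa_frame isa_frame_Q t(2)])
  moreover have "relabel stab_ident (stabilize alpha_TQFT P) = \<gamma> (stabilize alpha_ISA (relabel stab_ident P))"
    if P: "P \<in> paulis (stab_qubits tqft_qubits 5)" for P
  proof -
    have "relabel stab_ident P \<in> paulis ?Q"
      by (rule paulis_relabel[OF P]) (use stab_ident_bij in \<open>auto dest: bij_betwE\<close>)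
    then show ?thesis
      by (simp only: stabilize_TQFT[OF P] stabilize_ISA \<gamma>_def comp_apply pump_isa_frame[symmetric]
          csf.T_pump[OF gram_isa_frame lam_face_isa_frame])
  qed
  ultimately show ?thesis
    unfolding qca_equivalent_def
    by (intro exI[of _ 5] exI[of _ 7] exI[of _ stab_ident] exI[of _ \<gamma>] conjI ballI stab_ident_bij stab_ident_pos)
qed

theorem mainTheorem7:
  shows "clifford_qca tqft_qubits tqft_pos alpha_TQFT
       \<and> translation_invariant tqft_qubits tqft_translate alpha_TQFT
       \<and> (\<exists>!\<alpha>. is_alpha_ISA \<alpha>)
       \<and> clifford_qca isa_qubits isa_pos alpha_ISA
       \<and> translation_invariant isa_qubits isa_translate alpha_ISA
       \<and> qca_equivalent tqft_qubits tqft_pos alpha_TQFT isa_qubits isa_pos alpha_ISA"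
  by (intro conjI tqft_clifford tqft_translation_invariant ex1_alpha_ISA isa_clifford
      isa_translation_invariant TQFT_ISA_equivalent)

end
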